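(* Let $A$ be an $H^*$-Galois left $H$-module algebra over a finite dimensional Hopf algebra $H$ and let $E=\operatorname{End}_HA$ with its Hopf algebra structure. Let $R$ and $\widetilde R$ be mutually corresponding quasitriangular structures on $H$ and $E$. If $A$ is central simple, then $\dim A$ divides $(\operatorname{rk}R)(\operatorname{rk}\widetilde R)$.
   Context: $k$ is a field; unadorned $\otimes$, $\operatorname{Hom}$, $\operatorname{End}$ are over $k$. $H$ is a finite dimensional Hopf algebra over $k$ with $\Delta h=\sum_{(h)}h'\otimes h''$, counit $\varepsilon$, antipode $S$. Algebras are extensions of $k$ (so $A\neq0$, $k=k1_A\subset A$). A left $H$-module algebra $A$ is $H^*$-Galois if the map $\pi:A\otimes H\to\operatorname{End}A$, $\pi(a\otimes h)(b)=a(hb)$, is bijective; equivalently (known fact) if any one of the maps $\pi'(a\otimes h)(b)=(hb)a$ from $A\otimes H$ to $\operatorname{End}A$, $\gamma(a\otimes b)(h)=a(hb)$, $\gamma'(a\otimes b)(h)=(ha)b$ from $A\otimes A$ to $\operatorname{Hom}(H,A)\cong A\otimes H^*$ is bijective. Then $\dim A<\infty$ and $A^H=k$. $E=\operatorname{End}_HA$ acts on $A$ from the left and carries the unique Hopf algebra structure making $A$ a left $E$-module algebra: $\varphi(ab)=\sum_{(\varphi)}\varphi'(a)\varphi''(b)$, $\varepsilon(\varphi)=\varphi(1)$. A quasitriangular structure on a Hopf algebra $H$ is an element $R=\sum_ir'_i\otimes r''_i\in H\otimes H$ with $\Delta^{\mathrm{op}}(h)R=R\Delta(h)$ for all $h\in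 H$, $(\varepsilon\otimes\operatorname{id})(R)=1=(\operatorname{id}\otimes\varepsilon)(R)$, $(\Delta\otimes\operatorname{id})(R)=R_{13}R_{23}$, $(\operatorname{id}\otimes\Delta)(R)=R_{13}R_{12}$. Its rank is $\operatorname{rk}R=\dim R_l=\dim R_r$, where $R_r\subset H$ is the image of $H^*\to H$, $\xi\mapsto\sum_i\langle\xi,r'_i\rangle r''_i$, and $R_l\subset H$ is the image of $\xi\mapsto\sum_i\langle\xi,r''_i\rangle r'_i$. There is a bijective correspondence between quasitriangular structures on $H$ and on $E$ under which $R=\sum_ir'_i\otimes r''_i$ and $\widetilde R=\sum_m\rho'_m\otimes\rho''_m$ correspond to one another if and only if $\sum_i(r''_ib)(r'_ia)=\sum_m(\rho''_ma)(\rho'_mb)$ for all $a,b\in A$. *)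

theory Defs
  imports Complex_Main "HOL-Library.Function_Algebras"
begin

text \<open>
  Vector spaces over a field \<open>'k\<close> are types of class \<open>ab_group_add\<close> with a scalar multiplication
  (locale \<open>vector_space\<close>).  Algebras, Hopf algebras, ... live on a subspace \<open>V\<close> of such a type,
  because $\operatorname{End}_H A$ is a subspace of the function type \<open>'a \<Rightarrow> 'a\<close>.
  Values of maps outside the relevant subspace are irrelevant.
\<close>

definition fun_scale :: "('k \<Rightarrow> 'v \<Rightarrow> 'v) \<Rightarrow> 'k \<Rightarrow> ('x \<Rightarrow> 'v) \<Rightarrow> ('x \<Rightarrow> 'v)"
  where "fun_scale s c f = (\<lambda>x. s c (f x))"

definition linear_on ::
  "('k \<Rightarrow> 'v::ab_group_add \<Rightarrow> 'v) \<Rightarrow> ('k \<Rightarrow> 'w::ab_group_add \<Rightarrow> 'w) \<Rightarrow> 'v set \<Rightarrow> 'w set \<Rightarrow> ('v \<Rightarrow> 'w) \<Rightarrow> bool"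
  where "linear_on s1 s2 V W f \<longleftrightarrow>
    (\<forall>x\<in>V. f x \<in> W) \<and>
    (\<forall>x\<in>V. \<forall>y\<in>V. f (x + y) = f x + f y) \<and>
    (\<forall>c. \<forall>x\<in>V. f (s1 c x) = s2 c (f x))"

definition bilinear_on ::
  "('k \<Rightarrow> 'v::ab_group_add \<Rightarrow> 'v) \<Rightarrow> ('k \<Rightarrow> 'w::ab_group_add \<Rightarrow> 'w) \<Rightarrow> ('k \<Rightarrow> 'x::ab_group_add \<Rightarrow> 'x)
    \<Rightarrow> 'v set \<Rightarrow> 'w set \<Rightarrow> 'x set \<Rightarrow> ('v \<Rightarrow> 'w \<Rightarrow> 'x) \<Rightarrow> bool"
  where "bilinear_on s1 s2 s3 V W X f \<longleftrightarrow>
    (\<forall>w\<in>W. linear_on s1 s3 V X (\<lambda>v. f v w)) \<and> (\<forall>v\<in>V. linear_on s2 s3 W X (f v))"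

definition finite_dim :: "('k::field \<Rightarrow> 'v::ab_group_add \<Rightarrow> 'v) \<Rightarrow> 'v set \<Rightarrow> bool"
  where "finite_dim s V \<longleftrightarrow> (\<exists>B. finite B \<and> module.span s B = V)"

subsection \<open>Tensor products\<close>

text \<open>
  The tensor $v \otimes w$ is encoded as the functional $\beta \mapsto \beta(v,w)$ on bilinear forms
  (and by 0 on functions that are not bilinear forms).  Over a field this embeds $V \otimes W$ into
  the dual of the space of bilinear forms, also for infinite dimensional spaces; the lemma
  \<open>tensor_lift_sum\<close> below shows that the universal property holds.  As bilinear forms on subspaces extend,
  $V \otimes W$ is the same for \<open>V\<close>, \<open>W\<close> as spaces and as subspaces of their types.
\<close>

type_synonym ('v, 'w, 'k) tensor = "('v \<Rightarrow> 'w \<Rightarrow> 'k) \<Rightarrow> 'k"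

definition tens ::
  "('k::field \<Rightarrow> 'v::ab_group_add \<Rightarrow> 'v) \<Rightarrow> ('k \<Rightarrow> 'w::ab_group_add \<Rightarrow> 'w) \<Rightarrow> 'v \<Rightarrow> 'w \<Rightarrow> ('v, 'w, 'k) tensor"
  where "tens s1 s2 v w = (\<lambda>\<beta>. if bilinear_on s1 s2 (*) UNIV UNIV UNIV \<beta> then \<beta> v w else 0)"

abbreviation tensor_scale :: "'k::field \<Rightarrow> ('v, 'w, 'k) tensor \<Rightarrow> ('v, 'w, 'k) tensor"
  where "tensor_scale \<equiv> fun_scale (*)"

definition tensor_space ::
  "('k::field \<Rightarrow> 'v::ab_group_add \<Rightarrow> 'v) \<Rightarrow> ('k \<Rightarrow> 'w::ab_group_add \<Rightarrow> 'w) \<Rightarrow> 'v set \<Rightarrow> 'w set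
    \<Rightarrow> ('v, 'w, 'k) tensor set"
  where "tensor_space s1 s2 V W = module.span tensor_scale {tens s1 s2 v w | v w. v \<in> V \<and> w \<in> W}"

text \<open>
  \<open>tensor_lift s1 s2 V W f\<close> is the linear map on $V \otimes W$ induced by a map \<open>f\<close> that is bilinear on
  $V \times W$, so Sweedler-type sums $\sum_i f(v_i, w_i)$ for $t = \sum_i v_i \otimes w_i$ are
  written \<open>tensor_lift s1 s2 V W f t\<close>.
\<close>

definition tensor_lift ::
  "('k::field \<Rightarrow> 'v::ab_group_add \<Rightarrow> 'v) \<Rightarrow> ('k \<Rightarrow> 'w::ab_group_add \<Rightarrow> 'w) \<Rightarrow> 'v set \<Rightarrow> 'w set
    \<Rightarrow> ('v \<Rightarrow> 'w \<Rightarrow> 'x::ab_group_add) \<Rightarrow> ('v, 'w, 'k) tensor \<Rightarrow> 'x"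
  where "tensor_lift s1 s2 V W f t =
    (THE x. \<exists>ps. set ps \<subseteq> V \<times> W \<and> t = (\<Sum>(v, w)\<leftarrow>ps. tens s1 s2 v w) \<and> x = (\<Sum>(v, w)\<leftarrow>ps. f v w))"

lemma vector_space_fun_scale:
  assumes "vector_space s"
  shows "vector_space (fun_scale s)"
proof -
  interpret vector_space s by fact
  show ?thesis
    by standard (auto simp: fun_scale_def fun_eq_iff algebra_simps)
qed

lemma vector_space_mult: "vector_space ((*) :: 'k::field \<Rightarrow> 'k \<Rightarrow> 'k)"
  by standard (auto simp: algebra_simps)

lemma linear_on_compose:
  assumes "linear_on s1 s2 V W f" and "linear_on s2 s3 W X g"
  shows "linear_on s1 s3 V X (\<lambda>x. g (f x))"
  using assms by (auto simp: linear_on_def)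

lemma linear_iff_linear_on_UNIV:
  assumes "vector_space s1" and "vector_space s2"
  shows "Vector_Spaces.linear s1 s2 f \<longleftrightarrow> linear_on s1 s2 UNIV UNIV f"
  using assms by (auto simp: Vector_Spaces.linear_iff linear_on_def)

lemma exists_projection:
  assumes "vector_space s" and "module.subspace s V"
  obtains p where "linear_on s s UNIV V p" and "\<And>v. v \<in> V \<Longrightarrow> p v = v"
proof -
  interpret vector_space_pair s s using assms(1) by (simp add: vector_space_pair_def)
  have "Vector_Spaces.linear s s (\<lambda>x. x)"
    using assms(1) by (simp add: linear_iff_linear_on_UNIV linear_on_def)
  from linear_exists_left_inverse_on[OF this assms(2)] obtain g
    where g: "g ` UNIV \<subseteq> V" "Vector_Spaces.linear s s g" "\<forall>v\<in>V. g v = v" by auto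
  then have "linear_on s s UNIV V g"
    using assms(1) by (auto simp: linear_iff_linear_on_UNIV linear_on_def)
  with g(3) show ?thesis using that by blast
qed

lemma linear_on_sum_list:
  assumes "linear_on s1 s2 UNIV W f"
  shows "f (\<Sum>x\<leftarrow>xs. g x) = (\<Sum>x\<leftarrow>xs. f (g x))"
proof -
  have add: "f (x + y) = f x + f y" for x y using assms by (simp add: linear_on_def)
  from add[of 0 0] have "f 0 = 0" by simp
  then show ?thesis by (induction xs) (simp_all add: add)
qed

lemma sum_list_fun_apply: "(\<Sum>x\<leftarrow>xs. F x) y = (\<Sum>x\<leftarrow>xs. F x y)"
  for F :: "'a \<Rightarrow> 'b \<Rightarrow> 'c::ab_group_add"
  by (induction xs) simp_all

lemma sum_list_tens_apply:
  assumes "bilinear_on s1 s2 (*) UNIV UNIV UNIV \<beta>"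
  shows "(\<Sum>(v, w)\<leftarrow>ps. tens s1 s2 v w) \<beta> = (\<Sum>(v, w)\<leftarrow>ps. \<beta> v w)"
  using assms by (simp add: sum_list_fun_apply case_prod_unfold tens_def)

lemma sum_list_tens_eqD:
  assumes vs: "vector_space s1" "vector_space s2" "vector_space s3"
    and sub: "module.subspace s1 V" "module.subspace s2 W"
    and f: "bilinear_on s1 s2 s3 V W UNIV f"
    and ps: "set ps \<subseteq> V \<times> W" and qs: "set qs \<subseteq> V \<times> W"
    and eq: "(\<Sum>(v, w)\<leftarrow>ps. tens s1 s2 v w) = (\<Sum>(v, w)\<leftarrow>qs. tens s1 s2 v w)"
  shows "(\<Sum>(v, w)\<leftarrow>ps. f v w) = (\<Sum>(v, w)\<leftarrow>qs. f v w)"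
proof (rule ccontr)
  define d where "d = (\<Sum>(v, w)\<leftarrow>ps. f v w) - (\<Sum>(v, w)\<leftarrow>qs. f v w)"
  assume "\<not> ?thesis"
  then have "d \<noteq> 0" by (simp add: d_def)
  interpret vector_space_pair s3 "(*)"
    using vs vector_space_mult by (simp add: vector_space_pair_def)
  have "vs1.independent {d}" using \<open>d \<noteq> 0\<close> by simp
  from linear_independent_extend[OF this, of "\<lambda>_. 1"] obtain \<phi>
    where \<phi>: "Vector_Spaces.linear s3 (*) \<phi>" "\<phi> d = 1" by auto
  then have lin: "linear_on s3 (*) UNIV UNIV \<phi>"
    by (simp add: linear_iff_linear_on_UNIV vs vector_space_mult)
  obtain p where p: "linear_on s1 s1 UNIV V p" "\<And>v. v \<in> V \<Longrightarrow> p v = v"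
    using exists_projection[OF vs(1) sub(1)] by blast
  obtain q where q: "linear_on s2 s2 UNIV W q" "\<And>v. v \<in> W \<Longrightarrow> q v = v"
    using exists_projection[OF vs(2) sub(2)] by blast
  define \<beta> where "\<beta> = (\<lambda>v w. \<phi> (f (p v) (q w)))"
  have pV: "p v \<in> V" and qW: "q w \<in> W" for v w using p q by (auto simp: linear_on_def)
  have "linear_on s1 (*) UNIV UNIV (\<lambda>v. \<beta> v w)" for w
  proof -
    have "linear_on s1 s3 V UNIV (\<lambda>v. f v (q w))" using f qW by (simp add: bilinear_on_def)
    from linear_on_compose[OF linear_on_compose[OF p(1) this] lin] show ?thesis
      by (simp add: \<beta>_def)
  qed
  moreover have "linear_on s2 (*) UNIV UNIV (\<beta> v)" for v
  proof -
    have "linear_on s2 s3 W UNIV (f (p v))" using f pV by (simp add: bilinear_on_def)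
    from linear_on_compose[OF linear_on_compose[OF q(1) this] lin] show ?thesis
      by (simp add: \<beta>_def)
  qed
  ultimately have \<beta>: "bilinear_on s1 s2 (*) UNIV UNIV UNIV \<beta>"
    by (simp add: bilinear_on_def)
  have *: "(\<Sum>(v, w)\<leftarrow>rs. \<beta> v w) = \<phi> (\<Sum>(v, w)\<leftarrow>rs. f v w)" if "set rs \<subseteq> V \<times> W" for rs
  proof -
    have "(\<Sum>(v, w)\<leftarrow>rs. \<beta> v w) = (\<Sum>(v, w)\<leftarrow>rs. \<phi> (f v w))"
      using that p(2) q(2) by (intro arg_cong[where f = sum_list] map_cong) (auto simp: \<beta>_def)
    then show ?thesis by (simp add: linear_on_sum_list[OF lin] case_prod_unfold)
  qed
  have "\<phi> (\<Sum>(v, w)\<leftarrow>ps. f v w) = \<phi> (\<Sum>(v, w)\<leftarrow>qs. f v w)"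
    using arg_cong[OF eq, of "\<lambda>t. t \<beta>"] by (simp add: sum_list_tens_apply[OF \<beta>] * ps qs)
  moreover have "\<phi> (\<Sum>(v, w)\<leftarrow>ps. f v w) = \<phi> (d + (\<Sum>(v, w)\<leftarrow>qs. f v w))" by (simp add: d_def)
  moreover have "\<dots> = \<phi> d + \<phi> (\<Sum>(v, w)\<leftarrow>qs. f v w)" using lin unfolding linear_on_def by blast
  ultimately show False using \<phi>(2) by simp
qed

lemma tensor_lift_sum:
  assumes "vector_space s1" and "vector_space s2" and "vector_space s3"
    and "module.subspace s1 V" and "module.subspace s2 W"
    and "bilinear_on s1 s2 s3 V W UNIV f"
    and "set ps \<subseteq> V \<times> W"
  shows "tensor_lift s1 s2 V W f (\<Sum>(v, w)\<leftarrow>ps. tens s1 s2 v w) = (\<Sum>(v, w)\<leftarrow>ps. f v w)"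
  unfolding tensor_lift_def
proof (rule the_equality)
  fix x
  assume "\<exists>qs. set qs \<subseteq> V \<times> W \<and>
    (\<Sum>(v, w)\<leftarrow>ps. tens s1 s2 v w) = (\<Sum>(v, w)\<leftarrow>qs. tens s1 s2 v w) \<and> x = (\<Sum>(v, w)\<leftarrow>qs. f v w)"
  then obtain qs where qs: "set qs \<subseteq> V \<times> W"
    "(\<Sum>(v, w)\<leftarrow>ps. tens s1 s2 v w) = (\<Sum>(v, w)\<leftarrow>qs. tens s1 s2 v w)"
    and x: "x = (\<Sum>(v, w)\<leftarrow>qs. f v w)" by blast
  show "x = (\<Sum>(v, w)\<leftarrow>ps. f v w)"
    using sum_list_tens_eqD[OF assms qs] x by simp
qed (rule exI[of _ ps], simp add: assms(7))

definition tensor_mult ::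
  "('k::field \<Rightarrow> 'v::ab_group_add \<Rightarrow> 'v) \<Rightarrow> ('k \<Rightarrow> 'w::ab_group_add \<Rightarrow> 'w) \<Rightarrow> 'v set \<Rightarrow> 'w set
    \<Rightarrow> ('v \<Rightarrow> 'v \<Rightarrow> 'v) \<Rightarrow> ('w \<Rightarrow> 'w \<Rightarrow> 'w)
    \<Rightarrow> ('v, 'w, 'k) tensor \<Rightarrow> ('v, 'w, 'k) tensor \<Rightarrow> ('v, 'w, 'k) tensor"
  where "tensor_mult s1 s2 V W m1 m2 t u =
    tensor_lift s1 s2 V W (\<lambda>x y.
      tensor_lift s1 s2 V W (\<lambda>x' y'. tens s1 s2 (m1 x x') (m2 y y')) u) t"

subsection \<open>Algebras and Hopf algebras\<close>

locale algebra_on = vector_space scale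
  for scale :: "'k::field \<Rightarrow> 'v::ab_group_add \<Rightarrow> 'v" (infixr \<open>*s\<close> 75) +
  fixes V :: "'v set"
    and mult :: "'v \<Rightarrow> 'v \<Rightarrow> 'v" (infixl \<open>\<cdot>\<close> 70)
    and one :: 'v (\<open>\<one>\<close>)
  assumes subspace_carrier: "subspace V"
    and bilinear_mult: "bilinear_on scale scale scale V V V (\<cdot>)"
    and mult_assoc: "\<lbrakk>x \<in> V; y \<in> V; z \<in> V\<rbrakk> \<Longrightarrow> (x \<cdot> y) \<cdot> z = x \<cdot> (y \<cdot> z)"
    and one_closed: "\<one> \<in> V"
    and one_mult: "x \<in> V \<Longrightarrow> \<one> \<cdot> x = x"
    and mult_one: "x \<in> V \<Longrightarrow> x \<cdot> \<one> = x"
    and one_neq_zero: "\<one> \<noteq> 0"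
begin

abbreviation tens2 (infixr \<open>\<otimes>\<close> 73)
  where "x \<otimes> y \<equiv> tens scale scale x y"

abbreviation "V2 \<equiv> tensor_space scale scale V V"

abbreviation "lift2 \<equiv> tensor_lift scale scale V V"

abbreviation mult2 (infixl \<open>\<cdot>\<^sub>2\<close> 70)
  where "t \<cdot>\<^sub>2 u \<equiv> tensor_mult scale scale V V (\<cdot>) (\<cdot>) t u"

text \<open>The triple tensor product is taken to be $V \otimes (V \otimes V)$.\<close>

abbreviation tens3 (\<open>_ \<otimes>\<^sub>3 _ \<otimes>\<^sub>3 _\<close> [74, 74, 74] 73)
  where "x \<otimes>\<^sub>3 y \<otimes>\<^sub>3 z \<equiv> tens scale tensor_scale x (y \<otimes> z)"

abbreviation mult3 (infixl \<open>\<cdot>\<^sub>3\<close> 70)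
  where "t \<cdot>\<^sub>3 u \<equiv> tensor_mult scale tensor_scale V V2 (\<cdot>) (\<cdot>\<^sub>2) t u"

end

locale hopf_algebra_on = algebra_on scale V mult one
  for scale :: "'k::field \<Rightarrow> 'v::ab_group_add \<Rightarrow> 'v" (infixr \<open>*s\<close> 75)
    and V :: "'v set"
    and mult :: "'v \<Rightarrow> 'v \<Rightarrow> 'v" (infixl \<open>\<cdot>\<close> 70)
    and one :: 'v (\<open>\<one>\<close>) +
  fixes \<Delta> :: "'v \<Rightarrow> ('v, 'v, 'k) tensor"
    and \<epsilon> :: "'v \<Rightarrow> 'k"
    and S :: "'v \<Rightarrow> 'v"
  assumes linear_comult: "linear_on scale tensor_scale V V2 \<Delta>"
    and linear_counit: "linear_on scale (*) V UNIV \<epsilon>"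
    and linear_antipode: "linear_on scale scale V V S"
    and coassoc: "h \<in> V \<Longrightarrow>
      lift2 (\<lambda>x y. lift2 (\<lambda>u v. u \<otimes>\<^sub>3 v \<otimes>\<^sub>3 y) (\<Delta> x)) (\<Delta> h) =
      lift2 (\<lambda>x y. lift2 (\<lambda>u v. x \<otimes>\<^sub>3 u \<otimes>\<^sub>3 v) (\<Delta> y)) (\<Delta> h)"
    and counit_left: "h \<in> V \<Longrightarrow> lift2 (\<lambda>x y. \<epsilon> x *s y) (\<Delta> h) = h"
    and counit_right: "h \<in> V \<Longrightarrow> lift2 (\<lambda>x y. \<epsilon> y *s x) (\<Delta> h) = h"
    and comult_mult: "\<lbrakk>g \<in> V; h \<in> V\<rbrakk> \<Longrightarrow> \<Delta> (g \<cdot> h) = \<Delta> g \<cdot>\<^sub>2 \<Delta> h"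
    and comult_one: "\<Delta> \<one> = \<one> \<otimes> \<one>"
    and counit_mult: "\<lbrakk>g \<in> V; h \<in> V\<rbrakk> \<Longrightarrow> \<epsilon> (g \<cdot> h) = \<epsilon> g * \<epsilon> h"
    and counit_one: "\<epsilon> \<one> = 1"
    and antipode_left: "h \<in> V \<Longrightarrow> lift2 (\<lambda>x y. S x \<cdot> y) (\<Delta> h) = \<epsilon> h *s \<one>"
    and antipode_right: "h \<in> V \<Longrightarrow> lift2 (\<lambda>x y. x \<cdot> S y) (\<Delta> h) = \<epsilon> h *s \<one>"

subsection \<open>Quasitriangular structures\<close>

locale quasitriangular_on = hopf_algebra_on scale V mult one \<Delta> \<epsilon> S
  for scale :: "'k::field \<Rightarrow> 'v::ab_group_add \<Rightarrow> 'v" (infixr \<open>*s\<close> 75)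
    and V :: "'v set"
    and mult :: "'v \<Rightarrow> 'v \<Rightarrow> 'v" (infixl \<open>\<cdot>\<close> 70)
    and one :: 'v (\<open>\<one>\<close>)
    and \<Delta> :: "'v \<Rightarrow> ('v, 'v, 'k) tensor"
    and \<epsilon> :: "'v \<Rightarrow> 'k"
    and S :: "'v \<Rightarrow> 'v" +
  fixes R :: "('v, 'v, 'k) tensor"
  assumes R_closed: "R \<in> V2"
    and R_comult: "h \<in> V \<Longrightarrow> lift2 (\<lambda>x y. y \<otimes> x) (\<Delta> h) \<cdot>\<^sub>2 R = R \<cdot>\<^sub>2 \<Delta> h"
    and R_counit_left: "lift2 (\<lambda>x y. \<epsilon> x *s y) R = \<one>"
    and R_counit_right: "lift2 (\<lambda>x y. \<epsilon> y *s x) R = \<one>"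
    and R_comult_left: "lift2 (\<lambda>x y. lift2 (\<lambda>u v. u \<otimes>\<^sub>3 v \<otimes>\<^sub>3 y) (\<Delta> x)) R =
      lift2 (\<lambda>x y. x \<otimes>\<^sub>3 \<one> \<otimes>\<^sub>3 y) R \<cdot>\<^sub>3 lift2 (\<lambda>x y. \<one> \<otimes>\<^sub>3 x \<otimes>\<^sub>3 y) R"
    and R_comult_right: "lift2 (\<lambda>x y. lift2 (\<lambda>u v. x \<otimes>\<^sub>3 u \<otimes>\<^sub>3 v) (\<Delta> y)) R =
      lift2 (\<lambda>x y. x \<otimes>\<^sub>3 \<one> \<otimes>\<^sub>3 y) R \<cdot>\<^sub>3 lift2 (\<lambda>x y. x \<otimes>\<^sub>3 y \<otimes>\<^sub>3 \<one>) R"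

text \<open>
  \<open>left_support\<close> and \<open>right_support\<close> are the subspaces $R_l$ and $R_r$; they have the same dimension,
  the rank of $R$.
\<close>

definition left_support ::
  "('k::field \<Rightarrow> 'v::ab_group_add \<Rightarrow> 'v) \<Rightarrow> 'v set \<Rightarrow> ('v, 'v, 'k) tensor \<Rightarrow> 'v set"
  where "left_support s V R =
    {tensor_lift s s V V (\<lambda>x y. s (\<xi> y) x) R | \<xi>. linear_on s (*) V UNIV \<xi>}"

definition right_support ::
  "('k::field \<Rightarrow> 'v::ab_group_add \<Rightarrow> 'v) \<Rightarrow> 'v set \<Rightarrow> ('v, 'v, 'k) tensor \<Rightarrow> 'v set"
  where "right_support s V R =
    {tensor_lift s s V V (\<lambda>x y. s (\<xi> x) y) R | \<xi>. linear_on s (*) V UNIV \<xi>}"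

definition tensor_rank ::
  "('k::field \<Rightarrow> 'v::ab_group_add \<Rightarrow> 'v) \<Rightarrow> 'v set \<Rightarrow> ('v, 'v, 'k) tensor \<Rightarrow> nat"
  where "tensor_rank s V R = vector_space.dim s (left_support s V R)"

subsection \<open>Module algebras and Galois extensions\<close>

locale module_algebra =
  hopf_algebra_on scale V mult one \<Delta> \<epsilon> S + A: algebra_on scaleA UNIV "(*)" 1
  for scale :: "'k::field \<Rightarrow> 'v::ab_group_add \<Rightarrow> 'v" (infixr \<open>*s\<close> 75)
    and V :: "'v set"
    and mult :: "'v \<Rightarrow> 'v \<Rightarrow> 'v" (infixl \<open>\<cdot>\<close> 70)
    and one :: 'v (\<open>\<one>\<close>)
    and \<Delta> :: "'v \<Rightarrow> ('v, 'v, 'k) tensor"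
    and \<epsilon> :: "'v \<Rightarrow> 'k"
    and S :: "'v \<Rightarrow> 'v"
    and scaleA :: "'k \<Rightarrow> 'a::ring_1 \<Rightarrow> 'a" +
  fixes act :: "'v \<Rightarrow> 'a \<Rightarrow> 'a"
  assumes bilinear_act: "bilinear_on scale scaleA scaleA V UNIV UNIV act"
    and act_mult: "\<lbrakk>g \<in> V; h \<in> V\<rbrakk> \<Longrightarrow> act (g \<cdot> h) a = act g (act h a)"
    and act_one: "act \<one> a = a"
    and act_on_mult: "h \<in> V \<Longrightarrow> act h (a * b) = lift2 (\<lambda>x y. act x a * act y b) (\<Delta> h)"
    and act_on_one: "h \<in> V \<Longrightarrow> act h 1 = scaleA (\<epsilon> h) 1"

definition galois_map ::
  "('k::field \<Rightarrow> 'v::ab_group_add \<Rightarrow> 'v) \<Rightarrow> 'v set \<Rightarrow> ('k \<Rightarrow> 'a::ring_1 \<Rightarrow> 'a) \<Rightarrow> ('v \<Rightarrow> 'a \<Rightarrow> 'a)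
    \<Rightarrow> ('a, 'v, 'k) tensor \<Rightarrow> 'a \<Rightarrow> 'a"
  where "galois_map s V sA act = tensor_lift sA s UNIV V (\<lambda>a h b. a * act h b)"

definition dual_galois ::
  "('k::field \<Rightarrow> 'v::ab_group_add \<Rightarrow> 'v) \<Rightarrow> 'v set \<Rightarrow> ('k \<Rightarrow> 'a::ring_1 \<Rightarrow> 'a) \<Rightarrow> ('v \<Rightarrow> 'a \<Rightarrow> 'a) \<Rightarrow> bool"
  where "dual_galois s V sA act \<longleftrightarrow>
    bij_betw (galois_map s V sA act) (tensor_space sA s UNIV V) {f. Vector_Spaces.linear sA sA f}"

definition module_End ::
  "'v set \<Rightarrow> ('k::field \<Rightarrow> 'a::ab_group_add \<Rightarrow> 'a) \<Rightarrow> ('v \<Rightarrow> 'a \<Rightarrow> 'a) \<Rightarrow> ('a \<Rightarrow> 'a) set"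
  where "module_End V sA act =
    {f. Vector_Spaces.linear sA sA f \<and> (\<forall>h\<in>V. \<forall>a. f (act h a) = act h (f a))}"

text \<open>
  $\sum_i (r''_i b)(r'_i a) = \sum_m (\rho''_m a)(\rho'_m b)$ for all $a, b$, where
  $R = \sum_i r'_i \otimes r''_i$ and $\widetilde R = \sum_m \rho'_m \otimes \rho''_m$ is an element
  of $E \otimes E$ for a space \<open>E\<close> of endomorphisms of $A$.
\<close>

definition corresponding ::
  "('k::field \<Rightarrow> 'v::ab_group_add \<Rightarrow> 'v) \<Rightarrow> 'v set \<Rightarrow> ('k \<Rightarrow> 'a::ring_1 \<Rightarrow> 'a) \<Rightarrow> ('v \<Rightarrow> 'a \<Rightarrow> 'a)
    \<Rightarrow> ('a \<Rightarrow> 'a) set \<Rightarrow> ('v, 'v, 'k) tensor \<Rightarrow> ('a \<Rightarrow> 'a, 'a \<Rightarrow> 'a, 'k) tensor \<Rightarrow> bool"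
  where "corresponding s V sA act E R R' \<longleftrightarrow>
    (\<forall>a b. tensor_lift s s V V (\<lambda>x y. act y b * act x a) R =
      tensor_lift (fun_scale sA) (fun_scale sA) E E (\<lambda>\<phi> \<psi>. \<psi> a * \<phi> b) R')"

subsection \<open>Central simple algebras\<close>

definition two_sided_ideal :: "'a::ring_1 set \<Rightarrow> bool"
  where "two_sided_ideal I \<longleftrightarrow>
    0 \<in> I \<and> (\<forall>x\<in>I. \<forall>y\<in>I. x + y \<in> I) \<and> (\<forall>x\<in>I. \<forall>a. a * x \<in> I \<and> x * a \<in> I)"

definition central_simple :: "('k::field \<Rightarrow> 'a::ring_1 \<Rightarrow> 'a) \<Rightarrow> bool"
  where "central_simple sA \<longleftrightarrow>
    {z. \<forall>a. z * a = a * z} = range (\<lambda>c. sA c 1) \<and>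
    (\<forall>I::'a set. two_sided_ideal I \<longrightarrow> I = {0} \<or> I = UNIV)"

end

theory Submission
  imports Defs "HOL-Algebra.Free_Abelian_Groups"
begin

text \<open>
  The theorem follows from the existence of two commuting copies of $A \otimes A^{op}$, which is a
  full matrix algebra of size $\dim A$, on a space of dimension $(\dim A)(\mathrm{rk} R)(\mathrm{rk} R')$:
  such a space has dimension divisible by $(\dim A)^2$.

  Write $R = \sum_i x_i \otimes y_i$ and $R' = \sum_k p_k \otimes q_k$ with as few terms as possible;
  the numbers of terms are the ranks.  By the hexagon identities the spans of the $y_i$ and of the
  $p_k$ are bialgebras \<open>Y\<close> and \<open>P\<close>, and the families $x_i$ and $q_k$ are dual bases that multiply and
  comultiply by the dual structure constants (\<open>exists_coordinates\<close>).  The correspondence between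
  $R$ and $R'$ says $\sum_i (y_i b)(x_i a) = \sum_k (q_k a)(p_k b)$.  Since
  $\sum_{i,j} x_i S(x_j) \otimes y_i y_j = 1 \otimes 1$, substituting $S(x_j) c$ for \<open>a\<close> and
  $y_j d$ for \<open>b\<close> gives
  $$\sum_{j,k} (q_k S(x_j) c) (p_k y_j d) = d c.$$
  In the smash product of \<open>A\<close> with $Y \otimes P$ this means that
  $\theta(c) = \sum_{j,k} (q_k S(x_j) c) \otimes y_j p_k$ commutes with \<open>A\<close>; moreover $\theta$ is an algebra
  homomorphism from the opposite algebra of \<open>A\<close>.  So the smash product contains $A \otimes A^{op}$, and left
  and right multiplication by this subalgebra are the two commuting copies.

  The formal proof uses the dual space of all linear maps from $Y \otimes P$ to \<open>A\<close>, that is, the families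
  of elements of \<open>A\<close> indexed by the pairs \<open>(j, k)\<close>.  The displayed identity and the duality between
  the structure constants enter through the locale \<open>braided_commutative_dual_actions\<close>; the four commuting
  actions of \<open>A\<close> are compared in \<open>dim_dvd_card_index\<close>.  By \<open>dim_bimodule\<close>, a bimodule over \<open>A\<close> has
  dimension $\dim A$ times that of its centralizer of \<open>A\<close>; this is used twice.

  All this presupposes that \<open>A\<close> has finite dimension.  That follows from the Galois property by a
  cardinality argument (\<open>exists_function_outside_spans\<close>), because the endomorphisms of a space of
  infinite dimension do not form an image of finitely many copies of that space.
\<close>

section \<open>Finite dimension from the Galois property\<close>

lemma sum_fun_apply: "(\<Sum>i\<in>I. f i) x = (\<Sum>i\<in>I. f i x)"
  for f :: "'i \<Rightarrow> 'x \<Rightarrow> 'v::ab_group_add"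
  by (induction I rule: infinite_finite_induct) simp_all

lemma linear_on_sum:
  assumes "linear_on s1 s2 UNIV W f"
  shows "f (\<Sum>i\<in>I. g i) = (\<Sum>i\<in>I. f (g i))"
proof -
  have add: "f (x + y) = f x + f y" for x y using assms by (simp add: linear_on_def)
  from add[of 0 0] have "f 0 = 0" by simp
  then show ?thesis by (induction I rule: infinite_finite_induct) (simp_all add: add)
qed

text \<open>
  A diagonal argument.  Because \<open>X\<close> is infinite and at least as large as \<open>Y\<close>, it contains pairwise disjoint blocks of \<open>|F| + 1\<close>
  points, one for each finite subset \<open>F\<close> of \<open>Y\<close>.  On the block of \<open>F\<close> the functions that \<open>F\<close> names span a space of
  dimension at most \<open>|F|\<close>, so they miss some unit vector, and \<open>\<phi>\<close> is chosen to be that unit vector there.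
  So over any field the dual of a space of infinite dimension has a larger dimension than the space.
\<close>

lemma exists_function_outside_spans:
  fixes g :: "'y \<Rightarrow> 'x \<Rightarrow> 'k::field"
  assumes X: "infinite X" and YX: "Y \<lesssim> X"
  shows "\<exists>\<phi>. \<forall>F \<alpha>. finite F \<longrightarrow> F \<subseteq> Y \<longrightarrow> (\<exists>x\<in>X. \<phi> x \<noteq> (\<Sum>b\<in>F. \<alpha> b * g b x))"
proof -
  interpret seq: vector_space "fun_scale (*) :: 'k \<Rightarrow> (nat \<Rightarrow> 'k) \<Rightarrow> nat \<Rightarrow> 'k"
    by (intro vector_space_fun_scale vector_space_mult)
  have "Fpow Y \<lesssim> X"
  proof -
    obtain j where j: "inj_on j Y" "j ` Y \<subseteq> X" using YX by (auto simp: lepoll_def)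
    have "inj_on (image j) (Fpow Y)" using j(1) by (rule inj_on_image_Fpow)
    moreover have "image j ` Fpow Y \<subseteq> Fpow X" using j(2) by (auto simp: Fpow_def)
    ultimately have "Fpow Y \<lesssim> Fpow X" by (auto simp: lepoll_def)
    with eqpoll_Fpow[OF X] show ?thesis using eqpoll_imp_lepoll lepoll_trans by blast
  qed
  moreover have "(UNIV :: nat set) \<lesssim> X" using X by (simp add: infinite_le_lepoll)
  ultimately have "Fpow Y \<times> (UNIV :: nat set) \<lesssim> X \<times> X" by (rule times_lepoll_mono)
  also have "X \<times> X \<lesssim> X"
    using card_of_Times_same_infinite[OF X] eqpoll_iff_card_of_ordIso eqpoll_imp_lepoll by blast
  finally obtain \<psi> where inj: "inj_on \<psi> (Fpow Y \<times> (UNIV :: nat set))"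
    and \<psi>X: "\<psi> ` (Fpow Y \<times> UNIV) \<subseteq> X" by (auto simp: lepoll_def)
  define row where "row F b = (\<lambda>i. if i \<le> card F then g b (\<psi> (F, i)) else 0)" for F b
  define unit where "unit k = (\<lambda>i::nat. if i = k then 1 else 0 :: 'k)" for k
  have unit_sum: "(\<Sum>k\<le>n. fun_scale (*) (c k) (unit k)) i = (if i \<le> n then c i else 0)" for c n i
    by (simp add: fun_scale_def unit_def sum_fun_apply if_distrib cong: if_cong)
  have "\<exists>k\<le>card F. unit k \<notin> seq.span (row F ` F)" if F: "finite F" for F
  proof (rule ccontr)
    assume "\<not> ?thesis"
    then have sub: "unit ` {..card F} \<subseteq> seq.span (row F ` F)" by auto
    have inj_unit: "inj_on unit {..card F}"
      by (auto simp: inj_on_def unit_def fun_eq_iff split: if_splits)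
    have "seq.independent (unit ` {..card F})"
    proof (rule seq.independent_if_scalars_zero)
      fix f x assume s: "(\<Sum>v\<in>unit ` {..card F}. fun_scale (*) (f v) v) = 0" and x: "x \<in> unit ` {..card F}"
      then obtain k where k: "k \<le> card F" "x = unit k" by auto
      have "(\<Sum>j\<le>card F. fun_scale (*) (f (unit j)) (unit j)) k = 0"
        using s by (simp add: sum.reindex[OF inj_unit] fun_eq_iff)
      then show "f x = 0" using k by (simp only: unit_sum) simp
    qed simp
    from seq.independent_span_bound[OF _ this sub] F
    have "card (unit ` {..card F}) \<le> card (row F ` F)" by simp
    also have "\<dots> \<le> card F" using F by (rule card_image_le)
    finally show False by (simp add: card_image[OF inj_unit])
  qed
  then obtain k where k: "\<And>F. finite F \<Longrightarrow> k F \<le> card F \<and> unit (k F) \<notin> seq.span (row F ` F)"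
    by metis
  define \<phi> where "\<phi> x = (if \<exists>F\<in>Fpow Y. x = \<psi> (F, k F) then 1 else 0 :: 'k)" for x
  have "\<exists>x\<in>X. \<phi> x \<noteq> (\<Sum>b\<in>F. \<alpha> b * g b x)" if F: "finite F" "F \<subseteq> Y" for F \<alpha>
  proof (rule ccontr)
    assume neg: "\<not> ?thesis"
    have FY: "F \<in> Fpow Y" using F by (simp add: Fpow_def)
    have eq: "\<phi> (\<psi> (F, i)) = (\<Sum>b\<in>F. \<alpha> b * g b (\<psi> (F, i)))" for i
      using neg FY subsetD[OF \<psi>X, of "\<psi> (F, i)"] by auto
    have val: "\<phi> (\<psi> (F, i)) = unit (k F) i" for i
      using FY inj by (auto simp: \<phi>_def unit_def inj_on_def)
    have "unit (k F) = (\<Sum>b\<in>F. fun_scale (*) (\<alpha> b) (row F b))"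
    proof
      fix i
      show "unit (k F) i = (\<Sum>b\<in>F. fun_scale (*) (\<alpha> b) (row F b)) i"
        using k[OF F(1)] by (cases "i \<le> card F")
          (simp_all add: sum_fun_apply fun_scale_def row_def eq[symmetric] val, simp add: unit_def)
    qed
    also have "\<dots> \<in> seq.span (row F ` F)"
      by (intro seq.span_sum seq.span_scale seq.span_base) auto
    finally show False using k[OF F(1)] by blast
  qed
  then show ?thesis by blast
qed

text \<open>
  Algebras whose carrier is a whole type, so that the ring operations of the type are available.
\<close>

locale algebra_type = algebra_on scale UNIV "(*)" 1
  for scale :: "'k::field \<Rightarrow> 'a::ring_1 \<Rightarrow> 'a"
begin

lemma scale_mult_left: "scale c a * b = scale c (a * b)"
  and scale_mult_right: "a * scale c b = scale c (a * b)"
  using bilinear_mult by (auto simp: bilinear_on_def linear_on_def)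

lemma exists_functional_one: obtains \<xi> where "Vector_Spaces.linear scale (*) \<xi>" "\<xi> 1 = 1"
proof -
  interpret vector_space_pair scale "(*)"
    using vector_space_axioms vector_space_mult by (simp add: vector_space_pair_def)
  have "independent {1}" using one_neq_zero by simp
  from linear_independent_extend[OF this, of "\<lambda>_. 1"] show ?thesis using that by auto
qed

text \<open>
  If \<open>A\<close> had infinite dimension, then composing with a functional \<open>\<xi>\<close> such that \<open>\<xi> 1 = 1\<close> would present every
  functional on \<open>A\<close> as a finite combination of the functionals \<open>\<lambda>x. \<xi> (b * g h x)\<close>, and there are no more of
  these than elements of a basis.
\<close>

lemma finite_dim_if_finitely_many_operators_generate:
  assumes H: "finite H" and gen: "\<And>f. Vector_Spaces.linear scale scale f \<Longrightarrow> \<exists>c. \<forall>x. f x = (\<Sum>h\<in>H. c h * g h x)"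
  obtains B where "finite B" "independent B" "span B = UNIV"
proof -
  obtain B where B: "independent B" "span B = UNIV"
    using maximal_independent_subset[of UNIV] by (auto simp: top.extremum_unique)
  have "finite B"
  proof (rule ccontr)
    assume inf: "infinite B"
    interpret functional: vector_space_pair scale "(*)"
      using vector_space_axioms vector_space_mult by (simp add: vector_space_pair_def)
    obtain \<xi> where \<xi>: "Vector_Spaces.linear scale (*) \<xi>" "\<xi> 1 = 1"
      by (rule exists_functional_one)
    interpret \<xi>: Vector_Spaces.linear scale "(*)" \<xi> by fact
    have "H \<times> B \<lesssim> B \<times> B"
      using inf H by (intro times_lepoll_mono) (auto intro: finite_lepoll_infinite)
    also have "B \<times> B \<lesssim> B"
      using card_of_Times_same_infinite[OF inf] eqpoll_iff_card_of_ordIso eqpoll_imp_lepoll by blast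
    finally have "H \<times> B \<lesssim> B" .
    from exists_function_outside_spans[OF inf this, of "\<lambda>(h, b) x. \<xi> (b * g h x)"]
    obtain \<phi> where \<phi>: "\<And>F \<alpha>. finite F \<Longrightarrow> F \<subseteq> H \<times> B \<Longrightarrow>
      \<exists>x\<in>B. \<phi> x \<noteq> (\<Sum>p\<in>F. \<alpha> p * (case p of (h, b) \<Rightarrow> \<lambda>x. \<xi> (b * g h x)) x)"
      by blast
    obtain \<Phi> where \<Phi>: "Vector_Spaces.linear scale (*) \<Phi>" "\<And>x. x \<in> B \<Longrightarrow> \<Phi> x = \<phi> x"
      using functional.linear_independent_extend[OF B(1), of \<phi>] by auto
    interpret \<Phi>: Vector_Spaces.linear scale "(*)" \<Phi> by fact
    have "Vector_Spaces.linear scale scale (\<lambda>x. scale (\<Phi> x) 1)"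
      by (simp add: Vector_Spaces.linear_iff vector_space_axioms \<Phi>.add \<Phi>.scale scale_left_distrib)
    from gen[OF this] obtain c where c: "\<And>x. scale (\<Phi> x) 1 = (\<Sum>h\<in>H. c h * g h x)" by auto
    define r where "r h = representation B (c h)" for h
    define S where "S h = {b. r h b \<noteq> 0}" for h
    have S: "finite (S h)" "S h \<subseteq> B" for h
      unfolding S_def r_def using finite_representation representation_ne_zero by auto
    have crep: "c h = (\<Sum>b\<in>S h. scale (r h b) b)" for h
      unfolding S_def r_def using sum_nonzero_representation_eq[OF B(1)] B(2) by simp
    have "\<Phi> x = (\<Sum>p\<in>Sigma H S. r (fst p) (snd p) * (case p of (h, b) \<Rightarrow> \<lambda>x. \<xi> (b * g h x)) x)" for x
    proof -
      have "\<Phi> x = \<xi> (scale (\<Phi> x) 1)" by (simp add: \<xi>(2) \<xi>.scale)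
      also have "\<dots> = (\<Sum>h\<in>H. \<xi> (c h * g h x))" by (simp add: c \<xi>.sum)
      also have "\<dots> = (\<Sum>h\<in>H. \<Sum>b\<in>S h. r h b * \<xi> (b * g h x))"
        by (subst crep) (simp add: sum_distrib_right scale_mult_left \<xi>.sum \<xi>.scale)
      also have "\<dots> = (\<Sum>p\<in>Sigma H S. r (fst p) (snd p) * (case p of (h, b) \<Rightarrow> \<lambda>x. \<xi> (b * g h x)) x)"
        using H S by (subst sum.Sigma) (auto simp: case_prod_unfold)
      finally show ?thesis .
    qed
    moreover have "finite (Sigma H S)" "Sigma H S \<subseteq> H \<times> B" using H S by auto
    ultimately show False using \<phi>[of "Sigma H S" "\<lambda>p. r (fst p) (snd p)"] \<Phi>(2) by metis
  qed
  with B show ?thesis using that by blast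
qed

end

section \<open>Bimodules over a central simple algebra\<close>

context vector_space
begin

lemma indexed_independent:
  fixes v :: "'i \<Rightarrow> 'b"
  assumes fin: "finite I" and ind: "\<forall>c. (\<Sum>i\<in>I. scale (c i) (v i)) = 0 \<longrightarrow> (\<forall>i\<in>I. c i = 0)"
  shows "inj_on v I" and "independent (v ` I)"
proof -
  show inj: "inj_on v I"
  proof (rule inj_onI, rule ccontr)
    fix i j assume ij: "i \<in> I" "j \<in> I" "v i = v j" "i \<noteq> j"
    define c :: "'i \<Rightarrow> 'a" where "c k = (if k = i then 1 else if k = j then -1 else 0)" for k
    have "(\<Sum>k\<in>I. scale (c k) (v k)) = (\<Sum>k\<in>{i, j}. scale (c k) (v k))"
      using ij fin by (intro sum.mono_neutral_right) (auto simp: c_def)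
    also have "\<dots> = 0" using ij by (simp add: c_def)
    finally show False using ind ij by (auto simp: c_def dest!: spec[of _ c])
  qed
  show "independent (v ` I)"
  proof (rule independent_if_scalars_zero)
    fix f x assume "(\<Sum>x\<in>v ` I. scale (f x) x) = 0" "x \<in> v ` I"
    then show "f x = 0" using spec[OF ind, of "\<lambda>i. f (v i)"] by (auto simp: sum.reindex[OF inj])
  qed (simp add: fin)
qed

lemma independent_sum_zero:
  "finite B \<Longrightarrow> independent B \<Longrightarrow> (\<Sum>b\<in>B. scale (c b) b) = 0 \<Longrightarrow> b \<in> B \<Longrightarrow> c b = 0"
  using independent_explicit_finite_subsets by blast

end

locale central_simple_algebra = algebra_type scale
  for scale :: "'k::field \<Rightarrow> 'a::ring_1 \<Rightarrow> 'a" +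
  fixes B :: "'a set"
  assumes central_simple: "central_simple scale"
    and finite_basis: "finite B" and independent_basis: "independent B" and span_basis: "span B = UNIV"
begin

lemma central: "(\<And>a. z * a = a * z) \<Longrightarrow> \<exists>c. z = scale c 1"
  using central_simple unfolding central_simple_def by blast

lemma basis_expansion: "a = (\<Sum>b\<in>B. scale (representation B a b) b)"
  using sum_representation_eq[OF independent_basis _ finite_basis order_refl, of a] span_basis by simp

text \<open>
  The map from $A \otimes A^{op}$ to the endomorphisms of \<open>A\<close> is injective.  The coefficients of a fixed \<open>d\<close> in
  all relations that involve the same elements form a two-sided ideal, so that some relation has
  coefficient 1 at \<open>d\<close>.  Its commutators with elements of \<open>A\<close> are shorter relations, hence trivial, so
  its coefficients are central, that is, scalars; such a relation contradicts linear independence.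
\<close>

lemma multiplications_independent:
  assumes "finite C" "independent C" "\<And>a. (\<Sum>c\<in>C. \<alpha> c * a * c) = 0" "c \<in> C"
  shows "\<alpha> c = 0"
  using assms
proof (induction C arbitrary: \<alpha> c rule: finite_induct)
  case (insert d C)
  have ind: "independent C" using insert.prems(1) independent_mono by blast
  have rel: "\<alpha> d * a * d + (\<Sum>c\<in>C. \<alpha> c * a * c) = 0" for a
    using insert.prems(2)[of a] insert.hyps by simp
  define I where "I = {x. \<exists>\<beta>. \<forall>a. x * a * d + (\<Sum>c\<in>C. \<beta> c * a * c) = 0}"
  have "two_sided_ideal I" unfolding two_sided_ideal_def
  proof (intro conjI ballI allI)
    show "0 \<in> I" unfolding I_def by (auto intro!: exI[of _ "\<lambda>_. 0"])
  next
    fix x y assume "x \<in> I" "y \<in> I"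
    then obtain \<beta> \<gamma> where *: "\<And>a. x * a * d + (\<Sum>c\<in>C. \<beta> c * a * c) = 0"
      "\<And>a. y * a * d + (\<Sum>c\<in>C. \<gamma> c * a * c) = 0" by (auto simp: I_def)
    have "(x + y) * a * d + (\<Sum>c\<in>C. (\<beta> c + \<gamma> c) * a * c) = 0" for a
    proof -
      have "(x + y) * a * d + (\<Sum>c\<in>C. (\<beta> c + \<gamma> c) * a * c)
        = (x * a * d + (\<Sum>c\<in>C. \<beta> c * a * c)) + (y * a * d + (\<Sum>c\<in>C. \<gamma> c * a * c))"
        by (simp add: distrib_right sum.distrib)
      then show ?thesis by (simp only: *) simp
    qed
    then show "x + y \<in> I" unfolding I_def by (auto intro!: exI[of _ "\<lambda>c. \<beta> c + \<gamma> c"])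
  next
    fix x z assume "x \<in> I"
    then obtain \<beta> where *: "\<And>a. x * a * d + (\<Sum>c\<in>C. \<beta> c * a * c) = 0" by (auto simp: I_def)
    have "z * x * a * d + (\<Sum>c\<in>C. z * \<beta> c * a * c) = 0" for a
    proof -
      have "z * x * a * d + (\<Sum>c\<in>C. z * \<beta> c * a * c) = z * (x * a * d + (\<Sum>c\<in>C. \<beta> c * a * c))"
        by (simp add: distrib_left sum_distrib_left mult.assoc)
      then show ?thesis by (simp only: *) simp
    qed
    then show "z * x \<in> I" unfolding I_def by (auto intro!: exI[of _ "\<lambda>c. z * \<beta> c"])
    have "x * z * a * d + (\<Sum>c\<in>C. \<beta> c * z * a * c) = 0" for a
      using *[of "z * a"] by (simp add: mult.assoc)
    then show "x * z \<in> I" unfolding I_def by (auto intro!: exI[of _ "\<lambda>c. \<beta> c * z"])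
  qed
  then have I: "I = {0} \<or> I = UNIV" using central_simple unfolding central_simple_def by blast
  have d0: "\<alpha> d = 0"
  proof (rule ccontr)
    assume "\<alpha> d \<noteq> 0"
    moreover have "\<alpha> d \<in> I" using rel unfolding I_def by blast
    ultimately have "1 \<in> I" using I by auto
    then obtain \<beta> where \<beta>: "\<And>a. a * d + (\<Sum>c\<in>C. \<beta> c * a * c) = 0" by (auto simp: I_def)
    have comm: "z * \<beta> c - \<beta> c * z = 0" if "c \<in> C" for z c
    proof (rule insert.IH[OF ind _ that])
      fix a
      have "(\<Sum>c\<in>C. (z * \<beta> c - \<beta> c * z) * a * c)
          = z * (a * d + (\<Sum>c\<in>C. \<beta> c * a * c)) - (z * a * d + (\<Sum>c\<in>C. \<beta> c * (z * a) * c))"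
        by (simp add: distrib_left sum_distrib_left mult.assoc left_diff_distrib sum_subtractf)
      also have "\<dots> = 0" by (simp only: \<beta>) simp
      finally show "(\<Sum>c\<in>C. (z * \<beta> c - \<beta> c * z) * a * c) = 0" .
    qed
    have "\<exists>k. \<beta> c = scale k 1" if "c \<in> C" for c
      using central[of "\<beta> c"] comm[OF that] by simp
    then obtain k where k: "\<And>c. c \<in> C \<Longrightarrow> \<beta> c = scale (k c) 1" by metis
    define k' where "k' c = (if c = d then 1 else k c)" for c
    have "(\<Sum>c\<in>insert d C. scale (k' c) c) = d + (\<Sum>c\<in>C. \<beta> c * c)"
      using insert.hyps by (auto simp: k'_def k scale_mult_left intro!: sum.cong)
    also have "\<dots> = 0" using \<beta>[of 1] by simp
    finally have "k' d = 0"
      using independent_sum_zero[of "insert d C"] insert.hyps insert.prems(1) by blast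
    then show False by (simp add: k'_def)
  qed
  show ?case
  proof (cases "c = d")
    case False
    then show ?thesis using insert.IH[OF ind, of \<alpha>] rel d0 insert.prems(3) by simp
  qed (simp add: d0)
qed simp

text \<open>
  An element of $A \otimes A^{op}$ is determined by its action on \<open>A\<close>, so identities between elements
  $\sum_i a_i \otimes b_i$ can be checked on \<open>A\<close> and then used in any bimodule, with \<open>F\<close> as the action
  on a fixed vector.
\<close>

lemma enveloping_relation_transfer:
  assumes fin: "finite I" "finite J"
    and eq: "\<And>x. (\<Sum>i\<in>I. a i * x * b i) = (\<Sum>j\<in>J. c j * x * d j)"
    and F: "bilinear_on scale scale sM UNIV UNIV UNIV F" and sM: "vector_space sM"
  shows "(\<Sum>i\<in>I. F (a i) (b i)) = (\<Sum>j\<in>J. F (c j) (d j))"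
proof -
  interpret M: vector_space sM by fact
  let ?r = "representation B"
  have lin: "linear_on scale sM UNIV UNIV (\<lambda>x. F x y)" "linear_on scale sM UNIV UNIV (F x)" for x y
    using F by (simp_all add: bilinear_on_def)
  have scl: "F (scale p x) y = sM p (F x y)" "F x (scale p y) = sM p (F x y)" for p x y
    using lin[of y] lin(2)[of x] by (simp_all add: linear_on_def)
  have exp: "F x y = (\<Sum>k\<in>B. \<Sum>l\<in>B. sM (?r x k * ?r y l) (F k l))" for x y
  proof -
    have "F x y = F (\<Sum>k\<in>B. scale (?r x k) k) (\<Sum>l\<in>B. scale (?r y l) l)"
      using basis_expansion by simp
    also have "\<dots> = (\<Sum>k\<in>B. sM (?r x k) (F k (\<Sum>l\<in>B. scale (?r y l) l)))"
      by (simp only: linear_on_sum[OF lin(1)] scl)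
    also have "\<dots> = (\<Sum>k\<in>B. \<Sum>l\<in>B. sM (?r x k) (sM (?r y l) (F k l)))"
      by (simp only: linear_on_sum[OF lin(2)] scl M.scale_sum_right)
    finally show ?thesis by simp
  qed
  define g where "g k l = (\<Sum>i\<in>I. ?r (a i) k * ?r (b i) l) - (\<Sum>j\<in>J. ?r (c j) k * ?r (d j) l)" for k l
  have bil: "bilinear_on scale scale scale UNIV UNIV UNIV (\<lambda>p q. p * x * q)" for x
    by (auto simp: bilinear_on_def linear_on_def scale_mult_left scale_mult_right distrib_left distrib_right)
  have coll: "(\<Sum>i\<in>I. \<Sum>k\<in>B. \<Sum>l\<in>B. s (?r (a i) k * ?r (b i) l) (G k l))
      - (\<Sum>j\<in>J. \<Sum>k\<in>B. \<Sum>l\<in>B. s (?r (c j) k * ?r (d j) l) (G k l))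
      = (\<Sum>k\<in>B. \<Sum>l\<in>B. s (g k l) (G k l))" if "vector_space s"
    for s :: "'k \<Rightarrow> 'x::ab_group_add \<Rightarrow> 'x" and G
  proof -
    interpret S: vector_space s by fact
    have "(\<Sum>i\<in>I. \<Sum>k\<in>B. \<Sum>l\<in>B. s (?r (a i) k * ?r (b i) l) (G k l))
        = (\<Sum>k\<in>B. \<Sum>l\<in>B. \<Sum>i\<in>I. s (?r (a i) k * ?r (b i) l) (G k l))"
      by (subst sum.swap, rule sum.cong[OF refl], rule sum.swap)
    moreover have "(\<Sum>j\<in>J. \<Sum>k\<in>B. \<Sum>l\<in>B. s (?r (c j) k * ?r (d j) l) (G k l))
        = (\<Sum>k\<in>B. \<Sum>l\<in>B. \<Sum>j\<in>J. s (?r (c j) k * ?r (d j) l) (G k l))"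
      by (subst sum.swap, rule sum.cong[OF refl], rule sum.swap)
    ultimately show ?thesis
      by (simp add: g_def S.scale_left_diff_distrib sum_subtractf S.scale_sum_left)
  qed
  have exp': "k * x * l = (\<Sum>p\<in>B. \<Sum>q\<in>B. scale (?r k p * ?r l q) (p * x * q))" for k x l
  proof -
    have "k * x * l = (\<Sum>p\<in>B. scale (?r k p) p) * x * (\<Sum>q\<in>B. scale (?r l q) q)"
      using basis_expansion by simp
    also have "\<dots> = (\<Sum>p\<in>B. scale (?r k p) p * x * (\<Sum>q\<in>B. scale (?r l q) q))"
      by (simp only: sum_distrib_right)
    finally show ?thesis
      by (simp only: sum_distrib_left scale_mult_left scale_mult_right scale_scale mult.commute)
  qed
  have "(\<Sum>l\<in>B. (\<Sum>k\<in>B. scale (g k l) k) * x * l) = 0" for x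
  proof -
    have "(\<Sum>l\<in>B. (\<Sum>k\<in>B. scale (g k l) k) * x * l) = (\<Sum>k\<in>B. \<Sum>l\<in>B. scale (g k l) (k * x * l))"
      by (subst sum.swap) (simp add: sum_distrib_right scale_mult_left)
    also have "\<dots> = (\<Sum>i\<in>I. a i * x * b i) - (\<Sum>j\<in>J. c j * x * d j)"
      by (simp only: coll[OF vector_space_axioms, symmetric] exp'[symmetric])
    finally show ?thesis using eq by simp
  qed
  then have "(\<Sum>k\<in>B. scale (g k l) k) = 0" if "l \<in> B" for l
    using that multiplications_independent[OF finite_basis independent_basis,
        of "\<lambda>l. \<Sum>k\<in>B. scale (g k l) k"] by blast
  then have "g k l = 0" if "k \<in> B" "l \<in> B" for k l
    using independent_sum_zero[OF finite_basis independent_basis, of "\<lambda>k. g k l"] that by blast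
  then have "(\<Sum>k\<in>B. \<Sum>l\<in>B. sM (g k l) (F k l)) = 0" by simp
  then show ?thesis
    by (simp only: coll[OF sM, symmetric] exp[symmetric]) simp
qed

text \<open>
  The $(\dim A)^2$ independent two-sided multiplications exhaust the endomorphisms of \<open>A\<close>; in particular
  they combine to the maps that pick a coordinate and return it as a scalar.
\<close>

lemma coordinate_functionals_enveloping:
  "\<exists>\<beta>. \<forall>j\<in>B. \<forall>x. (\<Sum>(k, l)\<in>B \<times> B. scale (\<beta> j k l) k * x * l) = scale (representation B x j) 1"
proof -
  let ?s = "fun_scale scale :: 'k \<Rightarrow> ('a \<Rightarrow> 'a) \<Rightarrow> 'a \<Rightarrow> 'a"
  let ?r = "representation B"
  interpret E: vector_space ?s by (intro vector_space_fun_scale vector_space_axioms)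
  define e :: "'a \<times> 'a \<Rightarrow> 'a \<Rightarrow> 'a" where "e = (\<lambda>(k, l) x. k * x * l)"
  define m :: "'a \<times> 'a \<Rightarrow> 'a \<Rightarrow> 'a" where "m = (\<lambda>(k, l) x. scale (?r x k) l)"
  have r_lin: "?r (x + y) b = ?r x b + ?r y b" "?r (scale c x) b = c * ?r x b" for x y b c
    using representation_add[OF independent_basis] representation_scale[OF independent_basis] span_basis
    by auto
  have fin: "finite (B \<times> B)" using finite_basis by simp
  have indep: "\<forall>c. (\<Sum>p\<in>B \<times> B. ?s (c p) (e p)) = 0 \<longrightarrow> (\<forall>p\<in>B \<times> B. c p = 0)"
  proof (intro allI impI ballI)
    fix c p assume 0: "(\<Sum>p\<in>B \<times> B. ?s (c p) (e p)) = 0" and p: "p \<in> B \<times> B"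
    have "(\<Sum>l\<in>B. (\<Sum>k\<in>B. scale (c (k, l)) k) * x * l) = 0" for x
    proof -
      have "(\<Sum>l\<in>B. (\<Sum>k\<in>B. scale (c (k, l)) k) * x * l)
          = (\<Sum>k\<in>B. \<Sum>l\<in>B. scale (c (k, l)) (k * x * l))"
        by (subst sum.swap) (simp add: sum_distrib_right scale_mult_left)
      also have "\<dots> = (\<Sum>p\<in>B \<times> B. ?s (c p) (e p)) x"
        by (simp add: sum_fun_apply fun_scale_def e_def sum.cartesian_product case_prod_unfold)
      finally show ?thesis using 0 by simp
    qed
    then have "(\<Sum>k\<in>B. scale (c (k, l)) k) = 0" if "l \<in> B" for l
      using that multiplications_independent[OF finite_basis independent_basis,
          of "\<lambda>l. \<Sum>k\<in>B. scale (c (k, l)) k"] by blast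
    then show "c p = 0"
      using p independent_sum_zero[OF finite_basis independent_basis, of "\<lambda>k. c (k, snd p)" "fst p"]
      by (cases p) auto
  qed
  note inj = E.indexed_independent(1)[OF fin indep] and ind = E.indexed_independent(2)[OF fin indep]
  have span_m: "f \<in> E.span (m ` (B \<times> B))" if f: "Vector_Spaces.linear scale scale f" for f
  proof -
    have f': "linear_on scale scale UNIV UNIV f"
      using f by (simp add: linear_iff_linear_on_UNIV vector_space_axioms)
    then have f_scale: "f (scale c x) = scale c (f x)" for c x by (simp add: linear_on_def)
    have "f = (\<Sum>(k, l)\<in>B \<times> B. ?s (?r (f k) l) (m (k, l)))"
    proof
      fix x
      have "f x = f (\<Sum>k\<in>B. scale (?r x k) k)" using basis_expansion by simp
      also have "\<dots> = (\<Sum>k\<in>B. scale (?r x k) (f k))"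
        by (simp only: linear_on_sum[OF f'] f_scale)
      also have "\<dots> = (\<Sum>k\<in>B. scale (?r x k) (\<Sum>l\<in>B. scale (?r (f k) l) l))"
        using basis_expansion by simp
      also have "\<dots> = (\<Sum>k\<in>B. \<Sum>l\<in>B. scale (?r (f k) l) (scale (?r x k) l))"
        by (simp add: scale_sum_right mult.commute)
      also have "\<dots> = (\<Sum>(k, l)\<in>B \<times> B. ?s (?r (f k) l) (m (k, l))) x"
        by (simp add: sum_fun_apply fun_scale_def m_def sum.cartesian_product case_prod_unfold)
      finally show "f x = (\<Sum>(k, l)\<in>B \<times> B. ?s (?r (f k) l) (m (k, l))) x" .
    qed
    also have "\<dots> \<in> E.span (m ` (B \<times> B))"
      unfolding case_prod_unfold by (intro E.span_sum E.span_scale E.span_base) auto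
    finally show ?thesis .
  qed
  have lin_e: "Vector_Spaces.linear scale scale (e p)" for p
    by (auto simp: Vector_Spaces.linear_iff e_def vector_space_axioms distrib_left distrib_right
        scale_mult_left scale_mult_right split: prod.split)
  have all: "f \<in> E.span (e ` (B \<times> B))" if f: "Vector_Spaces.linear scale scale f" for f
  proof (rule ccontr)
    assume no: "f \<notin> E.span (e ` (B \<times> B))"
    then have "E.independent (insert f (e ` (B \<times> B)))" using ind by (rule E.independent_insertI)
    moreover have "insert f (e ` (B \<times> B)) \<subseteq> E.span (m ` (B \<times> B))" using span_m f lin_e by auto
    ultimately have "card (insert f (e ` (B \<times> B))) \<le> card (m ` (B \<times> B))"
      using E.independent_span_bound[of "m ` (B \<times> B)"] fin by blast
    also have "\<dots> \<le> card (B \<times> B)" using fin by (rule card_image_le)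
    also have "\<dots> = card (e ` (B \<times> B))" using inj by (simp add: card_image)
    finally have "card (insert f (e ` (B \<times> B))) \<le> card (e ` (B \<times> B))" .
    moreover have "f \<notin> e ` (B \<times> B)"
    proof
      assume "f \<in> e ` (B \<times> B)"
      then have "f \<in> E.span (e ` (B \<times> B))" by (rule E.span_base)
      with no show False by contradiction
    qed
    then have "card (insert f (e ` (B \<times> B))) = Suc (card (e ` (B \<times> B)))"
      by (rule card_insert_disjoint[OF finite_imageI[OF fin]])
    ultimately show False by linarith
  qed
  have "\<exists>c. \<forall>x. (\<Sum>(k, l)\<in>B \<times> B. scale (c k l) k * x * l) = scale (?r x j) 1" for j
  proof -
    have "Vector_Spaces.linear scale scale (\<lambda>x. scale (?r x j) 1)"
      by (simp add: Vector_Spaces.linear_iff vector_space_axioms r_lin scale_left_distrib)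
    from all[OF this] obtain u where u: "(\<lambda>x. scale (?r x j) 1) = (\<Sum>v\<in>e ` (B \<times> B). ?s (u v) v)"
      using fin by (auto simp: E.span_finite)
    show ?thesis
    proof (intro exI[of _ "\<lambda>k l. u (e (k, l))"] allI)
      fix x
      show "(\<Sum>(k, l)\<in>B \<times> B. scale (u (e (k, l))) k * x * l) = scale (?r x j) 1"
        using fun_cong[OF u, of x] inj
        by (simp add: sum.reindex sum_fun_apply fun_scale_def e_def case_prod_unfold scale_mult_left)
    qed
  qed
  then obtain \<beta> where "\<forall>j. \<forall>x. (\<Sum>(k, l)\<in>B \<times> B. scale (\<beta> j k l) k * x * l) = scale (?r x j) 1"
    using choice[of "\<lambda>j c. \<forall>x. (\<Sum>(k, l)\<in>B \<times> B. scale (c k l) k * x * l) = scale (?r x j) 1"] by blast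
  then show ?thesis by blast
qed

text \<open>
  With the coefficients of the preceding lemma the elements $p_j(w) = \sum_{k,b} \beta_{jkb}\, k w b$
  commute with \<open>A\<close>, and $w = \sum_j j \, p_j(w)$, where \<open>j\<close> runs through the basis of \<open>A\<close>.  Hence the bimodule
  is the tensor product of \<open>A\<close> with its centralizer of \<open>A\<close>.
\<close>

lemma dim_bimodule:
  fixes sM :: "'k \<Rightarrow> 'm::ab_group_add \<Rightarrow> 'm"
  assumes sM: "vector_space sM" and W: "module.subspace sM W"
    and T: "finite T" "W \<subseteq> module.span sM T"
    and l: "bilinear_on scale sM sM UNIV W W l" and r: "bilinear_on scale sM sM UNIV W W r"
    and l_mult: "\<And>a b w. w \<in> W \<Longrightarrow> l (a * b) w = l a (l b w)" and l_one: "\<And>w. w \<in> W \<Longrightarrow> l 1 w = w"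
    and r_mult: "\<And>a b w. w \<in> W \<Longrightarrow> r (a * b) w = r b (r a w)" and r_one: "\<And>w. w \<in> W \<Longrightarrow> r 1 w = w"
    and comm: "\<And>a b w. w \<in> W \<Longrightarrow> l a (r b w) = r b (l a w)"
  shows "vector_space.dim sM W = card B * vector_space.dim sM {w \<in> W. \<forall>a. l a w = r a w}"
proof -
  interpret M: vector_space sM by fact
  let ?Z = "{w \<in> W. \<forall>a. l a w = r a w}"
  have W_add: "v + w \<in> W" if "v \<in> W" "w \<in> W" for v w
    using W that by (auto simp: M.subspace_def)
  have W_scale: "sM c v \<in> W" if "v \<in> W" for v c
    using W that by (auto simp: M.subspace_def)
  have W_sum: "(\<Sum>i\<in>I. f i) \<in> W" if "\<And>i. i \<in> I \<Longrightarrow> f i \<in> W" for I and f :: "'i \<Rightarrow> 'm"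
    using M.subspace_sum[OF W, of I f] that by blast
  have l_closed: "l a w \<in> W" and r_closed: "r a w \<in> W" if "w \<in> W" for a w
    using l r that by (auto simp: bilinear_on_def linear_on_def)
  have l_lin: "l (a + b) w = l a w + l b w" "l (scale c a) w = sM c (l a w)"
      "l a (v + w) = l a v + l a w" "l a (sM c w) = sM c (l a w)"
    and r_lin: "r (a + b) w = r a w + r b w" "r (scale c a) w = sM c (r a w)"
      "r a (v + w) = r a v + r a w" "r a (sM c w) = sM c (r a w)"
    if "v \<in> W" "w \<in> W" for a b c v w
    using l r that by (auto simp: bilinear_on_def linear_on_def)
  have l_sum: "l a (\<Sum>i\<in>I. f i) = (\<Sum>i\<in>I. l a (f i))"
    and r_sum: "r a (\<Sum>i\<in>I. f i) = (\<Sum>i\<in>I. r a (f i))"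
    if "\<And>i. i \<in> I \<Longrightarrow> f i \<in> W" for a I and f :: "'i \<Rightarrow> 'm"
  proof -
    have 0: "l a 0 = 0" "r a 0 = 0" using l_lin(4)[of 0 0 a 0] r_lin(4)[of 0 0 a 0] M.subspace_0[OF W] by auto
    have "l a (\<Sum>i\<in>I. f i) = (\<Sum>i\<in>I. l a (f i)) \<and> r a (\<Sum>i\<in>I. f i) = (\<Sum>i\<in>I. r a (f i))"
      using that by (induction I rule: infinite_finite_induct) (simp_all add: 0 l_lin r_lin W_sum)
    then show "l a (\<Sum>i\<in>I. f i) = (\<Sum>i\<in>I. l a (f i))" "r a (\<Sum>i\<in>I. f i) = (\<Sum>i\<in>I. r a (f i))" by auto
  qed
  obtain \<beta> where \<beta>: "\<And>j x. j \<in> B \<Longrightarrow>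
    (\<Sum>(k, l)\<in>B \<times> B. scale (\<beta> j k l) k * x * l) = scale (representation B x j) 1"
    using coordinate_functionals_enveloping by blast
  define F where "F w a b = r b (l a w)" for w a b
  have F: "bilinear_on scale scale sM UNIV UNIV UNIV (F w)" if "w \<in> W" for w
    using that by (auto simp: F_def bilinear_on_def linear_on_def l_lin[OF that that] r_lin l_closed)
  define p where "p j w = (\<Sum>(k, b)\<in>B \<times> B. F w (scale (\<beta> j k b) k) b)" for j w
  have F_closed: "w \<in> W \<Longrightarrow> F w a b \<in> W" for w a b by (simp add: F_def l_closed r_closed)
  have p_closed: "w \<in> W \<Longrightarrow> p j w \<in> W" for j w
    unfolding p_def by (intro W_sum) (auto simp: F_closed)
  have l_F: "l z (F w a b) = F w (z * a) b" and r_F: "r z (F w a b) = F w a (b * z)" if "w \<in> W" for z w a b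
    using that by (simp_all add: F_def comm l_mult r_mult l_closed)
  have fin: "finite (B \<times> B)" using finite_basis by simp
  have p_inv: "p j w \<in> ?Z" if w: "w \<in> W" and j: "j \<in> B" for j w
  proof -
    have "l z (p j w) = r z (p j w)" for z
    proof -
      have "l z (p j w) = (\<Sum>q\<in>B \<times> B. F w (z * scale (\<beta> j (fst q) (snd q)) (fst q)) (snd q))"
        unfolding p_def using w by (subst l_sum) (auto simp: F_closed l_F case_prod_unfold)
      also have "\<dots> = (\<Sum>q\<in>B \<times> B. F w (scale (\<beta> j (fst q) (snd q)) (fst q)) (snd q * z))"
      proof (rule enveloping_relation_transfer[OF fin fin _ F[OF w] sM])
        fix x
        have "(\<Sum>q\<in>B \<times> B. z * scale (\<beta> j (fst q) (snd q)) (fst q) * x * snd q)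
          = z * (\<Sum>(k, b)\<in>B \<times> B. scale (\<beta> j k b) k * x * b)"
          by (simp add: sum_distrib_left case_prod_unfold mult.assoc)
        also have "\<dots> = (\<Sum>(k, b)\<in>B \<times> B. scale (\<beta> j k b) k * x * b) * z"
          by (simp only: \<beta>[OF j]) (simp add: scale_mult_left scale_mult_right)
        finally show "(\<Sum>q\<in>B \<times> B. z * scale (\<beta> j (fst q) (snd q)) (fst q) * x * snd q)
          = (\<Sum>q\<in>B \<times> B. scale (\<beta> j (fst q) (snd q)) (fst q) * x * (snd q * z))"
          by (simp add: sum_distrib_right case_prod_unfold mult.assoc)
      qed
      also have "\<dots> = r z (p j w)"
        unfolding p_def using w by (subst r_sum) (auto simp: F_closed r_F case_prod_unfold)
      finally show ?thesis .
    qed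
    then show ?thesis using p_closed[OF w] by blast
  qed
  have expand: "w = (\<Sum>j\<in>B. l j (p j w))" if w: "w \<in> W" for w
  proof -
    have "w = F w 1 1" using w by (simp add: F_def l_one r_one)
    also have "\<dots> = (\<Sum>i\<in>{()}. F w 1 1)" by simp
    also have "\<dots> = (\<Sum>q\<in>B \<times> (B \<times> B).
      F w (fst q * scale (\<beta> (fst q) (fst (snd q)) (snd (snd q))) (fst (snd q))) (snd (snd q)))"
    proof (rule enveloping_relation_transfer[OF _ _ _ F[OF w] sM])
      fix x
      have "(\<Sum>q\<in>B \<times> (B \<times> B).
          fst q * scale (\<beta> (fst q) (fst (snd q)) (snd (snd q))) (fst (snd q)) * x * snd (snd q))
        = (\<Sum>j\<in>B. j * (\<Sum>(k, b)\<in>B \<times> B. scale (\<beta> j k b) k * x * b))"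
        by (simp add: sum.cartesian_product' sum_distrib_left case_prod_unfold mult.assoc)
      also have "\<dots> = (\<Sum>j\<in>B. scale (representation B x j) j)"
        by (intro sum.cong refl, subst \<beta>) (simp_all add: scale_mult_right)
      finally show "(\<Sum>i\<in>{()}. 1 * x * 1) = (\<Sum>q\<in>B \<times> (B \<times> B).
          fst q * scale (\<beta> (fst q) (fst (snd q)) (snd (snd q))) (fst (snd q)) * x * snd (snd q))"
        using basis_expansion[of x] by simp
    qed (use finite_basis in auto)
    also have "\<dots> = (\<Sum>j\<in>B. \<Sum>q\<in>B \<times> B. F w (j * scale (\<beta> j (fst q) (snd q)) (fst q)) (snd q))"
      by (simp add: sum.cartesian_product case_prod_unfold)
    also have "\<dots> = (\<Sum>j\<in>B. l j (p j w))"
      unfolding p_def using w by (subst l_sum) (auto simp: F_closed l_F case_prod_unfold)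
    finally show ?thesis .
  qed
  have p_l: "p i (l b z) = sM (representation B b i) z" if z: "z \<in> ?Z" and i: "i \<in> B" for i b z
  proof -
    have zW: "z \<in> W" and z_inv: "l a z = r a z" for a using z by auto
    have "p i (l b z) = (\<Sum>(k, d)\<in>B \<times> B. l (scale (\<beta> i k d) k * b * d) z)"
      unfolding p_def F_def using zW
      by (intro sum.cong refl) (auto simp: l_mult l_closed r_closed comm[symmetric] z_inv[symmetric])
    also have "\<dots> = l (\<Sum>(k, d)\<in>B \<times> B. scale (\<beta> i k d) k * b * d) z"
    proof -
      have "linear_on scale sM UNIV W (\<lambda>a. l a z)" using l zW by (simp add: bilinear_on_def)
      from linear_on_sum[OF this, symmetric] show ?thesis unfolding case_prod_unfold .
    qed
    also have "\<dots> = sM (representation B b i) z" using i zW by (simp add: \<beta> l_lin l_one)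
    finally show ?thesis .
  qed
  have p_add: "p j (v + w) = p j v + p j w" if "v \<in> W" "w \<in> W" for j v w
    using that by (simp add: p_def F_def l_lin(3)[OF that] r_lin(3) l_closed sum.distrib case_prod_unfold)
  have p_scale: "p j (sM c v) = sM c (p j v)" if "v \<in> W" for j v c
    using that by (simp add: p_def F_def l_lin(4)[OF that that] r_lin(4)[OF l_closed[OF that] l_closed[OF that]]
        case_prod_unfold M.scale_sum_right)
  have p_sum: "p j (\<Sum>i\<in>I. f i) = (\<Sum>i\<in>I. p j (f i))"
    if "\<And>i. i \<in> I \<Longrightarrow> f i \<in> W" for j I and f :: "'i \<Rightarrow> 'm"
  proof -
    have "p j 0 = 0" using p_scale[of 0 j 0] M.subspace_0[OF W] by auto
    then show ?thesis
      using that by (induction I rule: infinite_finite_induct) (simp_all add: p_add W_sum)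
  qed
  obtain C where C: "C \<subseteq> ?Z" "M.independent C" "?Z \<subseteq> M.span C" "card C = M.dim ?Z"
    using M.basis_exists by blast
  have finC: "finite C" using M.independent_span_bound[OF T(1) C(2)] C(1) T(2) by blast
  define v where "v = (\<lambda>(j, z). l j z)"
  have finBC: "finite (B \<times> C)" using finite_basis finC by simp
  have vW: "v q \<in> W" if "q \<in> B \<times> C" for q
    using that subsetD[OF C(1)] by (auto simp: v_def intro!: l_closed)
  have ind: "\<forall>c. (\<Sum>q\<in>B \<times> C. sM (c q) (v q)) = 0 \<longrightarrow> (\<forall>q\<in>B \<times> C. c q = 0)"
  proof (intro allI impI ballI)
    fix c q assume 0: "(\<Sum>q\<in>B \<times> C. sM (c q) (v q)) = 0" and q: "q \<in> B \<times> C"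
    then obtain i y where iz: "q = (i, y)" "i \<in> B" "y \<in> C" by auto
    have "0 = p i (\<Sum>q\<in>B \<times> C. sM (c q) (v q))"
      using p_scale[of 0 i 0] M.subspace_0[OF W] 0 by auto
    also have "\<dots> = (\<Sum>q\<in>B \<times> C. p i (sM (c q) (v q)))"
      using vW W_scale by (intro p_sum) blast
    also have "\<dots> = (\<Sum>(j, z)\<in>B \<times> C. if j = i then sM (c (i, z)) z else 0)"
    proof (intro sum.cong refl)
      fix q assume q: "q \<in> B \<times> C"
      obtain j z where jz: "q = (j, z)" "j \<in> B" "z \<in> C" "z \<in> ?Z" using q C(1) by auto
      have "p i (sM (c q) (v q)) = sM (c q) (p i (v q))" using vW[OF q] by (rule p_scale)
      also have "p i (v q) = sM (representation B j i) z"
        unfolding v_def using p_l[OF jz(4) iz(2)] jz(1) by simp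
      finally show "p i (sM (c q) (v q)) = (case q of (j, z) \<Rightarrow> if j = i then sM (c (i, z)) z else 0)"
        using jz by (simp add: representation_basis[OF independent_basis])
    qed
    also have "\<dots> = (\<Sum>j\<in>B. \<Sum>z\<in>C. if j = i then sM (c (i, z)) z else 0)"
      by (rule sum.cartesian_product[symmetric])
    also have "\<dots> = (\<Sum>z\<in>C. sM (c (i, z)) z)"
      using iz finite_basis by (subst sum.swap) simp
    finally have "(\<Sum>z\<in>C. sM (c (i, z)) z) = 0" by simp
    then show "c q = 0" using M.independent_sum_zero[OF finC C(2), of "\<lambda>z. c (i, z)"] iz by simp
  qed
  note inj = M.indexed_independent(1)[OF finBC ind] and indep = M.indexed_independent(2)[OF finBC ind]
  have "v ` (B \<times> C) \<subseteq> W" using vW by blast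
  moreover have "W \<subseteq> M.span (v ` (B \<times> C))"
  proof
    fix w assume w: "w \<in> W"
    have "l j z \<in> M.span (v ` (B \<times> C))" if j: "j \<in> B" and z: "z \<in> ?Z" for j z
    proof -
      have zC: "z \<in> M.span C" using z C(3) by blast
      then obtain u where u: "z = (\<Sum>y\<in>C. sM (u y) y)" using M.span_finite[OF finC] by auto
      have CW: "y \<in> C \<Longrightarrow> y \<in> W" for y using C(1) by blast
      have "l j z = (\<Sum>y\<in>C. l j (sM (u y) y))"
        unfolding u using CW W_scale by (intro l_sum) blast
      also have "\<dots> = (\<Sum>y\<in>C. sM (u y) (v (j, y)))"
        by (intro sum.cong refl) (simp add: v_def l_lin(4)[OF CW CW])
      also have "\<dots> \<in> M.span (v ` (B \<times> C))"
        using j by (intro M.span_sum M.span_scale M.span_base) auto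
      finally show ?thesis .
    qed
    then have "(\<Sum>j\<in>B. l j (p j w)) \<in> M.span (v ` (B \<times> C))"
      using p_inv[OF w] by (intro M.span_sum) blast
    then show "w \<in> M.span (v ` (B \<times> C))" using expand[OF w] by simp
  qed
  ultimately have "M.dim W = card (v ` (B \<times> C))" using M.basis_card_eq_dim[of "v ` (B \<times> C)" W] indep by simp
  also have "\<dots> = card B * M.dim ?Z" by (simp add: card_image[OF inj] card_cartesian_product C(4))
  finally show ?thesis .
qed

end

section \<open>Algebras that are braided commutative for two dual actions\<close>

text \<open>
  A bialgebra with basis \<open>J\<close> is given by structure constants: \<open>w i j l\<close> is the coefficient of \<open>l\<close> in the
  product of \<open>i\<close> and \<open>j\<close>, while \<open>t i j l\<close> is the coefficient of $i \otimes j$ in the coproduct of \<open>l\<close>; its unit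
  and counit have the coefficients \<open>e\<close> and \<open>\<zeta>\<close>.  The operators \<open>z j\<close> make \<open>A\<close> a module algebra over it.
  The operators \<open>u j\<close> make \<open>A\<close> a module algebra over the dual bialgebra with the opposite coproduct: they
  multiply by \<open>t\<close>, and on products of elements of \<open>A\<close> they expand by \<open>w\<close> with the factors swapped.
\<close>

locale dual_actions = algebra_type scale
  for scale :: "'k::field \<Rightarrow> 'a::ring_1 \<Rightarrow> 'a" +
  fixes J :: "'j set" and w t :: "'j \<Rightarrow> 'j \<Rightarrow> 'j \<Rightarrow> 'k" and e \<zeta> :: "'j \<Rightarrow> 'k" and z u :: "'j \<Rightarrow> 'a \<Rightarrow> 'a"
  assumes finite_index: "finite J"
    and w_support: "w i j l \<noteq> 0 \<Longrightarrow> i \<in> J \<and> j \<in> J \<and> l \<in> J"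
    and t_support: "t i j l \<noteq> 0 \<Longrightarrow> i \<in> J \<and> j \<in> J \<and> l \<in> J"
    and w_assoc: "(\<Sum>g\<in>J. w i j g * w g k l) = (\<Sum>g\<in>J. w j k g * w i g l)"
    and t_coassoc: "(\<Sum>g\<in>J. t i j g * t g k l) = (\<Sum>g\<in>J. t j k g * t i g l)"
    and w_unit_left: "(\<Sum>g\<in>J. e g * w g j l) = (if j = l \<and> j \<in> J then 1 else 0)"
    and w_unit_right: "(\<Sum>g\<in>J. e g * w j g l) = (if j = l \<and> j \<in> J then 1 else 0)"
    and t_counit: "(\<Sum>g\<in>J. \<zeta> g * t g j l) = (if j = l \<and> j \<in> J then 1 else 0)"
    and compat: "(\<Sum>l\<in>J. w i j l * t a b l) =
      (\<Sum>c\<in>J. \<Sum>d\<in>J. \<Sum>f\<in>J. \<Sum>g\<in>J. t c d i * t f g j * w c f a * w d g b)"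
    and z_linear: "j \<in> J \<Longrightarrow> Vector_Spaces.linear scale scale (z j)"
    and z_mult: "j \<in> J \<Longrightarrow> z j (x * y) = (\<Sum>a\<in>J. \<Sum>b\<in>J. scale (t a b j) (z a x * z b y))"
    and z_one: "j \<in> J \<Longrightarrow> z j 1 = scale (\<zeta> j) 1"
    and z_comp: "i \<in> J \<Longrightarrow> j \<in> J \<Longrightarrow> z i (z j x) = (\<Sum>l\<in>J. scale (w i j l) (z l x))"
    and u_linear: "j \<in> J \<Longrightarrow> Vector_Spaces.linear scale scale (u j)"
    and u_mult: "j \<in> J \<Longrightarrow> u j (x * y) = (\<Sum>a\<in>J. \<Sum>b\<in>J. scale (w a b j) (u b x * u a y))"
    and u_one: "j \<in> J \<Longrightarrow> u j 1 = scale (e j) 1"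
    and u_comp: "i \<in> J \<Longrightarrow> j \<in> J \<Longrightarrow> u i (u j x) = (\<Sum>l\<in>J. scale (t i j l) (u l x))"
begin

lemma z_linear_on: "j \<in> J \<Longrightarrow> linear_on scale scale UNIV UNIV (z j)"
  and u_linear_on: "j \<in> J \<Longrightarrow> linear_on scale scale UNIV UNIV (u j)"
  using z_linear u_linear vector_space_axioms by (simp_all add: linear_iff_linear_on_UNIV)

lemma z_add: "j \<in> J \<Longrightarrow> z j (x + y) = z j x + z j y"
  and z_scale: "j \<in> J \<Longrightarrow> z j (scale c x) = scale c (z j x)"
  and u_add: "j \<in> J \<Longrightarrow> u j (x + y) = u j x + u j y"
  and u_scale: "j \<in> J \<Longrightarrow> u j (scale c x) = scale c (u j x)"
  using z_linear_on u_linear_on by (auto simp: linear_on_def)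

lemma z_sum: "j \<in> J \<Longrightarrow> z j (\<Sum>i\<in>I. f i) = (\<Sum>i\<in>I. z j (f i))"
  by (rule linear_on_sum[OF z_linear_on])

lemma u_sum: "j \<in> J \<Longrightarrow> u j (\<Sum>i\<in>I. f i) = (\<Sum>i\<in>I. u j (f i))"
  by (rule linear_on_sum[OF u_linear_on])

abbreviation mat_scale :: "'k \<Rightarrow> ('j \<Rightarrow> 'j \<Rightarrow> 'a) \<Rightarrow> 'j \<Rightarrow> 'j \<Rightarrow> 'a"
  where "mat_scale \<equiv> fun_scale (fun_scale scale)"

definition mat_mult :: "('j \<Rightarrow> 'j \<Rightarrow> 'a) \<Rightarrow> ('j \<Rightarrow> 'j \<Rightarrow> 'a) \<Rightarrow> 'j \<Rightarrow> 'j \<Rightarrow> 'a" (infixl \<open>\<star>\<close> 70)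
  where "(X \<star> Y) q i = (\<Sum>p\<in>J. X q p * Y p i)"

lemma mat_mult_assoc: "(X \<star> Y) \<star> Z = X \<star> (Y \<star> Z)"
proof (intro ext)
  fix q i
  have "((X \<star> Y) \<star> Z) q i = (\<Sum>p\<in>J. \<Sum>s\<in>J. X q s * (Y s p * Z p i))"
    by (simp add: mat_mult_def sum_distrib_right mult.assoc)
  also have "\<dots> = (X \<star> (Y \<star> Z)) q i"
    by (subst sum.swap) (simp add: mat_mult_def sum_distrib_left)
  finally show "((X \<star> Y) \<star> Z) q i = (X \<star> (Y \<star> Z)) q i" .
qed

lemma mat_mult_sum_left: "(\<Sum>i\<in>I. X i) \<star> Y = (\<Sum>i\<in>I. X i \<star> Y)"
  by (intro ext) (simp add: mat_mult_def sum_fun_apply sum_distrib_right sum.swap[of _ I J])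

lemma mat_mult_sum_right: "Y \<star> (\<Sum>i\<in>I. X i) = (\<Sum>i\<in>I. Y \<star> X i)"
  by (intro ext) (simp add: mat_mult_def sum_fun_apply sum_distrib_left sum.swap[of _ I J])

lemma mat_mult_scale: "mat_scale c X \<star> Y = mat_scale c (X \<star> Y)" "X \<star> mat_scale c Y = mat_scale c (X \<star> Y)"
  by (intro ext; simp add: mat_mult_def fun_scale_def scale_mult_left scale_mult_right scale_sum_right)+

definition mat_one :: "'j \<Rightarrow> 'j \<Rightarrow> 'a"
  where "mat_one q i = (if q = i \<and> q \<in> J then 1 else 0)"

text \<open>
  Families \<open>f\<close> of elements of \<open>A\<close> indexed by \<open>J\<close> stand for linear maps from the bialgebra to \<open>A\<close>.  In Sweedler
  notation, the matrix \<open>comat x\<close> sends \<open>f\<close> to $q \mapsto \sum (q' x) f(q'')$, and \<open>rtrans j\<close> sends \<open>f\<close> to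
  $q \mapsto f(q j)$.  With the element $\theta(x) = \sum_j u_j(x) \otimes j$ of the smash product, \<open>lmat x\<close>
  sends \<open>f\<close> to $q \mapsto \sum_j u_j(x) f(j q)$, and \<open>rmat x\<close> is the right multiplication by \<open>\<theta>(x)\<close>
  on the smash product, transposed: $q \mapsto \sum_j (q' u_j(x)) f(q'' j)$.
\<close>

definition comat :: "'a \<Rightarrow> 'j \<Rightarrow> 'j \<Rightarrow> 'a"
  where "comat x q i = (\<Sum>c\<in>J. scale (t c i q) (z c x))"

definition rtrans :: "'j \<Rightarrow> 'j \<Rightarrow> 'j \<Rightarrow> 'a"
  where "rtrans j q i = scale (w q j i) 1"

definition lmat :: "'a \<Rightarrow> 'j \<Rightarrow> 'j \<Rightarrow> 'a"
  where "lmat x q i = (\<Sum>j\<in>J. scale (w j q i) (u j x))"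

definition rmat :: "'a \<Rightarrow> 'j \<Rightarrow> 'j \<Rightarrow> 'a"
  where "rmat x = (\<Sum>j\<in>J. comat (u j x) \<star> rtrans j)"

lemma comat_add: "comat (x + y) = comat x + comat y"
  by (intro ext) (simp add: comat_def z_add scale_right_distrib sum.distrib)

lemma comat_scale: "comat (scale c x) = mat_scale c (comat x)"
  by (intro ext) (simp add: comat_def z_scale fun_scale_def scale_sum_right mult.commute)

lemma comat_sum: "comat (\<Sum>i\<in>I. f i) = (\<Sum>i\<in>I. comat (f i))"
proof (rule linear_on_sum)
  show "linear_on scale mat_scale UNIV UNIV comat"
    by (simp add: linear_on_def comat_add comat_scale)
qed

lemma lmat_add: "lmat (x + y) = lmat x + lmat y"
  by (intro ext) (simp add: lmat_def u_add scale_right_distrib sum.distrib)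

lemma lmat_scale: "lmat (scale c x) = mat_scale c (lmat x)"
  by (intro ext) (simp add: lmat_def u_scale fun_scale_def scale_sum_right mult.commute)

lemma rmat_add: "rmat (x + y) = rmat x + rmat y"
proof -
  have "(X + Y) \<star> Z = X \<star> Z + Y \<star> Z" for X Y Z
    by (intro ext) (simp add: mat_mult_def distrib_right sum.distrib)
  then show ?thesis by (simp add: rmat_def u_add comat_add sum.distrib)
qed

lemma rmat_scale: "rmat (scale c x) = mat_scale c (rmat x)"
  by (intro ext) (simp add: rmat_def u_scale comat_scale mat_mult_scale, simp add: sum_fun_apply fun_scale_def scale_sum_right)

lemma comat_mult: "comat (x * y) = comat x \<star> comat y"
proof (intro ext)
  fix q i
  have "comat (x * y) q i = (\<Sum>c\<in>J. \<Sum>a\<in>J. \<Sum>b\<in>J. scale (t a b c * t c i q) (z a x * z b y))"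
    by (simp add: comat_def z_mult scale_sum_right mult.commute)
  also have "\<dots> = (\<Sum>a\<in>J. \<Sum>b\<in>J. \<Sum>c\<in>J. scale (t a b c * t c i q) (z a x * z b y))"
    by (subst sum.swap, rule sum.cong[OF refl], rule sum.swap)
  also have "\<dots> = (\<Sum>a\<in>J. \<Sum>b\<in>J. scale (\<Sum>c\<in>J. t a b c * t c i q) (z a x * z b y))"
    by (simp only: scale_sum_left)
  also have "\<dots> = (\<Sum>a\<in>J. \<Sum>b\<in>J. \<Sum>p\<in>J. scale (t b i p * t a p q) (z a x * z b y))"
    by (simp only: scale_sum_left t_coassoc)
  also have "\<dots> = (\<Sum>a\<in>J. \<Sum>p\<in>J. \<Sum>b\<in>J. scale (t b i p * t a p q) (z a x * z b y))"
    by (rule sum.cong[OF refl], rule sum.swap)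
  also have "\<dots> = (\<Sum>p\<in>J. \<Sum>a\<in>J. \<Sum>b\<in>J. scale (t b i p * t a p q) (z a x * z b y))"
    by (rule sum.swap)
  also have "\<dots> = (comat x \<star> comat y) q i"
    by (simp add: comat_def mat_mult_def sum_product scale_mult_left scale_mult_right mult.commute)
  finally show "comat (x * y) q i = (comat x \<star> comat y) q i" .
qed

lemma comat_one: "comat 1 = mat_one"
proof (intro ext)
  fix q i
  have "comat 1 q i = scale (\<Sum>c\<in>J. \<zeta> c * t c i q) 1"
    by (simp add: comat_def z_one scale_sum_left mult.commute)
  then show "comat 1 q i = mat_one q i" by (auto simp: t_counit mat_one_def)
qed

text \<open>
  The coproduct is multiplicative: moving \<open>comat x\<close> past a translation applies the comatrix of the
  bialgebra a second time, to the entries of \<open>comat x\<close>.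
\<close>

lemma comat_compat:
  "(\<Sum>l\<in>J. scale (w i j l) (comat x l b)) = (\<Sum>d\<in>J. \<Sum>g\<in>J. scale (w d g b) (comat (comat x j g) i d))"
proof -
  have "(\<Sum>l\<in>J. scale (w i j l) (comat x l b)) = (\<Sum>l\<in>J. \<Sum>a\<in>J. scale (w i j l * t a b l) (z a x))"
    by (simp add: comat_def scale_sum_right)
  also have "\<dots> = (\<Sum>a\<in>J. scale (\<Sum>l\<in>J. w i j l * t a b l) (z a x))"
    by (subst sum.swap) (simp only: scale_sum_left)
  also have "\<dots> = (\<Sum>a\<in>J. \<Sum>c\<in>J. \<Sum>d\<in>J. \<Sum>f\<in>J. \<Sum>g\<in>J. scale (t c d i * t f g j * w d g b) (scale (w c f a) (z a x)))"
    by (simp only: compat scale_sum_left) (simp add: mult.assoc mult.commute mult.left_commute)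
  also have "\<dots> = (\<Sum>c\<in>J. \<Sum>d\<in>J. \<Sum>f\<in>J. \<Sum>g\<in>J. \<Sum>a\<in>J. scale (t c d i * t f g j * w d g b) (scale (w c f a) (z a x)))"
    by (subst sum.swap, rule sum.cong[OF refl], subst sum.swap, rule sum.cong[OF refl],
      subst sum.swap, rule sum.cong[OF refl], rule sum.swap)
  also have "\<dots> = (\<Sum>c\<in>J. \<Sum>d\<in>J. \<Sum>f\<in>J. \<Sum>g\<in>J. scale (t c d i * t f g j * w d g b) (z c (z f x)))"
    by (simp add: scale_sum_right z_comp)
  also have "\<dots> = (\<Sum>d\<in>J. \<Sum>c\<in>J. \<Sum>g\<in>J. \<Sum>f\<in>J. scale (t c d i * t f g j * w d g b) (z c (z f x)))"
    by (subst sum.swap, rule sum.cong[OF refl], rule sum.cong[OF refl], rule sum.swap)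
  also have "\<dots> = (\<Sum>d\<in>J. \<Sum>g\<in>J. \<Sum>c\<in>J. \<Sum>f\<in>J. scale (t c d i * t f g j * w d g b) (z c (z f x)))"
    by (rule sum.cong[OF refl], rule sum.swap)
  also have "\<dots> = (\<Sum>d\<in>J. \<Sum>g\<in>J. scale (w d g b) (comat (comat x j g) i d))"
    by (simp add: comat_def z_sum z_scale scale_sum_right mult.assoc mult.commute mult.left_commute)
  finally show ?thesis .
qed

lemma lmat_mult: "lmat x \<star> lmat y = lmat (x * y)"
proof (intro ext)
  fix q i
  have "(lmat x \<star> lmat y) q i = (\<Sum>p\<in>J. \<Sum>j\<in>J. \<Sum>k\<in>J. scale (w j q p * w k p i) (u j x * u k y))"
    by (simp add: lmat_def mat_mult_def sum_product scale_mult_left scale_mult_right mult.commute)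
  also have "\<dots> = (\<Sum>j\<in>J. \<Sum>k\<in>J. \<Sum>p\<in>J. scale (w j q p * w k p i) (u j x * u k y))"
    by (subst sum.swap, rule sum.cong[OF refl], rule sum.swap)
  also have "\<dots> = (\<Sum>j\<in>J. \<Sum>k\<in>J. \<Sum>g\<in>J. scale (w k j g * w g q i) (u j x * u k y))"
    by (simp only: scale_sum_left[symmetric] w_assoc)
  also have "\<dots> = (\<Sum>j\<in>J. \<Sum>g\<in>J. \<Sum>k\<in>J. scale (w k j g * w g q i) (u j x * u k y))"
    by (rule sum.cong[OF refl], rule sum.swap)
  also have "\<dots> = (\<Sum>g\<in>J. \<Sum>k\<in>J. \<Sum>j\<in>J. scale (w k j g * w g q i) (u j x * u k y))"
    by (subst sum.swap, rule sum.cong[OF refl], rule sum.swap)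
  also have "\<dots> = lmat (x * y) q i"
    by (simp add: lmat_def u_mult scale_sum_right mult.commute)
  finally show "(lmat x \<star> lmat y) q i = lmat (x * y) q i" .
qed

lemma lmat_one: "lmat 1 = mat_one"
proof (intro ext)
  fix q i
  have "lmat 1 q i = scale (\<Sum>j\<in>J. e j * w j q i) 1"
    by (simp add: lmat_def u_one scale_sum_left mult.commute)
  then show "lmat 1 q i = mat_one q i" by (auto simp: w_unit_left mat_one_def)
qed

lemma rmat_one: "rmat 1 = mat_one"
proof (intro ext)
  fix q i
  have "rmat 1 q i = (\<Sum>j\<in>J. \<Sum>s\<in>J. scale (e j) (mat_one q s * scale (w s j i) 1))"
    by (simp add: rmat_def u_one comat_scale comat_one mat_mult_scale sum_fun_apply fun_scale_def
        mat_mult_def rtrans_def scale_sum_right scale_mult_left)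
  also have "\<dots> = (\<Sum>j\<in>J. if q \<in> J then scale (e j * w q j i) 1 else 0)"
    using finite_index by (intro sum.cong refl)
      (auto simp: mat_one_def scale_mult_right if_distrib[of "\<lambda>x. x * _"] if_distrib[of "scale _"] cong: if_cong)
  also have "\<dots> = scale (\<Sum>j\<in>J. e j * w q j i) 1"
  proof (cases "q \<in> J")
    case False
    then have "w q j i = 0" for j using w_support by blast
    with False show ?thesis by simp
  qed (simp add: scale_sum_left)
  finally show "rmat 1 q i = mat_one q i" by (auto simp: w_unit_right mat_one_def)
qed

text \<open>
  The translations \<open>rtrans j\<close> have scalar entries; they represent the product of the bialgebra, and
  associativity makes them commute with the left translations that occur in \<open>lmat\<close>.
\<close>

lemma rtrans_mult: "rtrans k \<star> rtrans j = (\<Sum>g\<in>J. mat_scale (w k j g) (rtrans g))"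
proof (intro ext)
  fix q i
  have "(rtrans k \<star> rtrans j) q i = scale (\<Sum>p\<in>J. w q k p * w p j i) 1"
    by (simp add: mat_mult_def rtrans_def scale_mult_left scale_sum_left)
  also have "\<dots> = (\<Sum>g\<in>J. scale (w k j g * w q g i) 1)" by (simp only: w_assoc scale_sum_left)
  finally show "(rtrans k \<star> rtrans j) q i = (\<Sum>g\<in>J. mat_scale (w k j g) (rtrans g)) q i"
    by (simp add: sum_fun_apply fun_scale_def rtrans_def)
qed

lemma lmat_rtrans: "lmat x \<star> rtrans j = rtrans j \<star> lmat x"
proof (intro ext)
  fix q i
  have "(lmat x \<star> rtrans j) q i = (\<Sum>k\<in>J. \<Sum>p\<in>J. scale (w k q p * w p j i) (u k x))"
    by (subst sum.swap) (simp add: mat_mult_def lmat_def rtrans_def sum_distrib_right scale_mult_left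
        scale_mult_right scale_sum_right mult.commute)
  also have "\<dots> = (\<Sum>k\<in>J. \<Sum>p\<in>J. scale (w q j p * w k p i) (u k x))"
    by (simp only: scale_sum_left[symmetric] w_assoc)
  also have "\<dots> = (rtrans j \<star> lmat x) q i"
    by (subst sum.swap) (simp add: mat_mult_def lmat_def rtrans_def sum_distrib_left scale_mult_left
        scale_mult_right scale_sum_right mult.commute)
  finally show "(lmat x \<star> rtrans j) q i = (rtrans j \<star> lmat x) q i" .
qed

end

text \<open>
  The additional identity says that \<open>A\<close> is commutative up to the braiding given by the
  canonical element $\sum_j u_j \otimes z_j$.
\<close>

locale braided_commutative_dual_actions =
  dual_actions scale J w t e \<zeta> z u + central_simple_algebra scale B
  for scale :: "'k::field \<Rightarrow> 'a::ring_1 \<Rightarrow> 'a"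
    and J :: "'j set" and w t :: "'j \<Rightarrow> 'j \<Rightarrow> 'j \<Rightarrow> 'k" and e \<zeta> :: "'j \<Rightarrow> 'k"
    and z u :: "'j \<Rightarrow> 'a \<Rightarrow> 'a" and B :: "'a set" +
  assumes braided_commutative: "(\<Sum>j\<in>J. u j x * z j y) = y * x"
begin

text \<open>
  Equivalently, \<open>\<theta>(x)\<close> commutes with \<open>A\<close> in the smash product.  The products of the \<open>u j\<close> have the
  structure constants of the coproduct, so the comatrix entries turn into one more application of an operator \<open>u\<close>, and
  braided commutativity applies.
\<close>

lemma u_comat: "i \<in> J \<Longrightarrow> (\<Sum>j\<in>J. u j x * comat y j i) = y * u i x"
proof -
  assume i: "i \<in> J"
  have "(\<Sum>j\<in>J. u j x * comat y j i) = (\<Sum>j\<in>J. \<Sum>a\<in>J. scale (t a i j) (u j x * z a y))"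
    by (simp add: comat_def sum_distrib_left scale_mult_right)
  also have "\<dots> = (\<Sum>a\<in>J. u a (u i x) * z a y)"
    using i by (subst sum.swap) (simp add: u_comp sum_distrib_right scale_mult_left)
  finally show ?thesis by (simp add: braided_commutative)
qed

lemma lmat_comat: "lmat x \<star> comat y = comat y \<star> lmat x"
proof (intro ext)
  fix q i
  have "(lmat x \<star> comat y) q i = (\<Sum>j\<in>J. u j x * (\<Sum>p\<in>J. scale (w j q p) (comat y p i)))"
    by (simp add: mat_mult_def lmat_def sum_distrib_left sum_distrib_right scale_mult_left scale_mult_right)
      (rule sum.swap)
  also have "\<dots> = (\<Sum>j\<in>J. \<Sum>d\<in>J. \<Sum>g\<in>J. scale (w d g i) (u j x * comat (comat y q g) j d))"
    by (simp only: comat_compat) (simp add: sum_distrib_left scale_mult_right)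
  also have "\<dots> = (\<Sum>d\<in>J. \<Sum>g\<in>J. \<Sum>j\<in>J. scale (w d g i) (u j x * comat (comat y q g) j d))"
    by (subst sum.swap, rule sum.cong[OF refl], rule sum.swap)
  also have "\<dots> = (\<Sum>d\<in>J. \<Sum>g\<in>J. scale (w d g i) (comat y q g * u d x))"
    by (simp add: scale_sum_right[symmetric] u_comat)
  also have "\<dots> = (comat y \<star> lmat x) q i"
    by (subst sum.swap) (simp add: mat_mult_def lmat_def sum_distrib_left scale_mult_right)
  finally show "(lmat x \<star> comat y) q i = (comat y \<star> lmat x) q i" .
qed

lemma rtrans_comat: "rtrans j \<star> comat x = (\<Sum>g\<in>J. comat (comat x j g) \<star> rtrans g)"
proof (intro ext)
  fix q i
  have "(rtrans j \<star> comat x) q i = (\<Sum>l\<in>J. scale (w q j l) (comat x l i))"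
    by (simp add: mat_mult_def rtrans_def scale_mult_left)
  also have "\<dots> = (\<Sum>g\<in>J. comat (comat x j g) \<star> rtrans g) q i"
    by (subst comat_compat, subst sum.swap)
      (simp add: sum_fun_apply mat_mult_def rtrans_def scale_mult_right)
  finally show "(rtrans j \<star> comat x) q i = (\<Sum>g\<in>J. comat (comat x j g) \<star> rtrans g) q i" .
qed

lemma rmat_comat: "rmat x \<star> comat y = comat y \<star> rmat x"
proof -
  have "rmat x \<star> comat y = (\<Sum>j\<in>J. \<Sum>g\<in>J. comat (u j x * comat y j g) \<star> rtrans g)"
    by (simp add: rmat_def mat_mult_sum_left mat_mult_assoc rtrans_comat mat_mult_sum_right comat_mult)
  also have "\<dots> = (\<Sum>g\<in>J. comat (\<Sum>j\<in>J. u j x * comat y j g) \<star> rtrans g)"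
    by (subst sum.swap) (simp add: comat_sum mat_mult_sum_left)
  also have "\<dots> = comat y \<star> rmat x"
    by (simp add: u_comat rmat_def mat_mult_sum_right comat_mult mat_mult_assoc)
  finally show ?thesis .
qed

text \<open>
  Since \<open>rmat x\<close> commutes with all comatrices, it can be moved past \<open>comat (u j y)\<close>; what
  remains is the expansion of \<open>u g (y * x)\<close>.
\<close>

lemma rmat_mult: "rmat x \<star> rmat y = rmat (y * x)"
proof -
  have "rmat x \<star> rmat y = (\<Sum>j\<in>J. rmat x \<star> comat (u j y) \<star> rtrans j)"
    by (simp add: rmat_def[of y] mat_mult_sum_right mat_mult_assoc)
  also have "\<dots> = (\<Sum>j\<in>J. comat (u j y) \<star> rmat x \<star> rtrans j)" by (simp only: rmat_comat)
  also have "\<dots> = (\<Sum>j\<in>J. \<Sum>k\<in>J. comat (u j y * u k x) \<star> (rtrans k \<star> rtrans j))"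
    by (simp add: rmat_def[of x] mat_mult_sum_left mat_mult_sum_right mat_mult_assoc comat_mult)
  also have "\<dots> = (\<Sum>j\<in>J. \<Sum>k\<in>J. \<Sum>g\<in>J. comat (scale (w k j g) (u j y * u k x)) \<star> rtrans g)"
    by (simp add: rtrans_mult mat_mult_sum_right mat_mult_scale comat_scale)
  also have "\<dots> = (\<Sum>j\<in>J. \<Sum>g\<in>J. \<Sum>k\<in>J. comat (scale (w k j g) (u j y * u k x)) \<star> rtrans g)"
    by (rule sum.cong[OF refl], rule sum.swap)
  also have "\<dots> = (\<Sum>g\<in>J. \<Sum>k\<in>J. \<Sum>j\<in>J. comat (scale (w k j g) (u j y * u k x)) \<star> rtrans g)"
    by (subst sum.swap, rule sum.cong[OF refl], rule sum.swap)
  also have "\<dots> = rmat (y * x)"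
    by (simp add: rmat_def u_mult comat_sum mat_mult_sum_left)
  finally show ?thesis .
qed

lemma lmat_rmat: "lmat x \<star> rmat y = rmat y \<star> lmat x"
proof -
  have "lmat x \<star> rmat y = (\<Sum>j\<in>J. (lmat x \<star> comat (u j y)) \<star> rtrans j)"
    by (simp add: rmat_def mat_mult_sum_right mat_mult_assoc)
  also have "\<dots> = rmat y \<star> lmat x"
    by (simp add: lmat_comat mat_mult_assoc lmat_rtrans rmat_def mat_mult_sum_left)
  finally show ?thesis .
qed

abbreviation vec_scale :: "'k \<Rightarrow> ('j \<Rightarrow> 'a) \<Rightarrow> 'j \<Rightarrow> 'a"
  where "vec_scale \<equiv> fun_scale scale"

definition mat_vec :: "('j \<Rightarrow> 'j \<Rightarrow> 'a) \<Rightarrow> ('j \<Rightarrow> 'a) \<Rightarrow> 'j \<Rightarrow> 'a"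
  where "mat_vec X f q = (\<Sum>p\<in>J. X q p * f p)"

definition vectors :: "('j \<Rightarrow> 'a) set"
  where "vectors = {f. \<forall>q. q \<notin> J \<longrightarrow> f q = 0}"

lemma vec_vector_space: "vector_space vec_scale"
  by (intro vector_space_fun_scale vector_space_axioms)

lemma mat_vec_mult: "mat_vec (X \<star> Y) f = mat_vec X (mat_vec Y f)"
proof
  fix q
  have "mat_vec (X \<star> Y) f q = (\<Sum>p\<in>J. \<Sum>s\<in>J. X q s * (Y s p * f p))"
    by (simp add: mat_vec_def mat_mult_def sum_distrib_right mult.assoc)
  also have "\<dots> = mat_vec X (mat_vec Y f) q"
    by (subst sum.swap) (simp add: mat_vec_def sum_distrib_left)
  finally show "mat_vec (X \<star> Y) f q = mat_vec X (mat_vec Y f) q" .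
qed

lemma mat_vec_one: "f \<in> vectors \<Longrightarrow> mat_vec mat_one f = f"
proof
  fix q assume "f \<in> vectors"
  then show "mat_vec mat_one f q = f q" using finite_index
    by (cases "q \<in> J") (simp_all add: mat_vec_def mat_one_def vectors_def if_distrib[of "\<lambda>x. x * _"] cong: if_cong)
qed

lemma mat_vec_add: "mat_vec (X + Y) f = mat_vec X f + mat_vec Y f" "mat_vec X (f + g) = mat_vec X f + mat_vec X g"
  by (intro ext; simp add: mat_vec_def distrib_left distrib_right sum.distrib)+

lemma mat_vec_scale: "mat_vec (mat_scale c X) f = vec_scale c (mat_vec X f)"
    "mat_vec X (vec_scale c f) = vec_scale c (mat_vec X f)"
  by (intro ext; simp add: mat_vec_def fun_scale_def scale_mult_left scale_mult_right scale_sum_right)+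

lemma subspace_vectors: "module.subspace vec_scale vectors"
proof -
  interpret M: vector_space vec_scale by (rule vec_vector_space)
  show ?thesis by (auto simp: M.subspace_def vectors_def fun_scale_def)
qed

lemma supported_rows:
  "q \<notin> J \<Longrightarrow> lmat x q i = 0" "q \<notin> J \<Longrightarrow> comat x q i = 0" "q \<notin> J \<Longrightarrow> rmat x q i = 0"
proof -
  have "w j q i = 0" "t c i q = 0" if "q \<notin> J" for j c i using w_support t_support that by blast+
  then show "q \<notin> J \<Longrightarrow> lmat x q i = 0" and *: "q \<notin> J \<Longrightarrow> comat x q i = 0" for x i
    by (simp_all add: lmat_def comat_def)
  show "q \<notin> J \<Longrightarrow> rmat x q i = 0" by (simp add: rmat_def sum_fun_apply mat_mult_def *)
qed

lemma vectors_closed: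
  "mat_vec (lmat x) f \<in> vectors" "mat_vec (comat x) f \<in> vectors" "mat_vec (rmat x) f \<in> vectors"
  by (simp_all add: vectors_def mat_vec_def supported_rows)

lemma dim_vectors:
  obtains T where "finite T" "vectors \<subseteq> module.span vec_scale T"
    "vector_space.dim vec_scale vectors = card J * card B"
proof -
  interpret M: vector_space vec_scale by (rule vec_vector_space)
  define v :: "'j \<times> 'a \<Rightarrow> 'j \<Rightarrow> 'a" where "v = (\<lambda>(j, b) q. if q = j then b else 0 :: 'a)"
  have fin: "finite (J \<times> B)" using finite_index finite_basis by simp
  have val: "(\<Sum>p\<in>J \<times> B. vec_scale (c p) (v p)) q = (\<Sum>b\<in>B. scale (c (q, b)) b)" if "q \<in> J" for c q
  proof -
    have "(\<Sum>p\<in>J \<times> B. vec_scale (c p) (v p)) q = (\<Sum>j\<in>J. \<Sum>b\<in>B. if j = q then scale (c (q, b)) b else 0)"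
      unfolding sum.cartesian_product by (auto simp: sum_fun_apply fun_scale_def v_def intro!: sum.cong)
    also have "\<dots> = (\<Sum>b\<in>B. scale (c (q, b)) b)"
      using that finite_index by (subst sum.swap) simp
    finally show ?thesis .
  qed
  have ind: "\<forall>c. (\<Sum>p\<in>J \<times> B. vec_scale (c p) (v p)) = 0 \<longrightarrow> (\<forall>p\<in>J \<times> B. c p = 0)"
  proof (intro allI impI ballI)
    fix c p assume 0: "(\<Sum>p\<in>J \<times> B. vec_scale (c p) (v p)) = 0" and p: "p \<in> J \<times> B"
    then obtain q b where qb: "p = (q, b)" "q \<in> J" "b \<in> B" by auto
    have "(\<Sum>b\<in>B. scale (c (q, b)) b) = 0" using val[OF qb(2), of c] 0 by simp
    then show "c p = 0"
      using independent_sum_zero[OF finite_basis independent_basis, of "\<lambda>b. c (q, b)"] qb by simp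
  qed
  note inj = M.indexed_independent(1)[OF fin ind] and indep = M.indexed_independent(2)[OF fin ind]
  have sub: "v ` (J \<times> B) \<subseteq> vectors" by (auto simp: v_def vectors_def)
  have span: "vectors \<subseteq> M.span (v ` (J \<times> B))"
  proof
    fix f assume f: "f \<in> vectors"
    have "f = (\<Sum>p\<in>J \<times> B. vec_scale (representation B (f (fst p)) (snd p)) (v p))"
    proof
      fix q
      show "f q = (\<Sum>p\<in>J \<times> B. vec_scale (representation B (f (fst p)) (snd p)) (v p)) q"
      proof (cases "q \<in> J")
        case True
        then show ?thesis using basis_expansion[of "f q"] by (simp only: val) simp
      next
        case False
        then have "v p q = 0" if "p \<in> J \<times> B" for p using that by (auto simp: v_def)
        then show ?thesis using False f by (simp add: sum_fun_apply fun_scale_def vectors_def)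
      qed
    qed
    also have "\<dots> \<in> M.span (v ` (J \<times> B))" by (intro M.span_sum M.span_scale M.span_base) auto
    finally show "f \<in> M.span (v ` (J \<times> B))" .
  qed
  have "M.dim vectors = card (v ` (J \<times> B))" using M.basis_card_eq_dim[OF sub span indep] by simp
  also have "\<dots> = card J * card B" by (simp add: card_image[OF inj] card_cartesian_product)
  finally have "M.dim vectors = card J * card B" .
  with span fin show ?thesis using that by blast
qed

text \<open>
  The matrices \<open>lmat x\<close> and the right multiplication by \<open>x\<close> make the families a bimodule over \<open>A\<close>, of dimension
  \<open>card J * card B\<close>, so the families on which these two actions agree form a space \<open>Z\<close> of dimension \<open>card J\<close>.  The matrices \<open>comat x\<close> and
  \<open>rmat x\<close> commute with both, so they make \<open>Z\<close> a second bimodule, and its dimension is a multiple of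
  \<open>card B\<close>.
\<close>

theorem dim_dvd_card_index: "card B dvd card J"
proof -
  interpret M: vector_space vec_scale by (rule vec_vector_space)
  obtain T where T: "finite T" "vectors \<subseteq> M.span T" and dim: "M.dim vectors = card J * card B"
    by (rule dim_vectors) blast
  let ?l = "\<lambda>x. mat_vec (lmat x)" and ?r = "\<lambda>x f q. f q * x"
  let ?Z = "{f \<in> vectors. \<forall>x. ?l x f = ?r x f}"
  have "M.dim vectors = card B * M.dim ?Z"
  proof (rule dim_bimodule[OF vec_vector_space subspace_vectors T])
    show "bilinear_on scale vec_scale vec_scale UNIV vectors vectors ?l"
      by (simp add: bilinear_on_def linear_on_def vectors_closed lmat_add lmat_scale mat_vec_add mat_vec_scale)
    show "bilinear_on scale vec_scale vec_scale UNIV vectors vectors ?r"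
      by (auto simp: bilinear_on_def linear_on_def vectors_def fun_scale_def fun_eq_iff
          distrib_left distrib_right scale_mult_left scale_mult_right)
    show "?l x (?r y f) = ?r y (?l x f)" for x y f
      by (simp add: mat_vec_def fun_eq_iff sum_distrib_right mult.assoc)
  qed (simp_all add: lmat_mult[symmetric] lmat_one mat_vec_mult mat_vec_one mult.assoc)
  moreover have "card B > 0"
  proof -
    have "B \<noteq> {}" using basis_expansion[of 1] one_neq_zero by auto
    then show ?thesis using finite_basis by (simp add: card_gt_0_iff)
  qed
  ultimately have dim_Z: "M.dim ?Z = card J" using dim by simp
  have "M.dim ?Z = card B * M.dim {f \<in> ?Z. \<forall>x. mat_vec (comat x) f = mat_vec (rmat x) f}"
  proof (rule dim_bimodule[OF vec_vector_space _ T(1)])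
    show "M.subspace ?Z"
      using subspace_vectors unfolding M.subspace_def
      by (simp add: mat_vec_add mat_vec_scale fun_eq_iff fun_scale_def distrib_right scale_mult_left)
        (simp add: mat_vec_def scale_mult_right scale_sum_right[symmetric])
    show "?Z \<subseteq> M.span T" using T(2) by blast
    have right: "mat_vec X (?r y f) = ?r y (mat_vec X f)" for X y f
      by (simp add: mat_vec_def fun_eq_iff sum_distrib_right mult.assoc)
    have "mat_vec (comat x) f \<in> ?Z" "mat_vec (rmat x) f \<in> ?Z" if f: "f \<in> ?Z" for x f
    proof -
      have l: "?l y f = ?r y f" for y using f by blast
      have "?l y (mat_vec (comat x) f) = ?r y (mat_vec (comat x) f)" for y
        by (simp only: mat_vec_mult[symmetric] lmat_comat) (simp only: mat_vec_mult l right)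
      moreover have "?l y (mat_vec (rmat x) f) = ?r y (mat_vec (rmat x) f)" for y
        by (simp only: mat_vec_mult[symmetric] lmat_rmat) (simp only: mat_vec_mult l right)
      ultimately show "mat_vec (comat x) f \<in> ?Z" "mat_vec (rmat x) f \<in> ?Z"
        by (simp_all add: vectors_closed)
    qed
    then show "bilinear_on scale vec_scale vec_scale UNIV ?Z ?Z (\<lambda>x. mat_vec (comat x))"
      "bilinear_on scale vec_scale vec_scale UNIV ?Z ?Z (\<lambda>x. mat_vec (rmat x))"
      unfolding bilinear_on_def linear_on_def
      by (simp_all only: comat_add comat_scale rmat_add rmat_scale mat_vec_add mat_vec_scale) blast+
    show "mat_vec (comat x) (mat_vec (rmat y) f) = mat_vec (rmat y) (mat_vec (comat x) f)" for x y f
      by (simp only: mat_vec_mult[symmetric] rmat_comat)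
  qed (simp_all add: comat_mult comat_one rmat_mult[symmetric] rmat_one mat_vec_mult mat_vec_one)
  from trans[OF dim_Z[symmetric] this] show ?thesis by (rule dvdI)
qed

end

section \<open>Linear maps on tensor products\<close>

text \<open>
  The tensors of two subspaces, with the vector space structures of the three spaces made available.
\<close>

locale subspace_pair =
  fixes s1 :: "'k::field \<Rightarrow> 'v::ab_group_add \<Rightarrow> 'v" and s2 :: "'k \<Rightarrow> 'w::ab_group_add \<Rightarrow> 'w"
    and V :: "'v set" and W :: "'w set"
  assumes vs1: "vector_space s1" and vs2: "vector_space s2"
    and sub1: "module.subspace s1 V" and sub2: "module.subspace s2 W"
begin

sublocale s1: vector_space s1 by (rule vs1)
sublocale s2: vector_space s2 by (rule vs2)
sublocale T: vector_space "tensor_scale :: 'k \<Rightarrow> ('v, 'w, 'k) tensor \<Rightarrow> _"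
  by (intro vector_space_fun_scale vector_space_mult)

lemma bilinear_tens: "bilinear_on s1 s2 tensor_scale UNIV UNIV UNIV (tens s1 s2)"
  by (auto simp: bilinear_on_def linear_on_def tens_def fun_scale_def fun_eq_iff)

lemma tens_scale_left: "tens s1 s2 (s1 c v) w = tensor_scale c (tens s1 s2 v w)"
  using bilinear_tens by (simp add: bilinear_on_def linear_on_def)

lemma tens_in_tensor_space: "v \<in> V \<Longrightarrow> w \<in> W \<Longrightarrow> tens s1 s2 v w \<in> tensor_space s1 s2 V W"
  unfolding tensor_space_def by (rule T.span_base) blast

lemma subspace_tensor_space: "T.subspace (tensor_space s1 s2 V W)"
  unfolding tensor_space_def by (rule T.subspace_span)

lemma tensor_space_list:
  assumes "t \<in> tensor_space s1 s2 V W"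
  obtains ps where "set ps \<subseteq> V \<times> W" "t = (\<Sum>(v, w)\<leftarrow>ps. tens s1 s2 v w)"
proof -
  have "\<exists>ps. set ps \<subseteq> V \<times> W \<and> t = (\<Sum>(v, w)\<leftarrow>ps. tens s1 s2 v w)"
    using assms unfolding tensor_space_def
  proof (induction rule: T.span_induct_alt)
    case base
    show ?case by (rule exI[of _ "[]"]) simp
  next
    case (step c x y)
    then obtain v w ps where *: "x = tens s1 s2 v w" "v \<in> V" "w \<in> W" "set ps \<subseteq> V \<times> W"
      "y = (\<Sum>(v, w)\<leftarrow>ps. tens s1 s2 v w)" by blast
    have "s1 c v \<in> V" using s1.subspace_scale[OF sub1 *(2)] .
    with * show ?case by (intro exI[of _ "(s1 c v, w) # ps"]) (simp add: tens_scale_left)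
  qed
  then show ?thesis using that by blast
qed

lemma tensor_space_sum:
  assumes "t \<in> tensor_space s1 s2 V W"
  obtains N :: nat and v w where "\<And>i. i < N \<Longrightarrow> v i \<in> V" "\<And>i. i < N \<Longrightarrow> w i \<in> W"
    "t = (\<Sum>i<N. tens s1 s2 (v i) (w i))"
proof -
  obtain ps where ps: "set ps \<subseteq> V \<times> W" "t = (\<Sum>(v, w)\<leftarrow>ps. tens s1 s2 v w)"
    by (rule tensor_space_list[OF assms])
  have "ps ! i \<in> V \<times> W" if "i < length ps" for i using ps(1) that nth_mem by blast
  then have "fst (ps ! i) \<in> V" "snd (ps ! i) \<in> W" if "i < length ps" for i
    using that by (auto simp: mem_Times_iff)
  note that[of "length ps" "\<lambda>i. fst (ps ! i)" "\<lambda>i. snd (ps ! i)", OF this]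
  moreover have "t = (\<Sum>i<length ps. tens s1 s2 (fst (ps ! i)) (snd (ps ! i)))"
    by (simp add: ps(2) sum_list_sum_nth atLeast0LessThan case_prod_unfold)
  ultimately show ?thesis by simp
qed

lemma lift_linear:
  assumes vs3: "vector_space s3" and f: "bilinear_on s1 s2 s3 V W UNIV f"
  shows "linear_on tensor_scale s3 (tensor_space s1 s2 V W) UNIV (tensor_lift s1 s2 V W f)"
proof -
  interpret s3: vector_space s3 by fact
  note lift = tensor_lift_sum[OF vs1 vs2 vs3 sub1 sub2 f]
  show ?thesis unfolding linear_on_def
  proof (intro conjI ballI allI)
    fix t t' assume "t \<in> tensor_space s1 s2 V W" "t' \<in> tensor_space s1 s2 V W"
    then obtain ps qs where *: "set ps \<subseteq> V \<times> W" "t = (\<Sum>(v, w)\<leftarrow>ps. tens s1 s2 v w)"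
      "set qs \<subseteq> V \<times> W" "t' = (\<Sum>(v, w)\<leftarrow>qs. tens s1 s2 v w)" by (metis tensor_space_list)
    then show "tensor_lift s1 s2 V W f (t + t') = tensor_lift s1 s2 V W f t + tensor_lift s1 s2 V W f t'"
      using lift[of "ps @ qs"] lift[of ps] lift[of qs] by simp
  next
    fix c t assume "t \<in> tensor_space s1 s2 V W"
    then obtain ps where *: "set ps \<subseteq> V \<times> W" "t = (\<Sum>(v, w)\<leftarrow>ps. tens s1 s2 v w)"
      by (metis tensor_space_list)
    let ?qs = "map (\<lambda>(v, w). (s1 c v, w)) ps"
    have qs: "set ?qs \<subseteq> V \<times> W" using *(1) s1.subspace_scale[OF sub1] by auto
    have "tensor_scale c t = (\<Sum>(v, w)\<leftarrow>?qs. tens s1 s2 v w)"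
      unfolding *(2)
    proof (induction ps)
      case (Cons p ps)
      then show ?case
        by (simp only: list.map sum_list.Cons T.scale_right_distrib case_prod_unfold fst_conv snd_conv tens_scale_left)
    qed (simp only: list.map sum_list.Nil T.scale_zero_right)
    moreover have "(\<Sum>(v, w)\<leftarrow>?qs. f v w) = s3 c (\<Sum>(v, w)\<leftarrow>ps. f v w)"
      using *(1)
    proof (induction ps)
      case (Cons p ps)
      then have "f (s1 c (fst p)) (snd p) = s3 c (f (fst p) (snd p))"
        using f by (cases p) (auto simp: bilinear_on_def linear_on_def)
      with Cons show ?case by (cases p) (simp add: s3.scale_right_distrib)
    qed simp
    ultimately show "tensor_lift s1 s2 V W f (tensor_scale c t) = s3 c (tensor_lift s1 s2 V W f t)"
      using lift[OF qs] lift[OF *(1)] *(2) by simp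
  qed simp
qed

lemma lift_tens:
  assumes "vector_space s3" "bilinear_on s1 s2 s3 V W UNIV f" "v \<in> V" "w \<in> W"
  shows "tensor_lift s1 s2 V W f (tens s1 s2 v w) = f v w"
  using tensor_lift_sum[OF vs1 vs2 assms(1) sub1 sub2 assms(2), of "[(v, w)]"] assms(3,4) by simp

end

lemma linear_on_sum_subspace:
  assumes "linear_on s1 s2 V W f" "vector_space s1" "module.subspace s1 V" "\<And>i. i \<in> I \<Longrightarrow> g i \<in> V"
  shows "f (\<Sum>i\<in>I. g i) = (\<Sum>i\<in>I. f (g i))"
proof -
  interpret vector_space s1 by fact
  have add: "f (x + y) = f x + f y" if "x \<in> V" "y \<in> V" for x y using assms(1) that by (simp add: linear_on_def)
  have 0: "0 \<in> V" by (rule subspace_0[OF assms(3)])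
  from add[OF 0 0] have "f 0 = 0" by simp
  then show ?thesis using assms(4)
    by (induction I rule: infinite_finite_induct) (simp_all add: add subspace_sum[OF assms(3)])
qed

lemma bilinear_on_cong:
  assumes "\<And>v w. v \<in> V \<Longrightarrow> w \<in> W \<Longrightarrow> f v w = g v w"
    and "vector_space s1" "vector_space s2" "module.subspace s1 V" "module.subspace s2 W"
  shows "bilinear_on s1 s2 s3 V W X f \<longleftrightarrow> bilinear_on s1 s2 s3 V W X g"
proof -
  interpret s1: vector_space s1 by fact
  interpret s2: vector_space s2 by fact
  show ?thesis
    unfolding bilinear_on_def linear_on_def
    by (simp add: assms(1) s1.subspace_add[OF assms(4)] s1.subspace_scale[OF assms(4)]
        s2.subspace_add[OF assms(5)] s2.subspace_scale[OF assms(5)])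
qed

context subspace_pair
begin

lemma lift_sum:
  assumes "vector_space s3" "bilinear_on s1 s2 s3 V W UNIV f" "\<And>i. i \<in> I \<Longrightarrow> t i \<in> tensor_space s1 s2 V W"
  shows "tensor_lift s1 s2 V W f (\<Sum>i\<in>I. t i) = (\<Sum>i\<in>I. tensor_lift s1 s2 V W f (t i))"
  by (rule linear_on_sum_subspace[OF lift_linear[OF assms(1,2)] T.vector_space_axioms subspace_tensor_space assms(3)])

lemma lift_sum_tens:
  assumes "vector_space s3" "bilinear_on s1 s2 s3 V W UNIV f" "\<And>i. i \<in> I \<Longrightarrow> v i \<in> V" "\<And>i. i \<in> I \<Longrightarrow> w i \<in> W"
  shows "tensor_lift s1 s2 V W f (\<Sum>i\<in>I. tens s1 s2 (v i) (w i)) = (\<Sum>i\<in>I. f (v i) (w i))"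
proof -
  have "tensor_lift s1 s2 V W f (\<Sum>i\<in>I. tens s1 s2 (v i) (w i)) = (\<Sum>i\<in>I. tensor_lift s1 s2 V W f (tens s1 s2 (v i) (w i)))"
    using assms(3,4) by (intro lift_sum[OF assms(1,2)] tens_in_tensor_space)
  also have "\<dots> = (\<Sum>i\<in>I. f (v i) (w i))"
    using assms(3,4) by (intro sum.cong refl lift_tens[OF assms(1,2)])
  finally show ?thesis .
qed

lemma lift_scale:
  assumes "vector_space s3" "bilinear_on s1 s2 s3 V W UNIV f" "t \<in> tensor_space s1 s2 V W"
  shows "tensor_lift s1 s2 V W f (tensor_scale c t) = s3 c (tensor_lift s1 s2 V W f t)"
  using lift_linear[OF assms(1,2)] assms(3) by (simp add: linear_on_def)

text \<open>
  A map that is linear in each of three arguments induces a bilinear map when the first two are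
  combined to a tensor.  This applies to the partial coproducts in the hexagon identities.
\<close>

lemma bilinear_lift_family:
  assumes vs: "vector_space s3" "vector_space s4" "module.subspace s3 U"
    and f: "\<And>y. y \<in> U \<Longrightarrow> bilinear_on s1 s2 s4 V W UNIV (f y)"
    and lin: "\<And>v w. v \<in> V \<Longrightarrow> w \<in> W \<Longrightarrow> linear_on s3 s4 U UNIV (\<lambda>y. f y v w)"
  shows "bilinear_on tensor_scale s3 s4 (tensor_space s1 s2 V W) U UNIV (\<lambda>t y. tensor_lift s1 s2 V W (f y) t)"
  unfolding bilinear_on_def
proof (intro conjI ballI)
  fix y assume "y \<in> U"
  then show "linear_on tensor_scale s4 (tensor_space s1 s2 V W) UNIV (tensor_lift s1 s2 V W (f y))"
    using lift_linear[OF vs(2) f] by blast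
next
  interpret s3: vector_space s3 by fact
  interpret s4: vector_space s4 by fact
  fix t assume "t \<in> tensor_space s1 s2 V W"
  then obtain N :: nat and v w where vw: "\<And>i. i < N \<Longrightarrow> v i \<in> V" "\<And>i. i < N \<Longrightarrow> w i \<in> W"
    and t: "t = (\<Sum>i<N. tens s1 s2 (v i) (w i))" by (rule tensor_space_sum) blast
  have eq: "tensor_lift s1 s2 V W (f y) t = (\<Sum>i<N. f y (v i) (w i))" if "y \<in> U" for y
    unfolding t using vw by (intro lift_sum_tens[OF vs(2) f[OF that]]) auto
  have lin': "f (y + y') (v i) (w i) = f y (v i) (w i) + f y' (v i) (w i)"
      "f (s3 c y) (v i) (w i) = s4 c (f y (v i) (w i))" if "i < N" "y \<in> U" "y' \<in> U" for i y y' c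
    using lin[OF vw(1)[OF that(1)] vw(2)[OF that(1)]] that by (auto simp: linear_on_def)
  show "linear_on s3 s4 U UNIV (\<lambda>y. tensor_lift s1 s2 V W (f y) t)"
    unfolding linear_on_def
    using lin'(2)[OF _ _ s3.subspace_0[OF vs(3)]]
    by (auto simp: eq s3.subspace_add[OF vs(3)] s3.subspace_scale[OF vs(3)] lin'(1) sum.distrib
        s4.scale_sum_right)
qed

context
  fixes m1 m2
  assumes m1: "bilinear_on s1 s1 s1 V V V m1" and m2: "bilinear_on s2 s2 s2 W W W m2"
begin

lemma bilinear_mult_tens:
  assumes "x \<in> V" "y \<in> W"
  shows "bilinear_on s1 s2 tensor_scale V W UNIV (\<lambda>x' y'. tens s1 s2 (m1 x x') (m2 y y'))"
  using assms m1 m2 bilinear_tens by (auto simp: bilinear_on_def linear_on_def)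

lemma bilinear_mult_tens':
  assumes "x \<in> V" "y \<in> W"
  shows "bilinear_on s1 s2 tensor_scale V W UNIV (\<lambda>x' y'. tens s1 s2 (m1 x' x) (m2 y' y))"
  using assms m1 m2 bilinear_tens by (auto simp: bilinear_on_def linear_on_def)

lemma bilinear_inner_mult:
  assumes "t \<in> tensor_space s1 s2 V W"
  shows "bilinear_on s1 s2 tensor_scale V W UNIV
    (\<lambda>x y. tensor_lift s1 s2 V W (\<lambda>x' y'. tens s1 s2 (m1 x x') (m2 y y')) t)"
proof -
  obtain N :: nat and v w where vw: "\<And>i. i < N \<Longrightarrow> v i \<in> V" "\<And>i. i < N \<Longrightarrow> w i \<in> W"
    and t: "t = (\<Sum>i<N. tens s1 s2 (v i) (w i))" by (rule tensor_space_sum[OF assms]) blast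
  have eq: "tensor_lift s1 s2 V W (\<lambda>x' y'. tens s1 s2 (m1 x x') (m2 y y')) t
      = (\<Sum>i<N. tens s1 s2 (m1 x (v i)) (m2 y (w i)))" if "x \<in> V" "y \<in> W" for x y
    unfolding t using vw by (intro lift_sum_tens[OF T.vector_space_axioms bilinear_mult_tens[OF that]]) auto
  have "bilinear_on s1 s2 tensor_scale V W UNIV (\<lambda>x y. \<Sum>i<N. tens s1 s2 (m1 x (v i)) (m2 y (w i)))"
    using bilinear_mult_tens'[OF vw] unfolding bilinear_on_def linear_on_def
    by (simp add: sum.distrib T.scale_sum_right)
  moreover have "bilinear_on s1 s2 tensor_scale V W UNIV
      (\<lambda>x y. tensor_lift s1 s2 V W (\<lambda>x' y'. tens s1 s2 (m1 x x') (m2 y y')) t) \<longleftrightarrow>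
    bilinear_on s1 s2 tensor_scale V W UNIV (\<lambda>x y. \<Sum>i<N. tens s1 s2 (m1 x (v i)) (m2 y (w i)))"
    by (rule bilinear_on_cong[OF _ vs1 vs2 sub1 sub2]) (rule eq)
  ultimately show ?thesis by simp
qed

lemma mult_tens:
  assumes "a \<in> V" "b \<in> W" "c \<in> V" "d \<in> W"
  shows "tensor_mult s1 s2 V W m1 m2 (tens s1 s2 a b) (tens s1 s2 c d) = tens s1 s2 (m1 a c) (m2 b d)"
  unfolding tensor_mult_def
  using assms by (simp add: lift_tens[OF T.vector_space_axioms bilinear_inner_mult] tens_in_tensor_space
      lift_tens[OF T.vector_space_axioms bilinear_mult_tens])

lemma mult_closed: "x \<in> V \<Longrightarrow> y \<in> V \<Longrightarrow> m1 x y \<in> V" "x' \<in> W \<Longrightarrow> y' \<in> W \<Longrightarrow> m2 x' y' \<in> W"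
  using m1 m2 by (auto simp: bilinear_on_def linear_on_def)

lemma bilinear_tensor_mult:
  "bilinear_on tensor_scale tensor_scale tensor_scale (tensor_space s1 s2 V W) (tensor_space s1 s2 V W)
    (tensor_space s1 s2 V W) (tensor_mult s1 s2 V W m1 m2)"
proof -
  let ?T = "tensor_space s1 s2 V W" and ?m = "tensor_mult s1 s2 V W m1 m2"
  have left: "linear_on tensor_scale tensor_scale ?T UNIV (\<lambda>t. ?m t u)" if "u \<in> ?T" for u
    unfolding tensor_mult_def by (rule lift_linear[OF T.vector_space_axioms bilinear_inner_mult[OF that]])
  have right1: "linear_on tensor_scale tensor_scale ?T UNIV (?m (tens s1 s2 a b))" if "a \<in> V" "b \<in> W" for a b
  proof -
    have "?m (tens s1 s2 a b) u = tensor_lift s1 s2 V W (\<lambda>x' y'. tens s1 s2 (m1 a x') (m2 b y')) u" if "u \<in> ?T" for u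
      unfolding tensor_mult_def
      by (rule lift_tens[OF T.vector_space_axioms bilinear_inner_mult[OF that] \<open>a \<in> V\<close> \<open>b \<in> W\<close>])
    then show ?thesis using lift_linear[OF T.vector_space_axioms bilinear_mult_tens[OF that]]
      by (simp add: linear_on_def T.subspace_add[OF subspace_tensor_space] T.subspace_scale[OF subspace_tensor_space])
  qed
  have expand: "\<exists>(N::nat) v w. (\<forall>i<N. v i \<in> V \<and> w i \<in> W) \<and> t = (\<Sum>i<N. tens s1 s2 (v i) (w i)) \<and>
      (\<forall>u\<in>?T. ?m t u = (\<Sum>i<N. ?m (tens s1 s2 (v i) (w i)) u))" if "t \<in> ?T" for t
  proof -
    obtain N :: nat and v w where vw: "\<And>i. i < N \<Longrightarrow> v i \<in> V" "\<And>i. i < N \<Longrightarrow> w i \<in> W"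
      and t: "t = (\<Sum>i<N. tens s1 s2 (v i) (w i))" by (rule tensor_space_sum[OF \<open>t \<in> ?T\<close>]) blast
    have "?m t u = (\<Sum>i<N. ?m (tens s1 s2 (v i) (w i)) u)" if "u \<in> ?T" for u
      unfolding t using vw linear_on_sum_subspace[OF left[OF that] T.vector_space_axioms subspace_tensor_space, of "{..<N}"]
      by (simp add: tens_in_tensor_space)
    with vw t show ?thesis by blast
  qed
  have right: "linear_on tensor_scale tensor_scale ?T UNIV (?m t)" if t: "t \<in> ?T" for t
  proof -
    from expand[OF t] obtain N :: nat and v w where vw: "\<And>i. i < N \<Longrightarrow> v i \<in> V \<and> w i \<in> W"
      and eq: "\<And>u. u \<in> ?T \<Longrightarrow> ?m t u = (\<Sum>i<N. ?m (tens s1 s2 (v i) (w i)) u)" by blast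
    show ?thesis using right1 vw unfolding linear_on_def
      by (simp add: eq T.subspace_add[OF subspace_tensor_space] T.subspace_scale[OF subspace_tensor_space]
          sum.distrib T.scale_sum_right)
  qed
  have closed: "?m t u \<in> ?T" if t: "t \<in> ?T" and u: "u \<in> ?T" for t u
  proof -
    from expand[OF t] obtain N :: nat and v w where vw: "\<And>i. i < N \<Longrightarrow> v i \<in> V \<and> w i \<in> W"
      and eq: "?m t u = (\<Sum>i<N. ?m (tens s1 s2 (v i) (w i)) u)" using u by blast
    obtain N' :: nat and v' w' where vw': "\<And>i. i < N' \<Longrightarrow> v' i \<in> V" "\<And>i. i < N' \<Longrightarrow> w' i \<in> W"
      and u': "u = (\<Sum>i<N'. tens s1 s2 (v' i) (w' i))" by (rule tensor_space_sum[OF u]) blast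
    have "?m (tens s1 s2 (v i) (w i)) u = (\<Sum>j<N'. tens s1 s2 (m1 (v i) (v' j)) (m2 (w i) (w' j)))" if "i < N" for i
      unfolding u' using vw[OF that] vw'
        linear_on_sum_subspace[OF right1 T.vector_space_axioms subspace_tensor_space, of "v i" "w i" "{..<N'}"]
      by (simp add: tens_in_tensor_space mult_tens)
    then show ?thesis
      using vw vw' unfolding eq
      by (auto intro!: T.subspace_sum[OF subspace_tensor_space] tens_in_tensor_space mult_closed)
  qed
  show ?thesis
    using left right closed unfolding bilinear_on_def linear_on_def by blast
qed

lemma mult_sum:
  assumes "\<And>i. i \<in> I \<Longrightarrow> a i \<in> V" "\<And>i. i \<in> I \<Longrightarrow> b i \<in> W" "\<And>j. j \<in> J \<Longrightarrow> c j \<in> V" "\<And>j. j \<in> J \<Longrightarrow> d j \<in> W"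
  shows "tensor_mult s1 s2 V W m1 m2 (\<Sum>i\<in>I. tens s1 s2 (a i) (b i)) (\<Sum>j\<in>J. tens s1 s2 (c j) (d j))
    = (\<Sum>i\<in>I. \<Sum>j\<in>J. tens s1 s2 (m1 (a i) (c j)) (m2 (b i) (d j)))"
proof -
  let ?T = "tensor_space s1 s2 V W" and ?m = "tensor_mult s1 s2 V W m1 m2"
  have lin: "linear_on tensor_scale tensor_scale ?T ?T (\<lambda>t. ?m t u)" "linear_on tensor_scale tensor_scale ?T ?T (?m u)"
    if "u \<in> ?T" for u using bilinear_tensor_mult that by (auto simp: bilinear_on_def)
  note sum_eq = linear_on_sum_subspace[OF _ T.vector_space_axioms subspace_tensor_space]
  have u: "(\<Sum>j\<in>J. tens s1 s2 (c j) (d j)) \<in> ?T"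
    using assms by (intro T.subspace_sum[OF subspace_tensor_space] tens_in_tensor_space) auto
  show ?thesis
    using assms
    by (simp add: sum_eq[OF lin(1)[OF u]] sum_eq[OF lin(2)] tens_in_tensor_space mult_tens)
qed

end

end

section \<open>Minimal representations of tensors\<close>

context subspace_pair
begin

lemma tens_scale_right: "tens s1 s2 v (s2 c w) = tensor_scale c (tens s1 s2 v w)"
  and tens_add_left: "tens s1 s2 (v + v') w = tens s1 s2 v w + tens s1 s2 v' w"
  and tens_add_right: "tens s1 s2 v (w + w') = tens s1 s2 v w + tens s1 s2 v w'"
  using bilinear_tens by (simp_all add: bilinear_on_def linear_on_def)

lemma tens_sum_left: "tens s1 s2 (\<Sum>i\<in>I. f i) w = (\<Sum>i\<in>I. tens s1 s2 (f i) w)"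
  and tens_sum_right: "tens s1 s2 v (\<Sum>i\<in>I. g i) = (\<Sum>i\<in>I. tens s1 s2 v (g i))"
  using bilinear_tens
  by (auto simp: bilinear_on_def intro!: linear_on_sum[of s1 tensor_scale UNIV "\<lambda>v. tens s1 s2 v w"]
      linear_on_sum[of s2 tensor_scale UNIV "tens s1 s2 v"])

lemma tens_zero_left: "tens s1 s2 0 w = 0" and tens_zero_right: "tens s1 s2 v 0 = 0"
  using tens_add_left[of 0 0 w] tens_add_right[of v 0 0] by simp_all

text \<open>
  In a representation with the least number of terms both families are linearly independent: a
  relation in one of them would allow one term to be absorbed by the others.
\<close>

lemma minimal_representation:
  assumes t: "t \<in> tensor_space s1 s2 V W"
  obtains I :: "nat set" and x y where "finite I" "\<And>i. i \<in> I \<Longrightarrow> x i \<in> V" "\<And>i. i \<in> I \<Longrightarrow> y i \<in> W"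
    "t = (\<Sum>i\<in>I. tens s1 s2 (x i) (y i))"
    "\<forall>c. (\<Sum>i\<in>I. s1 (c i) (x i)) = 0 \<longrightarrow> (\<forall>i\<in>I. c i = 0)"
    "\<forall>c. (\<Sum>i\<in>I. s2 (c i) (y i)) = 0 \<longrightarrow> (\<forall>i\<in>I. c i = 0)"
proof -
  define P where "P N I x y \<longleftrightarrow> finite I \<and> card I = N \<and> (\<forall>i\<in>I. x i \<in> V \<and> y i \<in> W) \<and>
    t = (\<Sum>i\<in>I. tens s1 s2 (x i) (y i))" for N and I :: "nat set" and x y
  obtain N0 :: nat and v w where vw: "\<And>i. i < N0 \<Longrightarrow> v i \<in> V" "\<And>i. i < N0 \<Longrightarrow> w i \<in> W"
    "t = (\<Sum>i<N0. tens s1 s2 (v i) (w i))" by (rule tensor_space_sum[OF t]) blast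
  have "P N0 {..<N0} v w" using vw by (simp add: P_def)
  then have ex: "\<exists>N I x y. P N I x y" by blast
  define N where "N = (LEAST N. \<exists>I x y. P N I x y)"
  have "\<exists>I x y. P N I x y" unfolding N_def by (rule LeastI_ex) (rule ex)
  then obtain I x y where P: "P N I x y" by blast
  have min: False if "P M I' x' y'" "M < N" for M I' x' y'
    using that not_less_Least[of M "\<lambda>N. \<exists>I x y. P N I x y"] unfolding N_def by blast
  from P have I: "finite I" "card I = N" and xy: "\<And>i. i \<in> I \<Longrightarrow> x i \<in> V" "\<And>i. i \<in> I \<Longrightarrow> y i \<in> W"
    and t_eq: "t = (\<Sum>i\<in>I. tens s1 s2 (x i) (y i))" by (auto simp: P_def)
  have smaller: "card (I - {k}) < N" if "k \<in> I" for k using that I card_Diff1_less by metis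
  have "c k = 0" if 0: "(\<Sum>i\<in>I. s1 (c i) (x i)) = 0" and k: "k \<in> I" for c k
  proof (rule ccontr)
    assume ck: "c k \<noteq> 0"
    define y' where "y' i = y i - s2 (c i / c k) (y k)" for i
    have "(\<Sum>i\<in>I. tens s1 s2 (x i) (s2 (c i / c k) (y k))) = tens s1 s2 (s1 (1 / c k) (\<Sum>i\<in>I. s1 (c i) (x i))) (y k)"
      by (simp add: s1.scale_sum_right tens_sum_left tens_scale_left tens_scale_right)
    then have "(\<Sum>i\<in>I. tens s1 s2 (x i) (s2 (c i / c k) (y k))) = 0" by (simp add: 0 tens_zero_left)
    moreover have "tens s1 s2 (x i) (y i) = tens s1 s2 (x i) (y' i) + tens s1 s2 (x i) (s2 (c i / c k) (y k))" for i
      by (simp add: y'_def tens_add_right[symmetric])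
    ultimately have "t = (\<Sum>i\<in>I. tens s1 s2 (x i) (y' i))" by (simp only: t_eq sum.distrib) simp
    also have "\<dots> = tens s1 s2 (x k) (y' k) + (\<Sum>i\<in>I - {k}. tens s1 s2 (x i) (y' i))"
      by (rule sum.remove[OF I(1) k])
    also have "y' k = 0" using ck by (simp add: y'_def)
    finally have "P (card (I - {k})) (I - {k}) x y'"
      using I xy k by (simp add: P_def y'_def tens_zero_right s2.subspace_diff[OF sub2] s2.subspace_scale[OF sub2])
    then show False using min smaller[OF k] by blast
  qed
  moreover have "c k = 0" if 0: "(\<Sum>i\<in>I. s2 (c i) (y i)) = 0" and k: "k \<in> I" for c k
  proof (rule ccontr)
    assume ck: "c k \<noteq> 0"
    define x' where "x' i = x i - s1 (c i / c k) (x k)" for i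
    have "(\<Sum>i\<in>I. tens s1 s2 (s1 (c i / c k) (x k)) (y i)) = tens s1 s2 (x k) (s2 (1 / c k) (\<Sum>i\<in>I. s2 (c i) (y i)))"
      by (simp add: s2.scale_sum_right tens_sum_right tens_scale_left tens_scale_right)
    then have "(\<Sum>i\<in>I. tens s1 s2 (s1 (c i / c k) (x k)) (y i)) = 0" by (simp add: 0 tens_zero_right)
    moreover have "tens s1 s2 (x i) (y i) = tens s1 s2 (x' i) (y i) + tens s1 s2 (s1 (c i / c k) (x k)) (y i)" for i
      by (simp add: x'_def tens_add_left[symmetric])
    ultimately have "t = (\<Sum>i\<in>I. tens s1 s2 (x' i) (y i))" by (simp only: t_eq sum.distrib) simp
    also have "\<dots> = tens s1 s2 (x' k) (y k) + (\<Sum>i\<in>I - {k}. tens s1 s2 (x' i) (y i))"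
      by (rule sum.remove[OF I(1) k])
    also have "x' k = 0" using ck by (simp add: x'_def)
    finally have "P (card (I - {k})) (I - {k}) x' y"
      using I xy k by (simp add: P_def x'_def tens_zero_left s1.subspace_diff[OF sub1] s1.subspace_scale[OF sub1])
    then show False using min smaller[OF k] by blast
  qed
  ultimately show ?thesis using that[OF I(1) xy t_eq] by blast
qed

end

lemma (in vector_space) dual_functionals:
  assumes fin: "finite I" and ind: "\<forall>c. (\<Sum>i\<in>I. scale (c i) (x i)) = 0 \<longrightarrow> (\<forall>i\<in>I. c i = 0)"
  obtains \<xi> where "\<And>i. linear_on scale (*) UNIV UNIV (\<xi> i)"
    "\<And>i j. i \<in> I \<Longrightarrow> j \<in> I \<Longrightarrow> \<xi> i (x j) = (if i = j then 1 else 0)"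
proof -
  interpret functional: vector_space_pair scale "(*)"
    using vector_space_axioms vector_space_mult by (simp add: vector_space_pair_def)
  note inj = indexed_independent(1)[OF fin ind] and indep = indexed_independent(2)[OF fin ind]
  have "\<exists>\<phi>. linear_on scale (*) UNIV UNIV \<phi> \<and> (\<forall>j\<in>I. \<phi> (x j) = (if i = j then 1 else 0))" for i
  proof -
    obtain \<phi> where \<phi>: "Vector_Spaces.linear scale (*) \<phi>"
        "\<forall>b\<in>x ` I. \<phi> b = (if i = the_inv_into I x b then 1 else 0)"
      using functional.linear_independent_extend[OF indep, of "\<lambda>b. if i = the_inv_into I x b then 1 else 0"] by blast
    then show ?thesis using inj
      by (intro exI[of _ \<phi>]) (simp add: linear_iff_linear_on_UNIV vector_space_axioms vector_space_mult the_inv_into_f_f)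
  qed
  then obtain \<xi> where "\<forall>i. linear_on scale (*) UNIV UNIV (\<xi> i) \<and> (\<forall>j\<in>I. \<xi> i (x j) = (if i = j then 1 else 0))"
    by metis
  then show ?thesis using that by blast
qed

lemma bilinear_on_swap: "bilinear_on s1 s2 s3 V W X f \<Longrightarrow> bilinear_on s2 s1 s3 W V X (\<lambda>w v. f v w)"
  by (simp add: bilinear_on_def)

context algebra_on
begin

sublocale pair2: subspace_pair scale scale V V
  by unfold_locales (rule subspace_carrier)+

lemma subspace_pair3: "subspace_pair scale tensor_scale V (tensor_space scale scale V V)"
  by (rule subspace_pair.intro[OF vector_space_axioms pair2.T.vector_space_axioms subspace_carrier
        pair2.subspace_tensor_space])

sublocale pair3: subspace_pair scale tensor_scale V "tensor_space scale scale V V"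
  by (rule subspace_pair3)

abbreviation T2 where "T2 \<equiv> tens scale scale"
abbreviation T3 where "T3 v t \<equiv> tens scale tensor_scale v t"
abbreviation lift3 where "lift3 \<equiv> tensor_lift scale tensor_scale V V2"

lemma mult_closed: "a \<in> V \<Longrightarrow> b \<in> V \<Longrightarrow> mult a b \<in> V"
  and mult_add_left: "a \<in> V \<Longrightarrow> a' \<in> V \<Longrightarrow> b \<in> V \<Longrightarrow> mult (a + a') b = mult a b + mult a' b"
  and mult_add_right: "a \<in> V \<Longrightarrow> b \<in> V \<Longrightarrow> b' \<in> V \<Longrightarrow> mult a (b + b') = mult a b + mult a b'"
  and mult_scale_left: "a \<in> V \<Longrightarrow> b \<in> V \<Longrightarrow> mult (scale c a) b = scale c (mult a b)"
  and mult_scale_right: "a \<in> V \<Longrightarrow> b \<in> V \<Longrightarrow> mult a (scale c b) = scale c (mult a b)"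
  using bilinear_mult by (auto simp: bilinear_on_def linear_on_def)

lemma mult_sum_left: "(\<And>i. i \<in> I \<Longrightarrow> f i \<in> V) \<Longrightarrow> b \<in> V \<Longrightarrow> mult (\<Sum>i\<in>I. f i) b = (\<Sum>i\<in>I. mult (f i) b)"
  using linear_on_sum_subspace[OF _ vector_space_axioms subspace_carrier, of scale V "\<lambda>a. mult a b"] bilinear_mult
  by (auto simp: bilinear_on_def)

lemma mult_sum_right: "(\<And>i. i \<in> I \<Longrightarrow> f i \<in> V) \<Longrightarrow> b \<in> V \<Longrightarrow> mult b (\<Sum>i\<in>I. f i) = (\<Sum>i\<in>I. mult b (f i))"
  using linear_on_sum_subspace[OF _ vector_space_axioms subspace_carrier, of scale V "mult b"] bilinear_mult
  by (auto simp: bilinear_on_def)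

lemma bilinear_T3_left: "y \<in> V \<Longrightarrow> bilinear_on scale scale tensor_scale V V UNIV (\<lambda>u v. T3 u (T2 v y))"
  by (simp add: bilinear_on_def linear_on_def pair3.tens_add_left pair3.tens_add_right pair3.tens_scale_left
      pair3.tens_scale_right pair2.tens_add_left pair2.tens_scale_left)

lemma bilinear_T3_right: "bilinear_on scale scale tensor_scale V V UNIV (\<lambda>u v. T3 x (T2 u v))"
  by (simp add: bilinear_on_def linear_on_def pair3.tens_add_right pair3.tens_scale_right
      pair2.tens_add_left pair2.tens_scale_left pair2.tens_add_right pair2.tens_scale_right)

lemma lift_T3_right:
  assumes "t \<in> V2" shows "lift2 (\<lambda>u v. T3 x (T2 u v)) t = T3 x t"
proof -
  obtain N :: nat and u v where uv: "\<And>i. i < N \<Longrightarrow> u i \<in> V" "\<And>i. i < N \<Longrightarrow> v i \<in> V"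
    "t = (\<Sum>i<N. T2 (u i) (v i))" by (rule pair2.tensor_space_sum[OF assms]) blast
  have "lift2 (\<lambda>u v. T3 x (T2 u v)) (\<Sum>i<N. T2 (u i) (v i)) = (\<Sum>i<N. T3 x (T2 (u i) (v i)))"
    using uv by (intro pair2.lift_sum_tens[OF pair3.T.vector_space_axioms bilinear_T3_right]) auto
  then show ?thesis by (simp add: uv(3) pair3.tens_sum_right)
qed

lemmas V2_sum = pair2.T.subspace_sum[OF pair2.subspace_tensor_space]
  and V2_scale = pair2.T.subspace_scale[OF pair2.subspace_tensor_space]
  and V3_sum = pair3.T.subspace_sum[OF pair3.subspace_tensor_space]

lemma lift_double_sum:
  assumes s3: "vector_space s3" and f: "bilinear_on scale scale s3 V V UNIV f"
    and u: "\<And>a. a \<in> I \<Longrightarrow> u a \<in> V" and v: "\<And>a. a \<in> I \<Longrightarrow> v a \<in> V"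
  shows "lift2 f (\<Sum>a\<in>I. \<Sum>b\<in>I. tensor_scale (c a b) (T2 (u a) (v b))) = (\<Sum>a\<in>I. \<Sum>b\<in>I. s3 (c a b) (f (u a) (v b)))"
proof -
  have mem: "T2 (u a) (v b) \<in> V2" if "a \<in> I" "b \<in> I" for a b using that u v by (simp add: pair2.tens_in_tensor_space)
  then have mem': "tensor_scale (c a b) (T2 (u a) (v b)) \<in> V2" if "a \<in> I" "b \<in> I" for a b
    using that V2_scale by blast
  have "lift2 f (\<Sum>a\<in>I. \<Sum>b\<in>I. tensor_scale (c a b) (T2 (u a) (v b)))
      = (\<Sum>a\<in>I. lift2 f (\<Sum>b\<in>I. tensor_scale (c a b) (T2 (u a) (v b))))"
    by (rule pair2.lift_sum[OF s3 f]) (intro V2_sum mem')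
  also have "\<dots> = (\<Sum>a\<in>I. \<Sum>b\<in>I. lift2 f (tensor_scale (c a b) (T2 (u a) (v b))))"
    by (intro sum.cong refl pair2.lift_sum[OF s3 f] mem')
  also have "\<dots> = (\<Sum>a\<in>I. \<Sum>b\<in>I. s3 (c a b) (f (u a) (v b)))"
    by (intro sum.cong refl) (simp add: pair2.lift_scale[OF s3 f] mem pair2.lift_tens[OF s3 f] u v)
  finally show ?thesis .
qed

end

section \<open>The structure constants of a quasitriangular structure\<close>

text \<open>
  A minimal representation of \<open>R\<close>.  The constants \<open>n\<close> give the product of the \<open>x i\<close> and the
  coproduct of the \<open>y i\<close>, the latter with the two factors swapped; the constants \<open>m\<close> give the product of the \<open>y i\<close> and
  the coproduct of the \<open>x i\<close>.  So the two spans are dual bialgebras, up to an opposite coproduct.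
\<close>

locale quasitriangular_coordinates = quasitriangular_on scale V mult one \<Delta> \<epsilon> S R
  for scale :: "'k::field \<Rightarrow> 'v::ab_group_add \<Rightarrow> 'v" (infixr \<open>*s\<close> 75)
    and V :: "'v set"
    and mult :: "'v \<Rightarrow> 'v \<Rightarrow> 'v" (infixl \<open>\<cdot>\<close> 70)
    and one :: 'v (\<open>\<one>\<close>)
    and \<Delta> :: "'v \<Rightarrow> ('v, 'v, 'k) tensor"
    and \<epsilon> :: "'v \<Rightarrow> 'k"
    and S :: "'v \<Rightarrow> 'v"
    and R :: "('v, 'v, 'k) tensor" +
  fixes I :: "nat set" and x y :: "nat \<Rightarrow> 'v" and n m :: "nat \<Rightarrow> nat \<Rightarrow> nat \<Rightarrow> 'k"
  assumes finite_I: "finite I"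
    and x_closed: "i \<in> I \<Longrightarrow> x i \<in> V" and y_closed: "i \<in> I \<Longrightarrow> y i \<in> V"
    and R_eq: "R = (\<Sum>i\<in>I. tens scale scale (x i) (y i))"
    and x_indep: "\<forall>c. (\<Sum>i\<in>I. c i *s x i) = 0 \<longrightarrow> (\<forall>i\<in>I. c i = 0)"
    and y_indep: "\<forall>c. (\<Sum>i\<in>I. c i *s y i) = 0 \<longrightarrow> (\<forall>i\<in>I. c i = 0)"
    and n_support: "n a b j \<noteq> 0 \<Longrightarrow> a \<in> I \<and> b \<in> I \<and> j \<in> I"
    and m_support: "m a b j \<noteq> 0 \<Longrightarrow> a \<in> I \<and> b \<in> I \<and> j \<in> I"
    and x_mult: "a \<in> I \<Longrightarrow> b \<in> I \<Longrightarrow> x a \<cdot> x b = (\<Sum>j\<in>I. n a b j *s x j)"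
    and y_mult: "a \<in> I \<Longrightarrow> b \<in> I \<Longrightarrow> y a \<cdot> y b = (\<Sum>j\<in>I. m a b j *s y j)"
    and x_comult: "j \<in> I \<Longrightarrow> \<Delta> (x j) = (\<Sum>a\<in>I. \<Sum>b\<in>I. tensor_scale (m a b j) (tens scale scale (x a) (x b)))"
    and y_comult: "j \<in> I \<Longrightarrow> \<Delta> (y j) = (\<Sum>a\<in>I. \<Sum>b\<in>I. tensor_scale (n a b j) (tens scale scale (y b) (y a)))"

context quasitriangular_on
begin

lemma comult_closed: "h \<in> V \<Longrightarrow> \<Delta> h \<in> tensor_space scale scale V V"
  and comult_add: "h \<in> V \<Longrightarrow> g \<in> V \<Longrightarrow> \<Delta> (h + g) = \<Delta> h + \<Delta> g"
  and comult_scale: "h \<in> V \<Longrightarrow> \<Delta> (c *s h) = tensor_scale c (\<Delta> h)"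
  using linear_comult by (auto simp: linear_on_def)

lemma functional_lift:
  assumes "linear_on scale (*) UNIV UNIV \<phi>" "linear_on scale (*) UNIV UNIV \<psi>"
  shows "bilinear_on scale scale (*) V V UNIV (\<lambda>p q. \<phi> p * \<psi> q)"
proof -
  have "\<phi> (a + b) = \<phi> a + \<phi> b" "\<phi> (c *s a) = c * \<phi> a"
    "\<psi> (a + b) = \<psi> a + \<psi> b" "\<psi> (c *s a) = c * \<psi> a" for a b c
    using assms by (auto simp: linear_on_def)
  then show ?thesis
    by (simp add: bilinear_on_def linear_on_def distrib_left distrib_right mult.assoc mult.left_commute)
qed

text \<open>
  Both hexagon identities are equations between triple tensors.  Their first or last factors run through
  one of the two independent families on the left-hand side; applying the dual functionals to one leg gives
  the coproducts, and applying them to the other two legs gives the products.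
\<close>

lemma exists_coordinates:
  "\<exists>I x y n m. quasitriangular_coordinates scale V mult one \<Delta> \<epsilon> S R I x y n m"
proof -
  note vsT2 = pair2.T.vector_space_axioms and vsT3 = pair3.T.vector_space_axioms
  obtain I :: "nat set" and x y where I: "finite I" and xV: "\<And>i. i \<in> I \<Longrightarrow> x i \<in> V" and yV: "\<And>i. i \<in> I \<Longrightarrow> y i \<in> V"
    and R: "R = (\<Sum>i\<in>I. T2 (x i) (y i))"
    and x_indep: "\<forall>c. (\<Sum>i\<in>I. c i *s x i) = 0 \<longrightarrow> (\<forall>i\<in>I. c i = 0)"
    and y_indep: "\<forall>c. (\<Sum>i\<in>I. c i *s y i) = 0 \<longrightarrow> (\<forall>i\<in>I. c i = 0)"
    by (rule pair2.minimal_representation[OF R_closed]) (rule that; assumption)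
  obtain \<xi> where \<xi>: "\<And>i. linear_on scale (*) UNIV UNIV (\<xi> i)"
    "\<And>i j. i \<in> I \<Longrightarrow> j \<in> I \<Longrightarrow> \<xi> i (x j) = (if i = j then 1 else 0)"
    by (rule dual_functionals[OF I x_indep]) (rule that; assumption)
  obtain \<eta> where \<eta>: "\<And>i. linear_on scale (*) UNIV UNIV (\<eta> i)"
    "\<And>i j. i \<in> I \<Longrightarrow> j \<in> I \<Longrightarrow> \<eta> i (y j) = (if i = j then 1 else 0)"
    by (rule dual_functionals[OF I y_indep]) (rule that; assumption)
  have \<xi>_lin: "\<xi> i (a + b) = \<xi> i a + \<xi> i b" "\<xi> i (c *s a) = c * \<xi> i a"
    and \<eta>_lin: "\<eta> i (a + b) = \<eta> i a + \<eta> i b" "\<eta> i (c *s a) = c * \<eta> i a" for i a b c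
    using \<xi>(1) \<eta>(1) by (auto simp: linear_on_def)
  have oneV: "one \<in> V" by (rule one_closed)
  note bil_m2 = pair2.bilinear_tensor_mult[OF bilinear_mult bilinear_mult]
  have lift_R: "lift2 F R = (\<Sum>i\<in>I. F (x i) (y i))" if "bilinear_on scale scale tensor_scale V V UNIV F"
    for F :: "'v \<Rightarrow> 'v \<Rightarrow> ('v, ('v, 'v, 'k) tensor, 'k) tensor"
    unfolding R by (rule pair2.lift_sum_tens[OF vsT3 that]) (rule xV yV, assumption)+
  have R13: "lift2 (\<lambda>x y. T3 x (T2 one y)) R = (\<Sum>a\<in>I. T3 (x a) (T2 one (y a)))"
    by (rule lift_R[of "\<lambda>x y. T3 x (T2 one y)"])
      (simp add: bilinear_on_def linear_on_def pair3.tens_add_left pair3.tens_add_right pair3.tens_scale_left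
        pair3.tens_scale_right pair2.tens_add_right pair2.tens_scale_right)
  have R12: "lift2 (\<lambda>x y. T3 x (T2 y one)) R = (\<Sum>b\<in>I. T3 (x b) (T2 (y b) one))"
    by (rule lift_R[of "\<lambda>x y. T3 x (T2 y one)"])
      (simp add: bilinear_on_def linear_on_def pair3.tens_add_left pair3.tens_add_right pair3.tens_scale_left
        pair3.tens_scale_right pair2.tens_add_left pair2.tens_scale_left)
  have R23: "lift2 (\<lambda>x y. T3 one (T2 x y)) R = (\<Sum>b\<in>I. T3 one (T2 (x b) (y b)))"
    by (rule lift_R[OF bilinear_T3_right])
  have hexR: "(\<Sum>i\<in>I. T3 (x i) (\<Delta> (y i))) = (\<Sum>a\<in>I. \<Sum>b\<in>I. T3 (mult (x a) (x b)) (T2 (y b) (y a)))"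
  proof -
    have "(\<Sum>i\<in>I. T3 (x i) (\<Delta> (y i))) = (\<Sum>i\<in>I. lift2 (\<lambda>u v. T3 (x i) (T2 u v)) (\<Delta> (y i)))"
      by (intro sum.cong refl) (simp add: lift_T3_right comult_closed yV)
    also have "\<dots> = lift2 (\<lambda>x y. lift2 (\<lambda>u v. T3 x (T2 u v)) (\<Delta> y)) R"
    proof (rule lift_R[of "\<lambda>x y. lift2 (\<lambda>u v. T3 x (T2 u v)) (\<Delta> y)", symmetric])
      have "bilinear_on scale scale tensor_scale V V UNIV (\<lambda>x y. T3 x (\<Delta> y))"
        by (simp add: bilinear_on_def linear_on_def comult_add comult_scale pair3.tens_add_left
            pair3.tens_add_right pair3.tens_scale_left pair3.tens_scale_right)
      moreover have "bilinear_on scale scale tensor_scale V V UNIV (\<lambda>x y. lift2 (\<lambda>u v. T3 x (T2 u v)) (\<Delta> y))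
        \<longleftrightarrow> bilinear_on scale scale tensor_scale V V UNIV (\<lambda>x y. T3 x (\<Delta> y))"
        by (rule bilinear_on_cong[OF _ vector_space_axioms vector_space_axioms subspace_carrier subspace_carrier])
          (simp add: lift_T3_right comult_closed)
      ultimately show "bilinear_on scale scale tensor_scale V V UNIV (\<lambda>x y. lift2 (\<lambda>u v. T3 x (T2 u v)) (\<Delta> y))"
        by simp
    qed
    also have "\<dots> = tensor_mult scale tensor_scale V V2 mult (mult2)
        (\<Sum>a\<in>I. T3 (x a) (T2 one (y a))) (\<Sum>b\<in>I. T3 (x b) (T2 (y b) one))"
      by (simp only: R_comult_right R13 R12)
    also have "\<dots> = (\<Sum>a\<in>I. \<Sum>b\<in>I. T3 (mult (x a) (x b))
            (mult2 (T2 one (y a)) (T2 (y b) one)))"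
      by (rule pair3.mult_sum[OF bilinear_mult bil_m2]) (simp_all add: xV yV oneV pair2.tens_in_tensor_space)
    also have "\<dots> = (\<Sum>a\<in>I. \<Sum>b\<in>I. T3 (mult (x a) (x b)) (T2 (y b) (y a)))"
      by (intro sum.cong refl) (simp add: pair2.mult_tens[OF bilinear_mult bilinear_mult] yV oneV one_mult mult_one)
    finally show ?thesis .
  qed
  define K where "K t y = lift2 (\<lambda>u v. T3 u (T2 v y)) t" for t y
  have bilK: "bilinear_on tensor_scale scale tensor_scale V2 V UNIV K"
    unfolding K_def
    by (rule pair2.bilinear_lift_family[OF vector_space_axioms vsT3 subspace_carrier bilinear_T3_left])
      (simp_all add: linear_on_def pair3.tens_add_right pair3.tens_scale_right pair2.tens_add_right pair2.tens_scale_right)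
  have hexL: "(\<Sum>i\<in>I. K (\<Delta> (x i)) (y i)) = (\<Sum>a\<in>I. \<Sum>b\<in>I. T3 (x a) (T2 (x b) (mult (y a) (y b))))"
  proof -
    have "(\<Sum>i\<in>I. K (\<Delta> (x i)) (y i)) = lift2 (\<lambda>x y. lift2 (\<lambda>u v. T3 u (T2 v y)) (\<Delta> x)) R"
      unfolding K_def[symmetric]
      by (rule lift_R[of "\<lambda>x y. K (\<Delta> x) y", symmetric])
        (use bilK in \<open>auto simp: bilinear_on_def linear_on_def comult_add comult_scale comult_closed\<close>)
    also have "\<dots> = tensor_mult scale tensor_scale V V2 mult (mult2)
        (\<Sum>a\<in>I. T3 (x a) (T2 one (y a))) (\<Sum>b\<in>I. T3 one (T2 (x b) (y b)))"
      by (simp only: R_comult_left R13 R23)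
    also have "\<dots> = (\<Sum>a\<in>I. \<Sum>b\<in>I. T3 (mult (x a) one)
            (mult2 (T2 one (y a)) (T2 (x b) (y b))))"
      by (rule pair3.mult_sum[OF bilinear_mult bil_m2]) (simp_all add: xV yV oneV pair2.tens_in_tensor_space)
    also have "\<dots> = (\<Sum>a\<in>I. \<Sum>b\<in>I. T3 (x a) (T2 (x b) (mult (y a) (y b))))"
      by (intro sum.cong refl) (simp add: pair2.mult_tens[OF bilinear_mult bilinear_mult] xV yV oneV one_mult mult_one)
    finally show ?thesis .
  qed
  \<comment> \<open>The value 0 outside \<open>I\<close> makes associativity and compatibility hold for all indices.\<close>
  define n where "n a b j = (if a \<in> I \<and> b \<in> I \<and> j \<in> I then \<xi> j (mult (x a) (x b)) else 0)" for a b j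
  define m where "m a b j = (if a \<in> I \<and> b \<in> I \<and> j \<in> I then \<eta> j (mult (y a) (y b)) else 0)" for a b j
  have V2_mem: "T2 (y b) (y a) \<in> V2" "T2 (x b) (mult (y a) (y b')) \<in> V2" "mult (x a) (x b) \<in> V" "mult (y a) (y b) \<in> V"
    if "a \<in> I" "b \<in> I" "b' \<in> I" for a b b'
    using that by (simp_all add: pair2.tens_in_tensor_space mult_closed xV yV)
  have eval_list: "\<exists>(N::nat) u v. (\<forall>i<N. u i \<in> V \<and> v i \<in> V) \<and> t = (\<Sum>i<N. T2 (u i) (v i))" if t: "t \<in> V2" for t
  proof -
    obtain N :: nat and u v where "\<And>i. i < N \<Longrightarrow> u i \<in> V" "\<And>i. i < N \<Longrightarrow> v i \<in> V" "t = (\<Sum>i<N. T2 (u i) (v i))"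
      by (rule pair2.tensor_space_sum[OF t]) blast
    then show ?thesis by blast
  qed
  have K_eq: "\<exists>(N::nat) u v. (\<forall>i<N. u i \<in> V \<and> v i \<in> V) \<and> t = (\<Sum>i<N. T2 (u i) (v i)) \<and>
      K t q = (\<Sum>i<N. T3 (u i) (T2 (v i) q))" if t: "t \<in> V2" and q: "q \<in> V" for t q
  proof -
    obtain N :: nat and u v where uv: "\<And>i. i < N \<Longrightarrow> u i \<in> V" "\<And>i. i < N \<Longrightarrow> v i \<in> V"
      and t: "t = (\<Sum>i<N. T2 (u i) (v i))" using eval_list[OF t] by blast
    have "K t q = (\<Sum>i<N. T3 (u i) (T2 (v i) q))"
      unfolding K_def t using uv by (intro pair2.lift_sum_tens[OF vsT3 bilinear_T3_left[OF q]]) auto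
    with uv t show ?thesis by blast
  qed
  have K_mem: "K t q \<in> tensor_space scale tensor_scale V V2" if t: "t \<in> V2" and q: "q \<in> V" for t q
  proof -
    obtain N :: nat and u v where uv: "\<And>i. i < N \<Longrightarrow> u i \<in> V" "\<And>i. i < N \<Longrightarrow> v i \<in> V"
      and K: "K t q = (\<Sum>i<N. T3 (u i) (T2 (v i) q))" using K_eq[OF t q] by blast
    show ?thesis unfolding K using uv q
      by (auto intro!: V3_sum pair3.tens_in_tensor_space
          pair2.tens_in_tensor_space)
  qed
  have y_comult: "\<Delta> (y j) = (\<Sum>a\<in>I. \<Sum>b\<in>I. tensor_scale (n a b j) (T2 (y b) (y a)))" if j: "j \<in> I" for j
  proof -
    define F where "F = (\<lambda>v (t :: ('v, 'v, 'k) tensor). tensor_scale (\<xi> j v) t)"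
    have F: "bilinear_on scale tensor_scale tensor_scale V V2 UNIV F"
      by (simp add: F_def bilinear_on_def linear_on_def \<xi>_lin pair2.T.scale_left_distrib pair2.T.scale_right_distrib mult.commute)
    note L = pair3.lift_sum_tens[OF vsT2 F] and Ls = pair3.lift_sum[OF vsT2 F]
    have "lift3 F (\<Sum>i\<in>I. T3 (x i) (\<Delta> (y i))) = (\<Sum>i\<in>I. F (x i) (\<Delta> (y i)))"
      by (rule L) (simp_all add: xV yV comult_closed)
    also have "\<dots> = (\<Sum>i\<in>I. if j = i then \<Delta> (y i) else 0)"
      unfolding F_def using \<xi>(2)[OF j] by (intro sum.cong refl) simp
    also have "\<dots> = \<Delta> (y j)" using I j by simp
    finally have 1: "lift3 F (\<Sum>i\<in>I. T3 (x i) (\<Delta> (y i))) = \<Delta> (y j)" .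
    have "lift3 F (\<Sum>a\<in>I. \<Sum>b\<in>I. T3 (mult (x a) (x b)) (T2 (y b) (y a)))
        = (\<Sum>a\<in>I. lift3 F (\<Sum>b\<in>I. T3 (mult (x a) (x b)) (T2 (y b) (y a))))"
      by (rule Ls) (intro V3_sum pair3.tens_in_tensor_space V2_mem)
    also have "\<dots> = (\<Sum>a\<in>I. \<Sum>b\<in>I. F (mult (x a) (x b)) (T2 (y b) (y a)))"
      by (intro sum.cong refl L V2_mem)
    also have "\<dots> = (\<Sum>a\<in>I. \<Sum>b\<in>I. tensor_scale (n a b j) (T2 (y b) (y a)))"
      unfolding F_def n_def using j by (intro sum.cong refl) simp
    finally show ?thesis using 1 hexR by simp
  qed
  have x_comult: "\<Delta> (x j) = (\<Sum>a\<in>I. \<Sum>b\<in>I. tensor_scale (m a b j) (T2 (x a) (x b)))" if j: "j \<in> I" for j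
  proof -
    define G where "G = (\<lambda>v. \<lambda>p q. tensor_scale (\<eta> j q) (T2 v p))"
    define F where "F = (\<lambda>v t. lift2 (G v) t)"
    have G: "bilinear_on scale scale tensor_scale V V UNIV (G v)" for v
      by (simp add: G_def bilinear_on_def linear_on_def \<eta>_lin pair2.T.scale_left_distrib
          pair2.T.scale_right_distrib pair2.tens_add_right pair2.tens_scale_right mult.commute)
    have F: "bilinear_on scale tensor_scale tensor_scale V V2 UNIV F"
      unfolding F_def
      by (rule bilinear_on_swap, rule pair2.bilinear_lift_family[OF vector_space_axioms vsT2 subspace_carrier G])
        (simp add: G_def linear_on_def pair2.tens_add_left pair2.tens_scale_left pair2.T.scale_right_distrib mult.commute)
    note L = pair3.lift_sum_tens[OF vsT2 F] and Ls = pair3.lift_sum[OF vsT2 F]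
    have F_val: "F v (T2 p q) = tensor_scale (\<eta> j q) (T2 v p)" if "p \<in> V" "q \<in> V" for v p q
      unfolding F_def using pair2.lift_tens[OF vsT2 G that] by (simp add: G_def)
    have FK: "lift3 F (K t q) = tensor_scale (\<eta> j q) t" if t: "t \<in> V2" and q: "q \<in> V" for t q
    proof -
      obtain N :: nat and u v where uv: "\<And>i. i < N \<Longrightarrow> u i \<in> V" "\<And>i. i < N \<Longrightarrow> v i \<in> V"
        and t: "t = (\<Sum>i<N. T2 (u i) (v i))" and K: "K t q = (\<Sum>i<N. T3 (u i) (T2 (v i) q))"
        using K_eq[OF t q] by blast
      have "lift3 F (K t q) = (\<Sum>i<N. F (u i) (T2 (v i) q))"
        unfolding K using uv q by (intro L) (auto simp: pair2.tens_in_tensor_space)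
      also have "\<dots> = tensor_scale (\<eta> j q) t"
        unfolding t pair2.T.scale_sum_right using uv q by (intro sum.cong refl) (simp add: F_val)
      finally show ?thesis .
    qed
    have "lift3 F (\<Sum>i\<in>I. K (\<Delta> (x i)) (y i))
        = (\<Sum>i\<in>I. lift3 F (K (\<Delta> (x i)) (y i)))"
      by (rule Ls) (simp add: K_mem xV yV comult_closed)
    also have "\<dots> = (\<Sum>i\<in>I. if j = i then \<Delta> (x i) else 0)"
      using \<eta>(2)[OF j] by (intro sum.cong refl) (simp add: FK xV yV comult_closed)
    also have "\<dots> = \<Delta> (x j)" using I j by simp
    finally have 1: "lift3 F (\<Sum>i\<in>I. K (\<Delta> (x i)) (y i)) = \<Delta> (x j)" .
    have "lift3 F (\<Sum>a\<in>I. \<Sum>b\<in>I. T3 (x a) (T2 (x b) (mult (y a) (y b))))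
        = (\<Sum>a\<in>I. lift3 F (\<Sum>b\<in>I. T3 (x a) (T2 (x b) (mult (y a) (y b)))))"
      by (rule Ls) (intro V3_sum pair3.tens_in_tensor_space V2_mem xV)
    also have "\<dots> = (\<Sum>a\<in>I. \<Sum>b\<in>I. F (x a) (T2 (x b) (mult (y a) (y b))))"
      by (intro sum.cong refl L V2_mem xV)
    also have "\<dots> = (\<Sum>a\<in>I. \<Sum>b\<in>I. tensor_scale (m a b j) (T2 (x a) (x b)))"
      unfolding m_def using j by (intro sum.cong refl) (simp add: F_val xV yV mult_closed)
    finally show ?thesis using 1 hexL by simp
  qed
  have x_mult: "mult (x a) (x b) = (\<Sum>j\<in>I. n a b j *s x j)" if a: "a \<in> I" and b: "b \<in> I" for a b
  proof -
    define G where "G p q = \<eta> b p * \<eta> a q" for p q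
    define F where "F = (\<lambda>v t. lift2 G t *s v)"
    have G: "bilinear_on scale scale (*) V V UNIV G"
      unfolding G_def by (rule functional_lift[OF \<eta>(1) \<eta>(1)])
    have lin: "linear_on tensor_scale (*) V2 UNIV (lift2 G)" by (rule pair2.lift_linear[OF vector_space_mult G])
    have F: "bilinear_on scale tensor_scale scale V V2 UNIV F"
      using lin by (simp add: F_def bilinear_on_def linear_on_def scale_left_distrib scale_right_distrib mult.commute)
    note L = pair3.lift_sum_tens[OF vector_space_axioms F] and Ls = pair3.lift_sum[OF vector_space_axioms F]
    have G_val: "lift2 G (T2 p q) = \<eta> b p * \<eta> a q" if "p \<in> V" "q \<in> V" for p q
      using pair2.lift_tens[OF vector_space_mult G that] by (simp add: G_def)
    have G_comult: "lift2 G (\<Delta> (y j)) = n a b j" if j: "j \<in> I" for j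
    proof -
      have "lift2 G (\<Delta> (y j)) = (\<Sum>a'\<in>I. \<Sum>b'\<in>I. n b' a' j * G (y a') (y b'))"
        unfolding y_comult[OF j] by (subst sum.swap, rule lift_double_sum[OF vector_space_mult G yV yV])
      also have "\<dots> = (\<Sum>a'\<in>I. \<Sum>b'\<in>I. if a = b' then if b = a' then n a b j else 0 else 0)"
        unfolding G_def using \<eta>(2) a b by (intro sum.cong refl) auto
      also have "\<dots> = n a b j" using I a b by simp
      finally show ?thesis .
    qed
    have "lift3 F (\<Sum>i\<in>I. T3 (x i) (\<Delta> (y i))) = (\<Sum>i\<in>I. F (x i) (\<Delta> (y i)))"
      by (rule L) (simp_all add: xV yV comult_closed)
    also have "\<dots> = (\<Sum>j\<in>I. n a b j *s x j)"
      by (intro sum.cong refl) (simp add: F_def G_comult)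
    finally have 1: "lift3 F (\<Sum>i\<in>I. T3 (x i) (\<Delta> (y i))) = (\<Sum>j\<in>I. n a b j *s x j)" .
    have "lift3 F (\<Sum>a\<in>I. \<Sum>b\<in>I. T3 (mult (x a) (x b)) (T2 (y b) (y a)))
        = (\<Sum>a\<in>I. lift3 F (\<Sum>b\<in>I. T3 (mult (x a) (x b)) (T2 (y b) (y a))))"
      by (rule Ls) (intro V3_sum pair3.tens_in_tensor_space V2_mem)
    also have "\<dots> = (\<Sum>a'\<in>I. \<Sum>b'\<in>I. F (mult (x a') (x b')) (T2 (y b') (y a')))"
      by (intro sum.cong refl L V2_mem)
    also have "\<dots> = (\<Sum>a'\<in>I. \<Sum>b'\<in>I. if b = b' then if a = a' then mult (x a) (x b) else 0 else 0)"
      unfolding F_def using \<eta>(2) a b by (intro sum.cong refl) (auto simp: G_val yV)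
    also have "\<dots> = mult (x a) (x b)" using I a b by simp
    finally show ?thesis using 1 hexR by simp
  qed
  have y_mult: "mult (y a) (y b) = (\<Sum>j\<in>I. m a b j *s y j)" if a: "a \<in> I" and b: "b \<in> I" for a b
  proof -
    define G where "G v = (\<lambda>p q. (\<xi> a v * \<xi> b p) *s q)" for v
    define F where "F = (\<lambda>v t. lift2 (G v) t)"
    have G: "bilinear_on scale scale scale V V UNIV (G v)" for v
      by (simp add: G_def bilinear_on_def linear_on_def \<xi>_lin scale_left_distrib scale_right_distrib
          distrib_left mult.commute mult.left_commute)
    have F: "bilinear_on scale tensor_scale scale V V2 UNIV F"
      unfolding F_def
      by (rule bilinear_on_swap, rule pair2.bilinear_lift_family[OF vector_space_axioms vector_space_axioms subspace_carrier G])
        (simp add: G_def linear_on_def \<xi>_lin scale_left_distrib distrib_right mult.assoc)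
    note L = pair3.lift_sum_tens[OF vector_space_axioms F] and Ls = pair3.lift_sum[OF vector_space_axioms F]
    have F_val: "F v (T2 p q) = (\<xi> a v * \<xi> b p) *s q" if "p \<in> V" "q \<in> V" for v p q
      unfolding F_def using pair2.lift_tens[OF vector_space_axioms G that] by (simp add: G_def)
    define G' where "G' p q = \<xi> a p * \<xi> b q" for p q
    have G': "bilinear_on scale scale (*) V V UNIV G'"
      unfolding G'_def by (rule functional_lift[OF \<xi>(1) \<xi>(1)])
    have FK: "lift3 F (K t q) = lift2 G' t *s q" if t: "t \<in> V2" and q: "q \<in> V" for t q
    proof -
      obtain N :: nat and u v where uv: "\<And>i. i < N \<Longrightarrow> u i \<in> V" "\<And>i. i < N \<Longrightarrow> v i \<in> V"
        and t: "t = (\<Sum>i<N. T2 (u i) (v i))" and K: "K t q = (\<Sum>i<N. T3 (u i) (T2 (v i) q))"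
        using K_eq[OF t q] by blast
      have "lift3 F (K t q) = (\<Sum>i<N. F (u i) (T2 (v i) q))"
        unfolding K using uv q by (intro L) (auto simp: pair2.tens_in_tensor_space)
      also have "\<dots> = (\<Sum>i<N. \<xi> a (u i) * \<xi> b (v i)) *s q"
        unfolding scale_sum_left using uv q by (intro sum.cong refl) (simp add: F_val)
      also have "(\<Sum>i<N. \<xi> a (u i) * \<xi> b (v i)) = lift2 G' t"
        unfolding t using uv by (subst pair2.lift_sum_tens[OF vector_space_mult G']) (auto simp: G'_def)
      finally show ?thesis .
    qed
    have G'_comult: "lift2 G' (\<Delta> (x j)) = m a b j" if j: "j \<in> I" for j
    proof -
      have "lift2 G' (\<Delta> (x j)) = (\<Sum>a'\<in>I. \<Sum>b'\<in>I. m a' b' j * G' (x a') (x b'))"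
        unfolding x_comult[OF j] by (rule lift_double_sum[OF vector_space_mult G' xV xV])
      also have "\<dots> = (\<Sum>a'\<in>I. \<Sum>b'\<in>I. if b = b' then if a = a' then m a b j else 0 else 0)"
        unfolding G'_def using \<xi>(2) a b by (intro sum.cong refl) auto
      also have "\<dots> = m a b j" using I a b by simp
      finally show ?thesis .
    qed
    have "lift3 F (\<Sum>i\<in>I. K (\<Delta> (x i)) (y i))
        = (\<Sum>i\<in>I. lift3 F (K (\<Delta> (x i)) (y i)))"
      by (rule Ls) (simp add: K_mem xV yV comult_closed)
    also have "\<dots> = (\<Sum>j\<in>I. m a b j *s y j)"
      by (intro sum.cong refl) (simp add: FK xV yV comult_closed G'_comult)
    finally have 1: "lift3 F (\<Sum>i\<in>I. K (\<Delta> (x i)) (y i)) = (\<Sum>j\<in>I. m a b j *s y j)" .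
    have "lift3 F (\<Sum>a\<in>I. \<Sum>b\<in>I. T3 (x a) (T2 (x b) (mult (y a) (y b))))
        = (\<Sum>a\<in>I. lift3 F (\<Sum>b\<in>I. T3 (x a) (T2 (x b) (mult (y a) (y b)))))"
      by (rule Ls) (intro V3_sum pair3.tens_in_tensor_space V2_mem xV)
    also have "\<dots> = (\<Sum>a'\<in>I. \<Sum>b'\<in>I. F (x a') (T2 (x b') (mult (y a') (y b'))))"
      by (intro sum.cong refl L V2_mem xV)
    also have "\<dots> = (\<Sum>a'\<in>I. \<Sum>b'\<in>I. if b = b' then if a = a' then mult (y a) (y b) else 0 else 0)"
      using \<xi>(2) a b by (intro sum.cong refl) (auto simp: F_val xV yV mult_closed)
    also have "\<dots> = mult (y a) (y b)" using I a b by simp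
    finally show ?thesis using 1 hexL by simp
  qed
  have "quasitriangular_coordinates scale V mult one \<Delta> \<epsilon> S R I x y n m"
    by unfold_locales
      (fact I xV yV R x_indep y_indep x_mult y_mult x_comult y_comult | simp add: n_def m_def split: if_splits)+
  then show ?thesis by blast
qed

end

section \<open>The antipode on the supports of a quasitriangular structure\<close>

context quasitriangular_coordinates
begin

lemma coordinates_unique:
  assumes ind: "\<forall>c. (\<Sum>i\<in>I. c i *s z i) = 0 \<longrightarrow> (\<forall>i\<in>I. c i = 0)"
    and eq: "(\<Sum>j\<in>I. c j *s z j) = (\<Sum>j\<in>I. d j *s z j)" and j: "j \<in> I"
  shows "c j = d j"
proof -
  have "(\<Sum>j\<in>I. (c j - d j) *s z j) = 0" using eq by (simp add: scale_left_diff_distrib sum_subtractf)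
  then have "c j - d j = 0" using ind[rule_format, of "\<lambda>j. c j - d j"] j by blast
  then show ?thesis by simp
qed

lemma scaled_closed: "h \<in> V \<Longrightarrow> c *s h \<in> V"
  and sum_closed: "(\<And>i. i \<in> J \<Longrightarrow> f i \<in> V) \<Longrightarrow> (\<Sum>i\<in>J. f i) \<in> V"
  using subspace_scale[OF subspace_carrier] subspace_sum[OF subspace_carrier] by blast+

text \<open>
  The two following lemmas serve both families: structure constants of an independent family inherit
  associativity and units from the algebra.
\<close>

lemma combination_assoc:
  assumes z: "\<And>i. i \<in> I \<Longrightarrow> z i \<in> V"
    and mult: "\<And>a b. a \<in> I \<Longrightarrow> b \<in> I \<Longrightarrow> z a \<cdot> z b = (\<Sum>j\<in>I. w a b j *s z j)"
    and ind: "\<forall>c. (\<Sum>i\<in>I. c i *s z i) = 0 \<longrightarrow> (\<forall>i\<in>I. c i = 0)"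
    and support: "\<And>a b j. w a b j \<noteq> 0 \<Longrightarrow> a \<in> I \<and> b \<in> I \<and> j \<in> I"
  shows "(\<Sum>g\<in>I. w a b g * w g c l) = (\<Sum>g\<in>I. w b c g * w a g l)"
proof (cases "a \<in> I \<and> b \<in> I \<and> c \<in> I \<and> l \<in> I")
  case True
  have "(\<Sum>l\<in>I. (\<Sum>g\<in>I. w a b g * w g c l) *s z l) = (\<Sum>g\<in>I. w a b g *s (z g \<cdot> z c))"
    using True by (simp add: scale_sum_left scale_sum_right mult) (rule sum.swap)
  also have "\<dots> = (z a \<cdot> z b) \<cdot> z c"
    using True z by (simp add: mult mult_sum_left scaled_closed mult_scale_left)
  also have "\<dots> = z a \<cdot> (z b \<cdot> z c)" using True z by (simp add: mult_assoc)
  also have "\<dots> = (\<Sum>g\<in>I. w b c g *s (z a \<cdot> z g))"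
    using True z by (simp add: mult mult_sum_right scaled_closed mult_scale_right)
  also have "\<dots> = (\<Sum>l\<in>I. (\<Sum>g\<in>I. w b c g * w a g l) *s z l)"
    using True by (simp add: scale_sum_left scale_sum_right mult) (rule sum.swap)
  finally have "(\<Sum>l\<in>I. (\<Sum>g\<in>I. w a b g * w g c l) *s z l) = (\<Sum>l\<in>I. (\<Sum>g\<in>I. w b c g * w a g l) *s z l)" .
  from coordinates_unique[OF ind this, of l] True show ?thesis by simp
next
  case False
  have *: "w a b g * w g c l = 0" "w b c g * w a g l = 0" for g
    using support[of a b g] support[of g c l] support[of b c g] support[of a g l] False by auto
  show ?thesis by (simp only: * sum.neutral_const)
qed

lemma combination_unit:
  assumes z: "\<And>i. i \<in> I \<Longrightarrow> z i \<in> V"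
    and mult: "\<And>a b. a \<in> I \<Longrightarrow> b \<in> I \<Longrightarrow> z a \<cdot> z b = (\<Sum>j\<in>I. w a b j *s z j)"
    and ind: "\<forall>c. (\<Sum>i\<in>I. c i *s z i) = 0 \<longrightarrow> (\<forall>i\<in>I. c i = 0)"
    and support: "\<And>a b j. w a b j \<noteq> 0 \<Longrightarrow> a \<in> I \<and> b \<in> I \<and> j \<in> I"
    and one: "one = (\<Sum>g\<in>I. e g *s z g)"
  shows "(\<Sum>g\<in>I. e g * w g j l) = (if j = l \<and> j \<in> I then 1 else 0)"
    and "(\<Sum>g\<in>I. e g * w j g l) = (if j = l \<and> j \<in> I then 1 else 0)"
proof -
  show "(\<Sum>g\<in>I. e g * w g j l) = (if j = l \<and> j \<in> I then 1 else 0)"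
  proof (cases "j \<in> I \<and> l \<in> I")
    case True
    have "(\<Sum>l\<in>I. (\<Sum>g\<in>I. e g * w g j l) *s z l) = (\<Sum>g\<in>I. e g *s (z g \<cdot> z j))"
      using True by (simp add: scale_sum_left scale_sum_right mult) (rule sum.swap)
    also have "\<dots> = one \<cdot> z j" using True z by (simp add: one mult_sum_left scaled_closed mult_scale_left)
    also have "\<dots> = (\<Sum>l\<in>I. (if j = l then 1 else 0) *s z l)"
      using True z finite_I by (simp add: one_mult if_distrib[of "\<lambda>c. c *s _"] cong: if_cong)
    finally show ?thesis using coordinates_unique[OF ind, of "\<lambda>l. \<Sum>g\<in>I. e g * w g j l" "\<lambda>l. if j = l then 1 else 0" l] True by simp
  next
    case False
    then have "w g j l = 0" for g using support[of g j l] by auto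
    then show ?thesis using False by auto
  qed
  show "(\<Sum>g\<in>I. e g * w j g l) = (if j = l \<and> j \<in> I then 1 else 0)"
  proof (cases "j \<in> I \<and> l \<in> I")
    case True
    have "(\<Sum>l\<in>I. (\<Sum>g\<in>I. e g * w j g l) *s z l) = (\<Sum>g\<in>I. e g *s (z j \<cdot> z g))"
      using True by (simp add: scale_sum_left scale_sum_right mult) (rule sum.swap)
    also have "\<dots> = z j \<cdot> one" using True z by (simp add: one mult_sum_right scaled_closed mult_scale_right)
    also have "\<dots> = (\<Sum>l\<in>I. (if j = l then 1 else 0) *s z l)"
      using True z finite_I by (simp add: mult_one if_distrib[of "\<lambda>c. c *s _"] cong: if_cong)
    finally show ?thesis using coordinates_unique[OF ind, of "\<lambda>l. \<Sum>g\<in>I. e g * w j g l" "\<lambda>l. if j = l then 1 else 0" l] True by simp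
  next
    case False
    then have "w j g l = 0" for g using support[of j g l] by auto
    then show ?thesis using False by auto
  qed
qed

lemma counit_add: "a \<in> V \<Longrightarrow> b \<in> V \<Longrightarrow> \<epsilon> (a + b) = \<epsilon> a + \<epsilon> b"
  and counit_scale: "a \<in> V \<Longrightarrow> \<epsilon> (c *s a) = c * \<epsilon> a"
  using linear_counit by (auto simp: linear_on_def)

lemma one_x: "one = (\<Sum>g\<in>I. \<epsilon> (y g) *s x g)"
proof -
  have "bilinear_on scale scale scale V V UNIV (\<lambda>x y. \<epsilon> y *s x)"
    by (simp add: bilinear_on_def linear_on_def counit_add counit_scale scale_left_distrib scale_right_distrib mult.commute)
  from pair2.lift_sum_tens[OF vector_space_axioms this, of I x y]
  show ?thesis using x_closed y_closed R_counit_right by (simp add: R_eq)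
qed

lemma one_y: "one = (\<Sum>g\<in>I. \<epsilon> (x g) *s y g)"
proof -
  have "bilinear_on scale scale scale V V UNIV (\<lambda>x y. \<epsilon> x *s y)"
    by (simp add: bilinear_on_def linear_on_def counit_add counit_scale scale_left_distrib scale_right_distrib mult.commute)
  from pair2.lift_sum_tens[OF vector_space_axioms this, of I x y]
  show ?thesis using x_closed y_closed R_counit_left by (simp add: R_eq)
qed

lemma n_assoc: "(\<Sum>g\<in>I. n a b g * n g c l) = (\<Sum>g\<in>I. n b c g * n a g l)"
  by (rule combination_assoc[of x n]) (fact x_closed x_mult x_indep n_support)+

lemma m_assoc: "(\<Sum>g\<in>I. m a b g * m g c l) = (\<Sum>g\<in>I. m b c g * m a g l)"
  by (rule combination_assoc[of y m]) (fact y_closed y_mult y_indep m_support)+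

lemma n_unit:
  "(\<Sum>g\<in>I. \<epsilon> (y g) * n g j l) = (if j = l \<and> j \<in> I then 1 else 0)"
  "(\<Sum>g\<in>I. \<epsilon> (y g) * n j g l) = (if j = l \<and> j \<in> I then 1 else 0)"
  by (rule combination_unit[of x n]; fact x_closed x_mult x_indep n_support one_x)+

lemma m_unit:
  "(\<Sum>g\<in>I. \<epsilon> (x g) * m g j l) = (if j = l \<and> j \<in> I then 1 else 0)"
  "(\<Sum>g\<in>I. \<epsilon> (x g) * m j g l) = (if j = l \<and> j \<in> I then 1 else 0)"
  by (rule combination_unit[of y m]; fact y_closed y_mult y_indep m_support one_y)+

lemma tensor_rank_eq: "tensor_rank scale V R = card I"
proof -
  obtain \<eta> where \<eta>: "\<And>i. linear_on scale (*) UNIV UNIV (\<eta> i)"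
    "\<And>i j. i \<in> I \<Longrightarrow> j \<in> I \<Longrightarrow> \<eta> i (y j) = (if i = j then 1 else 0)"
    by (rule dual_functionals[OF finite_I y_indep]) (rule that; assumption)
  have lift: "lift2 (\<lambda>x y. \<phi> y *s x) R = (\<Sum>i\<in>I. \<phi> (y i) *s x i)" if "linear_on scale (*) V UNIV \<phi>" for \<phi>
  proof -
    have "\<phi> (a + b) = \<phi> a + \<phi> b" "\<phi> (c *s a) = c * \<phi> a" if "a \<in> V" "b \<in> V" for a b c
      using \<open>linear_on scale (*) V UNIV \<phi>\<close> that by (auto simp: linear_on_def)
    then have "bilinear_on scale scale scale V V UNIV (\<lambda>x y. \<phi> y *s x)"
      by (simp add: bilinear_on_def linear_on_def scale_left_distrib scale_right_distrib mult.commute)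
    from pair2.lift_sum_tens[OF vector_space_axioms this x_closed y_closed] show ?thesis by (simp add: R_eq)
  qed
  have sub: "x ` I \<subseteq> left_support scale V R"
  proof
    fix h assume "h \<in> x ` I"
    then obtain i where i: "i \<in> I" "h = x i" by auto
    have lin: "linear_on scale (*) V UNIV (\<eta> i)" using \<eta>(1)[of i] by (simp add: linear_on_def)
    have "lift2 (\<lambda>x y. \<eta> i y *s x) R = (\<Sum>j\<in>I. if i = j then x j else 0)"
      unfolding lift[OF lin] using \<eta>(2) i(1) by (intro sum.cong refl) auto
    also have "\<dots> = h" using i finite_I by simp
    finally show "h \<in> left_support scale V R" using lin unfolding left_support_def by blast
  qed
  have "left_support scale V R \<subseteq> span (x ` I)"
  proof
    fix h assume "h \<in> left_support scale V R"
    then obtain \<phi> where "linear_on scale (*) V UNIV \<phi>" "h = lift2 (\<lambda>x y. \<phi> y *s x) R"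
      unfolding left_support_def by blast
    then show "h \<in> span (x ` I)" by (simp add: lift span_sum span_scale span_base)
  qed
  from basis_card_eq_dim[OF sub this indexed_independent(2)[OF finite_I x_indep]]
  show ?thesis by (simp add: tensor_rank_def card_image[OF indexed_independent(1)[OF finite_I x_indep]])
qed

lemma lift_comult_x:
  assumes "vector_space s3" "bilinear_on scale scale s3 V V UNIV f" "j \<in> I"
  shows "lift2 f (\<Delta> (x j)) = (\<Sum>a\<in>I. \<Sum>b\<in>I. s3 (m a b j) (f (x a) (x b)))"
  unfolding x_comult[OF assms(3)] by (rule lift_double_sum[OF assms(1,2)]) (simp_all add: x_closed)

lemma lift_comult_y:
  assumes s3: "vector_space s3" "bilinear_on scale scale s3 V V UNIV f" "j \<in> I"
  shows "lift2 f (\<Delta> (y j)) = (\<Sum>a\<in>I. \<Sum>b\<in>I. s3 (n b a j) (f (y a) (y b)))"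
proof -
  have "\<Delta> (y j) = (\<Sum>a\<in>I. \<Sum>b\<in>I. tensor_scale (n b a j) (T2 (y a) (y b)))"
    unfolding y_comult[OF assms(3)] by (rule sum.swap)
  then show ?thesis by (simp only:) (rule lift_double_sum[OF assms(1,2)], simp_all add: y_closed)
qed

lemma lift_comult_x_mult:
  assumes s3: "vector_space s3" and f: "bilinear_on scale scale s3 V V UNIV f" and ij: "i \<in> I" "j \<in> I"
  shows "lift2 f (\<Delta> (x i \<cdot> x j)) =
    (\<Sum>c\<in>I. \<Sum>d\<in>I. \<Sum>k\<in>I. \<Sum>g\<in>I. s3 (m c d i * m k g j) (f (x c \<cdot> x k) (x d \<cdot> x g)))"
proof -
  interpret s3: vector_space s3 by fact
  have \<Delta>: "\<Delta> (x j) = (\<Sum>p\<in>I \<times> I. T2 (m (fst p) (snd p) j *s x (fst p)) (x (snd p)))" if "j \<in> I" for j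
    by (simp add: x_comult that sum.cartesian_product pair2.tens_scale_left case_prod_unfold)
  have f_scale: "f (c *s u) v = s3 c (f u v)" if "u \<in> V" "v \<in> V" for c u v
    using f that by (auto simp: bilinear_on_def linear_on_def)
  have "\<Delta> (x i \<cdot> x j) = (\<Sum>p\<in>I \<times> I. \<Sum>q\<in>I \<times> I.
      T2 ((m (fst p) (snd p) i *s x (fst p)) \<cdot> (m (fst q) (snd q) j *s x (fst q))) (x (snd p) \<cdot> x (snd q)))"
    unfolding comult_mult[OF x_closed[OF ij(1)] x_closed[OF ij(2)]] \<Delta>[OF ij(1)] \<Delta>[OF ij(2)]
    by (rule pair2.mult_sum[OF bilinear_mult bilinear_mult]) (auto simp: scaled_closed x_closed)
  also have "\<dots> = (\<Sum>r\<in>(I \<times> I) \<times> (I \<times> I).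
      T2 ((m (fst (fst r)) (snd (fst r)) i *s x (fst (fst r))) \<cdot> (m (fst (snd r)) (snd (snd r)) j *s x (fst (snd r))))
        (x (snd (fst r)) \<cdot> x (snd (snd r))))"
    by (simp add: sum.cartesian_product case_prod_unfold)
  finally have "lift2 f (\<Delta> (x i \<cdot> x j)) = (\<Sum>r\<in>(I \<times> I) \<times> (I \<times> I).
      f ((m (fst (fst r)) (snd (fst r)) i *s x (fst (fst r))) \<cdot> (m (fst (snd r)) (snd (snd r)) j *s x (fst (snd r))))
        (x (snd (fst r)) \<cdot> x (snd (snd r))))"
    by (simp only:) (rule pair2.lift_sum_tens[OF s3 f], auto intro!: mult_closed scaled_closed x_closed)
  also have "\<dots> = (\<Sum>r\<in>(I \<times> I) \<times> (I \<times> I).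
      s3 (m (fst (fst r)) (snd (fst r)) i * m (fst (snd r)) (snd (snd r)) j)
        (f (x (fst (fst r)) \<cdot> x (fst (snd r))) (x (snd (fst r)) \<cdot> x (snd (snd r)))))"
    by (intro sum.cong refl)
      (auto simp: mult_scale_left mult_scale_right scaled_closed x_closed mult_closed f_scale mult.commute)
  also have "\<dots> = (\<Sum>c\<in>I. \<Sum>d\<in>I. \<Sum>k\<in>I. \<Sum>g\<in>I. s3 (m c d i * m k g j) (f (x c \<cdot> x k) (x d \<cdot> x g)))"
    by (simp add: sum.cartesian_product' case_prod_unfold)
  finally show ?thesis .
qed

text \<open>
  The coproduct of \<open>x i \<cdot> x j\<close>, computed in two ways and evaluated at a pair of dual functionals.
\<close>

lemma compat_nm:
  "(\<Sum>l\<in>I. n i j l * m a b l) =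
    (\<Sum>c\<in>I. \<Sum>d\<in>I. \<Sum>f\<in>I. \<Sum>g\<in>I. m c d i * m f g j * n c f a * n d g b)"
proof (cases "i \<in> I \<and> j \<in> I \<and> a \<in> I \<and> b \<in> I")
  case True
  obtain \<xi> where \<xi>: "\<And>i. linear_on scale (*) UNIV UNIV (\<xi> i)"
    "\<And>i j. i \<in> I \<Longrightarrow> j \<in> I \<Longrightarrow> \<xi> i (x j) = (if i = j then 1 else 0)"
    by (rule dual_functionals[OF finite_I x_indep]) (rule that; assumption)
  have \<xi>_n: "\<xi> l (x c \<cdot> x d) = n c d l" if "c \<in> I" "d \<in> I" "l \<in> I" for c d l
  proof -
    have sc: "\<xi> l (r *s h) = r * \<xi> l h" for r h using \<xi>(1)[of l] by (simp add: linear_on_def)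
    have "\<xi> l (x c \<cdot> x d) = (\<Sum>j\<in>I. n c d j * \<xi> l (x j))"
      using that by (simp add: x_mult linear_on_sum[OF \<xi>(1)] sc)
    also have "\<dots> = (\<Sum>j\<in>I. if l = j then n c d j else 0)" using \<xi>(2) that by (intro sum.cong refl) simp
    finally show ?thesis using that finite_I by simp
  qed
  define G where "G p q = \<xi> a p * \<xi> b q" for p q
  have G: "bilinear_on scale scale (*) V V UNIV G" unfolding G_def by (rule functional_lift[OF \<xi>(1) \<xi>(1)])
  have Gx: "lift2 G (\<Delta> (x l)) = m a b l" if l: "l \<in> I" for l
  proof -
    have "lift2 G (\<Delta> (x l)) = (\<Sum>c\<in>I. \<Sum>d\<in>I. if b = d then if a = c then m c d l else 0 else 0)"
      unfolding lift_comult_x[OF vector_space_mult G l] G_def using \<xi>(2) True by (intro sum.cong refl) auto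
    then show ?thesis using True finite_I by simp
  qed
  have mem: "\<Delta> (x l) \<in> V2" "tensor_scale r (\<Delta> (x l)) \<in> V2" if "l \<in> I" for l r
    using comult_closed[OF x_closed[OF that]] V2_scale by blast+
  have "\<Delta> (x i \<cdot> x j) = (\<Sum>l\<in>I. tensor_scale (n i j l) (\<Delta> (x l)))"
    using True linear_on_sum_subspace[OF linear_comult vector_space_axioms subspace_carrier, of I "\<lambda>l. n i j l *s x l"]
    by (simp add: x_mult scaled_closed x_closed comult_scale)
  then have "lift2 G (\<Delta> (x i \<cdot> x j)) = (\<Sum>l\<in>I. n i j l * m a b l)"
    by (simp add: pair2.lift_sum[OF vector_space_mult G] mem pair2.lift_scale[OF vector_space_mult G] Gx)
  moreover have "lift2 G (\<Delta> (x i \<cdot> x j)) =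
      (\<Sum>c\<in>I. \<Sum>d\<in>I. \<Sum>f\<in>I. \<Sum>g\<in>I. m c d i * m f g j * n c f a * n d g b)"
    unfolding lift_comult_x_mult[OF vector_space_mult G conjunct1[OF True] conjunct1[OF conjunct2[OF True]]] G_def
    using True by (intro sum.cong refl) (simp add: \<xi>_n)
  ultimately show ?thesis by simp
next
  case False
  have Z1: "n i j l * m a b l = 0" for l using n_support[of i j l] m_support[of a b l] False by auto
  have Z2: "m c d i * m f g j * n c f a * n d g b = 0" for c d f g
    using n_support[of c f a] n_support[of d g b] m_support[of c d i] m_support[of f g j] False by auto
  show ?thesis by (simp only: Z1 Z2 sum.neutral_const)
qed

lemma antipode_closed: "h \<in> V \<Longrightarrow> S h \<in> V"
  and antipode_add: "h \<in> V \<Longrightarrow> g \<in> V \<Longrightarrow> S (h + g) = S h + S g"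
  and antipode_scale: "h \<in> V \<Longrightarrow> S (c *s h) = c *s S h"
  using linear_antipode by (auto simp: linear_on_def)

lemma bilinear_antipode_left: "bilinear_on scale scale scale V V UNIV (\<lambda>u v. S u \<cdot> v)"
  and bilinear_antipode_right: "bilinear_on scale scale scale V V UNIV (\<lambda>u v. u \<cdot> S v)"
  by (simp_all add: bilinear_on_def linear_on_def antipode_add antipode_scale antipode_closed mult_add_left
      mult_add_right mult_scale_left mult_scale_right)

lemma antipode_left_x: "j \<in> I \<Longrightarrow> (\<Sum>a\<in>I. \<Sum>b\<in>I. m a b j *s (S (x a) \<cdot> x b)) = \<epsilon> (x j) *s one"
  using antipode_left[OF x_closed] lift_comult_x[OF vector_space_axioms bilinear_antipode_left] by simp

lemma antipode_right_x: "j \<in> I \<Longrightarrow> (\<Sum>a\<in>I. \<Sum>b\<in>I. m a b j *s (x a \<cdot> S (x b))) = \<epsilon> (x j) *s one"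
  using antipode_right[OF x_closed] lift_comult_x[OF vector_space_axioms bilinear_antipode_right] by simp

lemma counit_contraction:
  assumes "vector_space s3" and k: "k \<in> I"
  shows "(\<Sum>i\<in>I. \<Sum>c\<in>I. s3 (m i c k) (s3 (\<epsilon> (x i)) (g c))) = g k"
proof -
  interpret s3: vector_space s3 by fact
  have "(\<Sum>i\<in>I. \<Sum>c\<in>I. s3 (m i c k) (s3 (\<epsilon> (x i)) (g c))) = (\<Sum>c\<in>I. s3 (\<Sum>i\<in>I. \<epsilon> (x i) * m i c k) (g c))"
    by (subst sum.swap) (simp add: s3.scale_sum_left mult.commute)
  also have "\<dots> = (\<Sum>c\<in>I. if c = k then g k else 0)" by (intro sum.cong refl) (simp add: m_unit(1))
  also have "\<dots> = g k" using k finite_I by simp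
  finally show ?thesis .
qed

text \<open>
  In Sweedler notation, $\sum \Phi(h')(h'' S(h''')) = \Phi(h)(1)$ for \<open>h = x k\<close>.  The proofs about \<open>S\<close>
  below consist in moving \<open>S\<close> across an identity with this cancellation.
\<close>

lemma antipode_inversion:
  assumes s3: "vector_space s3" and \<Phi>: "\<And>a. a \<in> I \<Longrightarrow> linear_on scale s3 V UNIV (\<Phi> a)" and k: "k \<in> I"
  shows "(\<Sum>i\<in>I. \<Sum>c\<in>I. s3 (m i c k) (\<Sum>a\<in>I. \<Sum>b\<in>I. s3 (m a b i) (\<Phi> a (x b \<cdot> S (x c))))) = \<Phi> k one"
proof -
  interpret s3: vector_space s3 by fact
  note sums = linear_on_sum_subspace[OF \<Phi> vector_space_axioms subspace_carrier]
  have sc: "\<Phi> a (r *s h) = s3 r (\<Phi> a h)" if "a \<in> I" "h \<in> V" for a r h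
    using \<Phi>[OF that(1)] that(2) by (simp add: linear_on_def)
  have cl: "x b \<cdot> S (x c) \<in> V" if "b \<in> I" "c \<in> I" for b c
    using that by (simp add: mult_closed antipode_closed x_closed)
  have "(\<Sum>i\<in>I. \<Sum>c\<in>I. s3 (m i c k) (\<Sum>a\<in>I. \<Sum>b\<in>I. s3 (m a b i) (\<Phi> a (x b \<cdot> S (x c)))))
      = (\<Sum>i\<in>I. \<Sum>c\<in>I. \<Sum>a\<in>I. \<Sum>b\<in>I. s3 (m a b i * m i c k) (\<Phi> a (x b \<cdot> S (x c))))"
    by (simp add: s3.scale_sum_right mult.commute)
  also have "\<dots> = (\<Sum>c\<in>I. \<Sum>a\<in>I. \<Sum>b\<in>I. \<Sum>i\<in>I. s3 (m a b i * m i c k) (\<Phi> a (x b \<cdot> S (x c))))"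
    by (subst sum.swap, rule sum.cong[OF refl], subst sum.swap, rule sum.cong[OF refl], rule sum.swap)
  also have "\<dots> = (\<Sum>c\<in>I. \<Sum>a\<in>I. \<Sum>b\<in>I. \<Sum>g\<in>I. s3 (m b c g * m a g k) (\<Phi> a (x b \<cdot> S (x c))))"
    by (simp only: s3.scale_sum_left[symmetric] m_assoc)
  also have "\<dots> = (\<Sum>a\<in>I. \<Sum>b\<in>I. \<Sum>c\<in>I. \<Sum>g\<in>I. s3 (m b c g * m a g k) (\<Phi> a (x b \<cdot> S (x c))))"
    by (subst sum.swap, rule sum.cong[OF refl], rule sum.swap)
  also have "\<dots> = (\<Sum>a\<in>I. \<Sum>g\<in>I. \<Sum>b\<in>I. \<Sum>c\<in>I. s3 (m b c g * m a g k) (\<Phi> a (x b \<cdot> S (x c))))"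
  proof (rule sum.cong[OF refl])
    fix a
    have "(\<Sum>b\<in>I. \<Sum>c\<in>I. \<Sum>g\<in>I. s3 (m b c g * m a g k) (\<Phi> a (x b \<cdot> S (x c))))
        = (\<Sum>b\<in>I. \<Sum>g\<in>I. \<Sum>c\<in>I. s3 (m b c g * m a g k) (\<Phi> a (x b \<cdot> S (x c))))"
      by (rule sum.cong[OF refl], rule sum.swap)
    also have "\<dots> = (\<Sum>g\<in>I. \<Sum>b\<in>I. \<Sum>c\<in>I. s3 (m b c g * m a g k) (\<Phi> a (x b \<cdot> S (x c))))"
      by (rule sum.swap)
    finally show "(\<Sum>b\<in>I. \<Sum>c\<in>I. \<Sum>g\<in>I. s3 (m b c g * m a g k) (\<Phi> a (x b \<cdot> S (x c))))
        = (\<Sum>g\<in>I. \<Sum>b\<in>I. \<Sum>c\<in>I. s3 (m b c g * m a g k) (\<Phi> a (x b \<cdot> S (x c))))" .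
  qed
  also have "\<dots> = (\<Sum>a\<in>I. \<Sum>g\<in>I. s3 (m a g k) (\<Phi> a (\<Sum>b\<in>I. \<Sum>c\<in>I. m b c g *s (x b \<cdot> S (x c)))))"
    by (intro sum.cong refl)
      (simp add: sums sum_closed scaled_closed cl sc s3.scale_sum_right mult.commute)
  also have "\<dots> = (\<Sum>a\<in>I. \<Sum>g\<in>I. s3 (m a g k) (s3 (\<epsilon> (x g)) (\<Phi> a one)))"
    by (intro sum.cong refl) (simp add: antipode_right_x sc one_closed)
  also have "\<dots> = (\<Sum>a\<in>I. s3 (\<Sum>g\<in>I. \<epsilon> (x g) * m a g k) (\<Phi> a one))"
    by (simp add: s3.scale_sum_left mult.commute)
  also have "\<dots> = (\<Sum>a\<in>I. if a = k then \<Phi> k one else 0)" by (intro sum.cong refl) (simp add: m_unit(2))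
  also have "\<dots> = \<Phi> k one" using k finite_I by simp
  finally show ?thesis .
qed

text \<open>
  The antipode reverses products.  The defining property of \<open>S\<close> on \<open>x i \<cdot> x j\<close> gives a sum over the
  coproducts of both factors; the cancellation lemma removes first the contribution of \<open>x j\<close>, then that of \<open>x i\<close>.
\<close>

lemma antipode_mult_x:
  assumes k: "k \<in> I" and l: "l \<in> I"
  shows "S (x k \<cdot> x l) = S (x l) \<cdot> S (x k)"
proof -
  have cl: "S (x a \<cdot> x b) \<in> V" "S (x a) \<in> V" "x a \<cdot> x b \<in> V" if "a \<in> I" "b \<in> I" for a b
    using that by (simp_all add: antipode_closed mult_closed x_closed)
  have left: "(\<Sum>c\<in>I. \<Sum>d\<in>I. \<Sum>f\<in>I. \<Sum>g\<in>I. (m c d i * m f g j) *s (S (x c \<cdot> x f) \<cdot> (x d \<cdot> x g)))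
      = (\<epsilon> (x i) * \<epsilon> (x j)) *s one" if "i \<in> I" "j \<in> I" for i j
    using antipode_left[OF mult_closed[OF x_closed[OF that(1)] x_closed[OF that(2)]]]
      lift_comult_x_mult[OF vector_space_axioms bilinear_antipode_left that]
    by (simp add: counit_mult x_closed that)
  have half: "(\<Sum>a\<in>I. \<Sum>b\<in>I. m a b i *s (S (x a \<cdot> x l) \<cdot> x b)) = \<epsilon> (x i) *s S (x l)" if i: "i \<in> I" for i
  proof -
    define \<Phi> where "\<Phi> f h = (\<Sum>a\<in>I. \<Sum>b\<in>I. m a b i *s (S (x a \<cdot> x f) \<cdot> (x b \<cdot> h)))" for f h
    have \<Phi>: "linear_on scale scale V UNIV (\<Phi> f)" if "f \<in> I" for f
      using that by (simp add: linear_on_def \<Phi>_def mult_add_right mult_scale_right cl mult_closed x_closed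
          scale_right_distrib sum.distrib scale_sum_right mult.commute)
    have "\<Phi> l one = (\<Sum>j\<in>I. \<Sum>c\<in>I. m j c l *s (\<Sum>f\<in>I. \<Sum>g\<in>I. m f g j *s \<Phi> f (x g \<cdot> S (x c))))"
      by (rule antipode_inversion[OF vector_space_axioms \<Phi> l, symmetric])
    also have "\<dots> = (\<Sum>j\<in>I. \<Sum>c\<in>I. m j c l *s (\<epsilon> (x j) *s (\<epsilon> (x i) *s S (x c))))"
    proof (intro sum.cong refl arg_cong[where f = "scale _"])
      fix j c assume j: "j \<in> I" and c: "c \<in> I"
      have "(\<Sum>f\<in>I. \<Sum>g\<in>I. m f g j *s \<Phi> f (x g \<cdot> S (x c)))
          = (\<Sum>f\<in>I. \<Sum>g\<in>I. \<Sum>a\<in>I. \<Sum>b\<in>I. (m a b i * m f g j) *s (S (x a \<cdot> x f) \<cdot> (x b \<cdot> x g) \<cdot> S (x c)))"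
        using c by (intro sum.cong refl) (simp add: \<Phi>_def scale_sum_right mult_assoc cl mult_closed x_closed mult.commute)
      also have "\<dots> = (\<Sum>f\<in>I. \<Sum>a\<in>I. \<Sum>b\<in>I. \<Sum>g\<in>I. (m a b i * m f g j) *s (S (x a \<cdot> x f) \<cdot> (x b \<cdot> x g) \<cdot> S (x c)))"
        by (rule sum.cong[OF refl], subst sum.swap, rule sum.cong[OF refl], rule sum.swap)
      also have "\<dots> = (\<Sum>a\<in>I. \<Sum>b\<in>I. \<Sum>f\<in>I. \<Sum>g\<in>I. (m a b i * m f g j) *s (S (x a \<cdot> x f) \<cdot> (x b \<cdot> x g) \<cdot> S (x c)))"
        by (subst sum.swap, rule sum.cong[OF refl], rule sum.swap)
      also have "\<dots> = (\<Sum>a\<in>I. \<Sum>b\<in>I. \<Sum>f\<in>I. \<Sum>g\<in>I. (m a b i * m f g j) *s (S (x a \<cdot> x f) \<cdot> (x b \<cdot> x g))) \<cdot> S (x c)"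
        using c by (simp add: mult_sum_left sum_closed scaled_closed mult_closed cl mult_scale_left)
      also have "\<dots> = \<epsilon> (x j) *s (\<epsilon> (x i) *s S (x c))"
        using i j c by (simp add: left mult_scale_left one_closed cl one_mult mult.commute)
      finally show "(\<Sum>f\<in>I. \<Sum>g\<in>I. m f g j *s \<Phi> f (x g \<cdot> S (x c))) = \<epsilon> (x j) *s (\<epsilon> (x i) *s S (x c))" .
    qed
    also have "\<dots> = \<epsilon> (x i) *s S (x l)" by (rule counit_contraction[OF vector_space_axioms l])
    finally have "\<Phi> l one = \<epsilon> (x i) *s S (x l)" .
    then show ?thesis by (simp add: \<Phi>_def mult_one x_closed)
  qed
  have \<Phi>: "linear_on scale scale V UNIV (\<lambda>h. S (x a \<cdot> x l) \<cdot> h)" if "a \<in> I" for a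
    using that l by (simp add: linear_on_def mult_add_right mult_scale_right cl)
  have "S (x k \<cdot> x l) = S (x k \<cdot> x l) \<cdot> one" using k l by (simp add: mult_one cl)
  also have "\<dots> = (\<Sum>i\<in>I. \<Sum>c\<in>I. m i c k *s (\<Sum>a\<in>I. \<Sum>b\<in>I. m a b i *s (S (x a \<cdot> x l) \<cdot> (x b \<cdot> S (x c)))))"
    by (rule antipode_inversion[OF vector_space_axioms \<Phi> k, symmetric])
  also have "\<dots> = (\<Sum>i\<in>I. \<Sum>c\<in>I. m i c k *s (\<epsilon> (x i) *s (S (x l) \<cdot> S (x c))))"
  proof (intro sum.cong refl arg_cong[where f = "scale _"])
    fix i c assume i: "i \<in> I" and c: "c \<in> I"
    have "(\<Sum>a\<in>I. \<Sum>b\<in>I. m a b i *s (S (x a \<cdot> x l) \<cdot> (x b \<cdot> S (x c))))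
        = (\<Sum>a\<in>I. \<Sum>b\<in>I. m a b i *s (S (x a \<cdot> x l) \<cdot> x b)) \<cdot> S (x c)"
      using c l by (simp add: mult_sum_left sum_closed scaled_closed mult_closed cl mult_scale_left x_closed mult_assoc)
    then show "(\<Sum>a\<in>I. \<Sum>b\<in>I. m a b i *s (S (x a \<cdot> x l) \<cdot> (x b \<cdot> S (x c)))) = \<epsilon> (x i) *s (S (x l) \<cdot> S (x c))"
      using c l by (simp add: half[OF i] mult_scale_left cl)
  qed
  also have "\<dots> = S (x l) \<cdot> S (x k)" by (rule counit_contraction[OF vector_space_axioms k])
  finally show ?thesis .
qed

lemma antipode_x_mult: "a \<in> I \<Longrightarrow> b \<in> I \<Longrightarrow> S (x a) \<cdot> S (x b) = (\<Sum>j\<in>I. n b a j *s S (x j))"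
proof -
  assume ab: "a \<in> I" "b \<in> I"
  have "S (x a) \<cdot> S (x b) = S (x b \<cdot> x a)" using ab by (simp add: antipode_mult_x)
  also have "\<dots> = (\<Sum>j\<in>I. n b a j *s S (x j))"
    using ab linear_on_sum_subspace[OF linear_antipode vector_space_axioms subspace_carrier, of I "\<lambda>j. n b a j *s x j"]
    by (simp add: x_mult scaled_closed x_closed antipode_scale)
  finally show ?thesis .
qed

lemma counit_antipode_x:
  assumes k: "k \<in> I" shows "\<epsilon> (S (x k)) = \<epsilon> (x k)"
proof -
  have "\<epsilon> (x k) = \<epsilon> (\<Sum>a\<in>I. \<Sum>b\<in>I. m a b k *s (S (x a) \<cdot> x b))"
    using k by (simp add: antipode_left_x counit_scale one_closed counit_one)
  also have "\<dots> = (\<Sum>a\<in>I. \<Sum>b\<in>I. m a b k * (\<epsilon> (S (x a)) * \<epsilon> (x b)))"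
    by (simp add: linear_on_sum_subspace[OF linear_counit vector_space_axioms subspace_carrier] sum_closed
        scaled_closed mult_closed antipode_closed x_closed counit_scale counit_mult)
  also have "\<dots> = (\<Sum>a\<in>I. \<epsilon> (S (x a)) * (\<Sum>b\<in>I. \<epsilon> (x b) * m a b k))"
    by (simp add: sum_distrib_left mult.commute mult.left_commute)
  also have "\<dots> = (\<Sum>a\<in>I. if a = k then \<epsilon> (S (x k)) else 0)"
    by (intro sum.cong refl) (simp add: m_unit(2))
  finally show ?thesis using k finite_I by simp
qed

end

section \<open>Dual actions from quasitriangular structures\<close>

locale quasitriangular_module_algebra =
  quasitriangular_coordinates scale V mult one \<Delta> \<epsilon> S R I x y n m +
  module_algebra scale V mult one \<Delta> \<epsilon> S scaleA act
  for scale :: "'k::field \<Rightarrow> 'v::ab_group_add \<Rightarrow> 'v" (infixr \<open>*s\<close> 75)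
    and V :: "'v set"
    and mult :: "'v \<Rightarrow> 'v \<Rightarrow> 'v" (infixl \<open>\<cdot>\<close> 70)
    and one :: 'v (\<open>\<one>\<close>)
    and \<Delta> :: "'v \<Rightarrow> ('v, 'v, 'k) tensor"
    and \<epsilon> :: "'v \<Rightarrow> 'k"
    and S :: "'v \<Rightarrow> 'v"
    and R :: "('v, 'v, 'k) tensor"
    and I :: "nat set" and x y :: "nat \<Rightarrow> 'v" and n m :: "nat \<Rightarrow> nat \<Rightarrow> nat \<Rightarrow> 'k"
    and scaleA :: "'k \<Rightarrow> 'a::ring_1 \<Rightarrow> 'a" and act :: "'v \<Rightarrow> 'a \<Rightarrow> 'a"
begin

sublocale A: algebra_type scaleA ..

lemma act_linear: "h \<in> V \<Longrightarrow> linear_on scaleA scaleA UNIV UNIV (act h)"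
  and act_linear_left: "linear_on scale scaleA V UNIV (\<lambda>h. act h a)"
  using bilinear_act by (simp_all add: bilinear_on_def)

lemma act_add: "h \<in> V \<Longrightarrow> act h (a + b) = act h a + act h b"
  and act_scale: "h \<in> V \<Longrightarrow> act h (scaleA c a) = scaleA c (act h a)"
  and act_add_left: "h \<in> V \<Longrightarrow> g \<in> V \<Longrightarrow> act (h + g) a = act h a + act g a"
  and act_scale_left: "h \<in> V \<Longrightarrow> act (c *s h) a = scaleA c (act h a)"
  using bilinear_act by (simp_all add: bilinear_on_def linear_on_def)

lemma act_sum: "h \<in> V \<Longrightarrow> act h (\<Sum>i\<in>J. f i) = (\<Sum>i\<in>J. act h (f i))"
  by (rule linear_on_sum[OF act_linear])

lemma act_sum_left: "(\<And>i. i \<in> J \<Longrightarrow> f i \<in> V) \<Longrightarrow> act (\<Sum>i\<in>J. f i) a = (\<Sum>i\<in>J. act (f i) a)"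
  by (rule linear_on_sum_subspace[OF act_linear_left vector_space_axioms subspace_carrier])

lemma bilinear_act_mult: "bilinear_on scale scale scaleA V V UNIV (\<lambda>u v. act u a * act v b)"
  by (simp add: bilinear_on_def linear_on_def act_add_left act_scale_left distrib_left distrib_right
      A.scale_mult_left A.scale_mult_right)

lemma act_x_mult: "j \<in> I \<Longrightarrow> act (x j) (a * b) = (\<Sum>c\<in>I. \<Sum>d\<in>I. scaleA (m c d j) (act (x c) a * act (x d) b))"
  by (simp add: act_on_mult x_closed lift_comult_x[OF A.vector_space_axioms bilinear_act_mult])

lemma act_y_mult: "j \<in> I \<Longrightarrow> act (y j) (a * b) = (\<Sum>c\<in>I. \<Sum>d\<in>I. scaleA (n d c j) (act (y c) a * act (y d) b))"
  by (simp add: act_on_mult y_closed lift_comult_y[OF A.vector_space_axioms bilinear_act_mult])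

lemma act_antipode_left: "j \<in> I \<Longrightarrow>
    (\<Sum>a\<in>I. \<Sum>b\<in>I. scaleA (m a b j) (act (S (x a)) (act (x b) c))) = scaleA (\<epsilon> (x j)) c"
  using arg_cong[OF antipode_left_x, of j "\<lambda>h. act h c"]
  by (simp add: act_sum_left sum_closed scaled_closed mult_closed antipode_closed x_closed act_scale_left
      act_mult[symmetric] one_closed act_one)

text \<open>
  On products of elements of \<open>A\<close> the antipode reverses the coproduct.  The identity is reached through the mixed formula
  $\sum S(h')((h'' c) d) = c (S(h) d)$, in which only one factor has been moved across \<open>S\<close>; a second cancellation with
  $S(h) c$ in place of \<open>c\<close> moves the other one.
\<close>

lemma act_antipode_mult:
  assumes k: "k \<in> I"
  shows "act (S (x k)) (c * d) = (\<Sum>a\<in>I. \<Sum>b\<in>I. scaleA (m a b k) (act (S (x b)) c * act (S (x a)) d))"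
proof -
  let ?s = "\<lambda>a. act (S (x a))" and ?X = "\<lambda>a. act (x a)"
  have Sx: "S (x a) \<in> V" if "a \<in> I" for a using that by (simp add: antipode_closed x_closed)
  have XS: "act (x a \<cdot> S (x b)) c = ?X a (?s b c)" if "a \<in> I" "b \<in> I" for a b c
    using that by (simp add: act_mult x_closed Sx)
  have cl: "x a \<cdot> S (x b) \<in> V" if "a \<in> I" "b \<in> I" for a b using that by (simp add: mult_closed x_closed Sx)
  have move: "(\<Sum>a\<in>I. \<Sum>b\<in>I. scaleA (m a b l) (?s a (?X b c * d))) = c * ?s l d" if l: "l \<in> I" for l c d
  proof -
    define \<Psi> where "\<Psi> f h = (\<Sum>a\<in>I. \<Sum>b\<in>I. scaleA (m a b f) (?s a (?X b c * act h d)))" for f h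
    have \<Psi>: "linear_on scale scaleA V UNIV (\<Psi> f)" if "f \<in> I" for f
      by (simp add: linear_on_def \<Psi>_def act_add_left act_scale_left distrib_left act_add Sx sum.distrib
          A.scale_right_distrib A.scale_mult_right act_scale A.scale_sum_right mult.commute)
    have "\<Psi> l one = (\<Sum>j\<in>I. \<Sum>g\<in>I. scaleA (m j g l) (\<Sum>f\<in>I. \<Sum>h\<in>I. scaleA (m f h j) (\<Psi> f (x h \<cdot> S (x g)))))"
      by (rule antipode_inversion[OF A.vector_space_axioms \<Psi> l, symmetric])
    also have "\<dots> = (\<Sum>j\<in>I. \<Sum>g\<in>I. scaleA (m j g l) (scaleA (\<epsilon> (x j)) (c * ?s g d)))"
    proof (intro sum.cong refl arg_cong[where f = "scaleA _"])
      fix j g assume j: "j \<in> I" and g: "g \<in> I"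
      let ?t = "\<lambda>a b h. ?s a (?X b c * ?X h (?s g d))"
      have "(\<Sum>f\<in>I. \<Sum>h\<in>I. scaleA (m f h j) (\<Psi> f (x h \<cdot> S (x g))))
          = (\<Sum>f\<in>I. \<Sum>h\<in>I. \<Sum>a\<in>I. \<Sum>b\<in>I. scaleA (m a b f * m f h j) (?t a b h))"
        using g by (simp add: \<Psi>_def XS A.scale_sum_right mult.commute)
      also have "\<dots> = (\<Sum>h\<in>I. \<Sum>a\<in>I. \<Sum>b\<in>I. \<Sum>f\<in>I. scaleA (m a b f * m f h j) (?t a b h))"
        by (subst sum.swap, rule sum.cong[OF refl], subst sum.swap, rule sum.cong[OF refl], rule sum.swap)
      also have "\<dots> = (\<Sum>h\<in>I. \<Sum>a\<in>I. \<Sum>b\<in>I. \<Sum>f\<in>I. scaleA (m b h f * m a f j) (?t a b h))"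
        by (simp only: A.scale_sum_left[symmetric] m_assoc)
      also have "\<dots> = (\<Sum>a\<in>I. \<Sum>h\<in>I. \<Sum>f\<in>I. \<Sum>b\<in>I. scaleA (m b h f * m a f j) (?t a b h))"
        by (subst sum.swap, rule sum.cong[OF refl], rule sum.cong[OF refl], rule sum.swap)
      also have "\<dots> = (\<Sum>a\<in>I. \<Sum>f\<in>I. \<Sum>h\<in>I. \<Sum>b\<in>I. scaleA (m b h f * m a f j) (?t a b h))"
        by (rule sum.cong[OF refl], rule sum.swap)
      also have "\<dots> = (\<Sum>a\<in>I. \<Sum>f\<in>I. \<Sum>b\<in>I. \<Sum>h\<in>I. scaleA (m b h f * m a f j) (?t a b h))"
        by (rule sum.cong[OF refl], rule sum.cong[OF refl], rule sum.swap)
      also have "\<dots> = (\<Sum>a\<in>I. \<Sum>f\<in>I. scaleA (m a f j) (?s a (?X f (c * ?s g d))))"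
        by (intro sum.cong refl) (simp add: act_x_mult act_sum act_scale Sx A.scale_sum_right mult.commute)
      also have "\<dots> = scaleA (\<epsilon> (x j)) (c * ?s g d)" by (rule act_antipode_left[OF j])
      finally show "(\<Sum>f\<in>I. \<Sum>h\<in>I. scaleA (m f h j) (\<Psi> f (x h \<cdot> S (x g)))) = scaleA (\<epsilon> (x j)) (c * ?s g d)" .
    qed
    also have "\<dots> = c * ?s l d" by (rule counit_contraction[OF A.vector_space_axioms l])
    finally show ?thesis by (simp add: \<Psi>_def act_one)
  qed
  have \<Phi>: "linear_on scale scaleA V UNIV (\<lambda>h. ?s a (act h c * d))" if "a \<in> I" for a
    using that by (simp add: linear_on_def act_add_left act_scale_left distrib_right act_add Sx A.scale_mult_left act_scale)
  have "act (S (x k)) (c * d) = ?s k (act one c * d)" by (simp add: act_one)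
  also have "\<dots> = (\<Sum>i\<in>I. \<Sum>g\<in>I. scaleA (m i g k) (\<Sum>a\<in>I. \<Sum>b\<in>I. scaleA (m a b i) (?s a (act (x b \<cdot> S (x g)) c * d))))"
    by (rule antipode_inversion[OF A.vector_space_axioms \<Phi> k, symmetric])
  also have "\<dots> = (\<Sum>i\<in>I. \<Sum>g\<in>I. scaleA (m i g k) (?s g c * ?s i d))"
  proof (intro sum.cong refl arg_cong[where f = "scaleA _"])
    fix i g assume i: "i \<in> I" and g: "g \<in> I"
    have "(\<Sum>a\<in>I. \<Sum>b\<in>I. scaleA (m a b i) (?s a (act (x b \<cdot> S (x g)) c * d)))
      = (\<Sum>a\<in>I. \<Sum>b\<in>I. scaleA (m a b i) (?s a (?X b (?s g c) * d)))"
      using g by (intro sum.cong refl) (simp add: XS)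
    also have "\<dots> = ?s g c * ?s i d" by (rule move[OF i])
    finally show "(\<Sum>a\<in>I. \<Sum>b\<in>I. scaleA (m a b i) (?s a (act (x b \<cdot> S (x g)) c * d))) = ?s g c * ?s i d" .
  qed
  finally show ?thesis .
qed

text \<open>
  This expresses on \<open>A\<close> that $\sum_j S(x_j) \otimes y_j$ is inverse to $\sum_i x_i \otimes y_i$.
\<close>

lemma act_R_inverse:
  "(\<Sum>j\<in>I. \<Sum>i\<in>I. act (y i) (act (y j) d) * act (x i) (act (S (x j)) c)) = d * c"
proof -
  have Sx: "S (x a) \<in> V" if "a \<in> I" for a using that by (simp add: antipode_closed x_closed)
  have "(\<Sum>j\<in>I. \<Sum>i\<in>I. act (y i) (act (y j) d) * act (x i) (act (S (x j)) c))
      = (\<Sum>j\<in>I. \<Sum>i\<in>I. \<Sum>l\<in>I. scaleA (m i j l) (act (y l) d * act (x i \<cdot> S (x j)) c))"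
    by (simp add: act_mult[symmetric] y_closed x_closed Sx y_mult act_sum_left scaled_closed act_scale_left
        sum_distrib_right A.scale_mult_left)
  also have "\<dots> = (\<Sum>l\<in>I. \<Sum>i\<in>I. \<Sum>j\<in>I. scaleA (m i j l) (act (y l) d * act (x i \<cdot> S (x j)) c))"
    by (subst sum.swap, subst sum.swap[of _ I I], subst (2) sum.swap) (rule refl)
  also have "\<dots> = (\<Sum>l\<in>I. act (y l) d * act (\<Sum>i\<in>I. \<Sum>j\<in>I. m i j l *s (x i \<cdot> S (x j))) c)"
    by (simp add: act_sum_left sum_closed scaled_closed mult_closed x_closed Sx act_scale_left sum_distrib_left A.scale_mult_right)
  also have "\<dots> = (\<Sum>l\<in>I. scaleA (\<epsilon> (x l)) (act (y l) d) * c)"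
    by (intro sum.cong refl)
      (simp add: antipode_right_x act_scale_left one_closed act_one A.scale_mult_left A.scale_mult_right)
  also have "\<dots> = act (\<Sum>l\<in>I. \<epsilon> (x l) *s y l) d * c"
    by (simp add: sum_distrib_right act_sum_left scaled_closed y_closed act_scale_left)
  also have "\<dots> = d * c" by (simp only: one_y[symmetric] act_one)
  finally show ?thesis .
qed

text \<open>
  For the bialgebra spanned by the \<open>x j\<close>, whose dual is spanned by the \<open>y j\<close>.
\<close>

lemma dual_actions_left:
  "dual_actions scaleA I n m (\<lambda>j. \<epsilon> (y j)) (\<lambda>j. \<epsilon> (x j)) (\<lambda>j. act (x j)) (\<lambda>j. act (y j))"
proof unfold_locales
  fix i j assume ij: "i \<in> I" "j \<in> I"
  show "act (x i) (act (x j) a) = (\<Sum>l\<in>I. scaleA (n i j l) (act (x l) a))" for a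
    using ij by (simp add: act_mult[symmetric] x_closed x_mult act_sum_left scaled_closed act_scale_left)
  show "act (y i) (act (y j) a) = (\<Sum>l\<in>I. scaleA (m i j l) (act (y l) a))" for a
    using ij by (simp add: act_mult[symmetric] y_closed y_mult act_sum_left scaled_closed act_scale_left)
next
  fix j assume j: "j \<in> I"
  show "act (y j) (a * b) = (\<Sum>c\<in>I. \<Sum>d\<in>I. scaleA (n c d j) (act (y d) a * act (y c) b))" for a b
    unfolding act_y_mult[OF j] by (rule sum.swap)
qed (fact finite_I n_assoc m_assoc n_unit m_unit compat_nm |
    simp add: n_support m_support act_add act_scale x_closed y_closed act_x_mult act_on_one)+

text \<open>
  For the bialgebra spanned by the \<open>y j\<close>.  Here the \<open>x j\<close> multiply in the wrong order, and the antipode corrects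
  this: both its reversal of products and its reversal of coproducts are needed.
\<close>

lemma dual_actions_right:
  "dual_actions scaleA I m (\<lambda>a b j. n b a j) (\<lambda>j. \<epsilon> (x j)) (\<lambda>j. \<epsilon> (y j)) (\<lambda>j. act (y j)) (\<lambda>j. act (S (x j)))"
proof unfold_locales
  have Sx: "S (x a) \<in> V" if "a \<in> I" for a using that by (simp add: antipode_closed x_closed)
  fix i j assume ij: "i \<in> I" "j \<in> I"
  show "act (y i) (act (y j) a) = (\<Sum>l\<in>I. scaleA (m i j l) (act (y l) a))" for a
    using ij by (simp add: act_mult[symmetric] y_closed y_mult act_sum_left scaled_closed act_scale_left)
  show "act (S (x i)) (act (S (x j)) a) = (\<Sum>l\<in>I. scaleA (n j i l) (act (S (x l)) a))" for a
    using ij by (simp add: act_mult[symmetric] Sx antipode_x_mult act_sum_left scaled_closed act_scale_left)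
next
  show "(\<Sum>g\<in>I. n j i g * n k g l) = (\<Sum>g\<in>I. n k j g * n g i l)" for i j k l
    by (rule n_assoc[symmetric])
  show "(\<Sum>l\<in>I. m i j l * n b a l) = (\<Sum>c\<in>I. \<Sum>d\<in>I. \<Sum>f\<in>I. \<Sum>g\<in>I. n d c i * n g f j * m c f a * m d g b)" for i j a b
  proof -
    have "(\<Sum>l\<in>I. m i j l * n b a l) = (\<Sum>l\<in>I. n b a l * m i j l)" by (simp add: mult.commute)
    also have "\<dots> = (\<Sum>d\<in>I. \<Sum>g\<in>I. \<Sum>c\<in>I. \<Sum>f\<in>I. m d g b * m c f a * n d c i * n g f j)" by (rule compat_nm)
    also have "\<dots> = (\<Sum>d\<in>I. \<Sum>c\<in>I. \<Sum>g\<in>I. \<Sum>f\<in>I. m d g b * m c f a * n d c i * n g f j)"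
      by (rule sum.cong[OF refl], rule sum.swap)
    also have "\<dots> = (\<Sum>c\<in>I. \<Sum>d\<in>I. \<Sum>f\<in>I. \<Sum>g\<in>I. m d g b * m c f a * n d c i * n g f j)"
      by (subst sum.swap, rule sum.cong[OF refl], rule sum.cong[OF refl], rule sum.swap)
    finally show ?thesis by (simp add: mult.commute mult.left_commute)
  qed
qed (fact finite_I m_assoc n_unit m_unit act_antipode_mult |
    simp add: n_support m_support act_add act_scale antipode_closed x_closed y_closed act_y_mult act_on_one counit_antipode_x)+

lemma lift_R_act: "lift2 (\<lambda>u v. act v b * act u a) R = (\<Sum>i\<in>I. act (y i) b * act (x i) a)"
proof -
  have "bilinear_on scale scale scaleA V V UNIV (\<lambda>u v. act v b * act u a)"
    by (simp add: bilinear_on_def linear_on_def act_add_left act_scale_left distrib_left distrib_right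
        A.scale_mult_left A.scale_mult_right)
  from pair2.lift_sum_tens[OF A.vector_space_axioms this, of I x y] show ?thesis
    by (simp add: R_eq x_closed y_closed)
qed

end

lemma sum_Times_product:
  fixes f :: "'i \<Rightarrow> 'k::field"
  shows "(\<Sum>p\<in>I \<times> J. f (fst p) * g (snd p)) = (\<Sum>i\<in>I. f i) * (\<Sum>j\<in>J. g j)"
  by (simp add: sum_product sum.cartesian_product case_prod_unfold)

lemma sum_Times_product2:
  fixes f f' :: "'i \<Rightarrow> 'k::field"
  shows "(\<Sum>p\<in>I \<times> J. f (fst p) * g (snd p) * (f' (fst p) * g' (snd p)))
    = (\<Sum>i\<in>I. f i * f' i) * (\<Sum>j\<in>J. g j * g' j)"
proof -
  have "(\<Sum>p\<in>I \<times> J. f (fst p) * g (snd p) * (f' (fst p) * g' (snd p)))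
      = (\<Sum>p\<in>I \<times> J. (f (fst p) * f' (fst p)) * (g (snd p) * g' (snd p)))"
    by (simp add: mult.assoc mult.left_commute)
  also have "\<dots> = (\<Sum>i\<in>I. f i * f' i) * (\<Sum>j\<in>J. g j * g' j)"
    by (rule sum_Times_product[of "\<lambda>i. f i * f' i" "\<lambda>j. g j * g' j"])
  finally show ?thesis .
qed

text \<open>
  The tensor product of two bialgebras, acting on \<open>A\<close> through commuting operators.
\<close>

lemma dual_actions_product:
  fixes J :: "'i set" and J' :: "'j set"
  assumes 1: "dual_actions s J w t e \<zeta> z u" and 2: "dual_actions s J' w' t' e' \<zeta>' z' u'"
    and comm: "\<And>i j a. i \<in> J \<Longrightarrow> j \<in> J' \<Longrightarrow> z i (z' j a) = z' j (z i a)"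
      "\<And>i j a. i \<in> J \<Longrightarrow> j \<in> J' \<Longrightarrow> u i (u' j a) = u' j (u i a)"
  shows "dual_actions s (J \<times> J') (\<lambda>p q r. w (fst p) (fst q) (fst r) * w' (snd p) (snd q) (snd r))
    (\<lambda>p q r. t (fst p) (fst q) (fst r) * t' (snd p) (snd q) (snd r))
    (\<lambda>p. e (fst p) * e' (snd p)) (\<lambda>p. \<zeta> (fst p) * \<zeta>' (snd p))
    (\<lambda>p a. z (fst p) (z' (snd p) a)) (\<lambda>p a. u (fst p) (u' (snd p) a))"
  (is "dual_actions _ ?J ?w ?t ?e ?\<zeta> ?z ?u")
proof -
  interpret D: dual_actions s J w t e \<zeta> z u by fact
  interpret D': dual_actions s J' w' t' e' \<zeta>' z' u' by fact
  have sumsA: "(\<Sum>p\<in>J \<times> J'. s (c (fst p) * d (snd p)) (f (fst p) (snd p)))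
      = (\<Sum>j\<in>J'. s (d j) (\<Sum>i\<in>J. s (c i) (f i j)))" for c d f
    by (simp add: sum.cartesian_product' D.scale_sum_right mult.commute) (rule sum.swap)
  show ?thesis
  proof (intro dual_actions.intro dual_actions_axioms.intro D.algebra_type_axioms)
    show "finite (?J)" using D.finite_index D'.finite_index by simp
  next
    fix i j l
    show "?w i j l \<noteq> 0 \<Longrightarrow> i \<in> ?J \<and> j \<in> ?J \<and> l \<in> ?J"
      using D.w_support[of "fst i" "fst j" "fst l"] D'.w_support[of "snd i" "snd j" "snd l"] by (auto simp: mem_Times_iff)
    show "?t i j l \<noteq> 0 \<Longrightarrow> i \<in> ?J \<and> j \<in> ?J \<and> l \<in> ?J"
      using D.t_support[of "fst i" "fst j" "fst l"] D'.t_support[of "snd i" "snd j" "snd l"] by (auto simp: mem_Times_iff)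
  next
    fix i j k l
    show "(\<Sum>g\<in>?J. ?w i j g * ?w g k l)
      = (\<Sum>g\<in>?J. ?w j k g * ?w i g l)"
      by (simp only: sum_Times_product2[of "w (fst i) (fst j)" "w' (snd i) (snd j)" "\<lambda>g. w g (fst k) (fst l)" "\<lambda>g. w' g (snd k) (snd l)"]
          sum_Times_product2[of "w (fst j) (fst k)" "w' (snd j) (snd k)" "\<lambda>g. w (fst i) g (fst l)" "\<lambda>g. w' (snd i) g (snd l)"]
          D.w_assoc D'.w_assoc)
    show "(\<Sum>g\<in>?J. ?t i j g * ?t g k l)
      = (\<Sum>g\<in>?J. ?t j k g * ?t i g l)"
      by (simp only: sum_Times_product2[of "t (fst i) (fst j)" "t' (snd i) (snd j)" "\<lambda>g. t g (fst k) (fst l)" "\<lambda>g. t' g (snd k) (snd l)"]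
          sum_Times_product2[of "t (fst j) (fst k)" "t' (snd j) (snd k)" "\<lambda>g. t (fst i) g (fst l)" "\<lambda>g. t' (snd i) g (snd l)"]
          D.t_coassoc D'.t_coassoc)
  next
    fix j l
    show "(\<Sum>g\<in>?J. ?e g * ?w g j l)
      = (if j = l \<and> j \<in> ?J then 1 else 0)"
      by (simp only: sum_Times_product2[of e e' "\<lambda>g. w g (fst j) (fst l)" "\<lambda>g. w' g (snd j) (snd l)"] D.w_unit_left D'.w_unit_left)
        (auto simp: prod_eq_iff mem_Times_iff)
    show "(\<Sum>g\<in>?J. ?e g * ?w j g l)
      = (if j = l \<and> j \<in> ?J then 1 else 0)"
      by (simp only: sum_Times_product2[of e e' "\<lambda>g. w (fst j) g (fst l)" "\<lambda>g. w' (snd j) g (snd l)"] D.w_unit_right D'.w_unit_right)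
        (auto simp: prod_eq_iff mem_Times_iff)
    show "(\<Sum>g\<in>?J. ?\<zeta> g * ?t g j l)
      = (if j = l \<and> j \<in> ?J then 1 else 0)"
      by (simp only: sum_Times_product2[of \<zeta> \<zeta>' "\<lambda>g. t g (fst j) (fst l)" "\<lambda>g. t' g (snd j) (snd l)"] D.t_counit D'.t_counit)
        (auto simp: prod_eq_iff mem_Times_iff)
  next
    fix i j a b :: "'i \<times> 'j"
    let ?F = "\<lambda>c d f g. t c d (fst i) * t f g (fst j) * w c f (fst a) * w d g (fst b)"
    let ?G = "\<lambda>c d f g. t' c d (snd i) * t' f g (snd j) * w' c f (snd a) * w' d g (snd b)"
    have "(\<Sum>l\<in>?J. ?w i j l * ?t a b l)
      = (\<Sum>c\<in>J. \<Sum>d\<in>J. \<Sum>f\<in>J. \<Sum>g\<in>J. ?F c d f g) * (\<Sum>c\<in>J'. \<Sum>d\<in>J'. \<Sum>f\<in>J'. \<Sum>g\<in>J'. ?G c d f g)"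
      by (simp only: sum_Times_product2[of "w (fst i) (fst j)" "w' (snd i) (snd j)" "t (fst a) (fst b)" "t' (snd a) (snd b)"] D.compat D'.compat)
    also have "\<dots> = (\<Sum>c\<in>?J. \<Sum>d\<in>?J. \<Sum>f\<in>?J. \<Sum>g\<in>?J.
        ?F (fst c) (fst d) (fst f) (fst g) * ?G (snd c) (snd d) (snd f) (snd g))"
      by (simp only: sum_Times_product[symmetric])
    also have "\<dots> = (\<Sum>c\<in>?J. \<Sum>d\<in>?J. \<Sum>f\<in>?J. \<Sum>g\<in>?J. ?t c d i * ?t f g j * ?w c f a * ?w d g b)"
      by (simp add: mult.assoc mult.left_commute)
    finally show "(\<Sum>l\<in>?J. ?w i j l * ?t a b l)
      = (\<Sum>c\<in>?J. \<Sum>d\<in>?J. \<Sum>f\<in>?J. \<Sum>g\<in>?J. ?t c d i * ?t f g j * ?w c f a * ?w d g b)" .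
  next
    fix p assume "p \<in> ?J"
    then have p: "fst p \<in> J" "snd p \<in> J'" by auto
    show "Vector_Spaces.linear s s (?z p)"
      using p by (simp add: Vector_Spaces.linear_iff D.vector_space_axioms D.z_add D'.z_add D.z_scale D'.z_scale)
    show "Vector_Spaces.linear s s (?u p)"
      using p by (simp add: Vector_Spaces.linear_iff D.vector_space_axioms D.u_add D'.u_add D.u_scale D'.u_scale)
    show "?z p 1 = s (\<zeta> (fst p) * \<zeta>' (snd p)) 1"
      using p by (simp add: D'.z_one D.z_scale D.z_one mult.commute)
    show "?u p 1 = s (e (fst p) * e' (snd p)) 1"
      using p by (simp add: D'.u_one D.u_scale D.u_one mult.commute)
    have pairs: "(\<Sum>a\<in>J'. \<Sum>b\<in>J'. \<Sum>c\<in>J. \<Sum>d\<in>J. F a b c d)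
      = (\<Sum>q\<in>?J. \<Sum>r\<in>?J. F (snd q) (snd r) (fst q) (fst r))" for F :: "_ \<Rightarrow> _ \<Rightarrow> _ \<Rightarrow> _ \<Rightarrow> 'b"
    proof -
      have "(\<Sum>a\<in>J'. \<Sum>b\<in>J'. \<Sum>c\<in>J. \<Sum>d\<in>J. F a b c d) = (\<Sum>a\<in>J'. \<Sum>c\<in>J. \<Sum>b\<in>J'. \<Sum>d\<in>J. F a b c d)"
        by (rule sum.cong[OF refl], rule sum.swap)
      also have "\<dots> = (\<Sum>c\<in>J. \<Sum>a\<in>J'. \<Sum>d\<in>J. \<Sum>b\<in>J'. F a b c d)"
        by (subst sum.swap, rule sum.cong[OF refl], rule sum.cong[OF refl], rule sum.swap)
      finally show ?thesis by (simp add: sum.cartesian_product')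
    qed
    show "?z p (a * b) = (\<Sum>q\<in>?J. \<Sum>r\<in>?J. s (?t q r p) (?z q a * ?z r b))" for a b
      using p by (simp add: D'.z_mult D.z_mult D.z_sum D.z_scale D.scale_sum_right pairs mult.commute)
    show "?u p (a * b) = (\<Sum>q\<in>?J. \<Sum>r\<in>?J. s (?w q r p) (?u r a * ?u q b))" for a b
      using p by (simp add: D'.u_mult D.u_mult D.u_sum D.u_scale D.scale_sum_right pairs mult.commute)
  next
    fix p q a assume "p \<in> ?J" "q \<in> ?J"
    then have pq: "fst p \<in> J" "snd p \<in> J'" "fst q \<in> J" "snd q \<in> J'" by auto
    have "?z p (?z q a) = z (fst p) (z (fst q) (z' (snd p) (z' (snd q) a)))"
      using pq by (simp add: comm)
    then show "?z p (?z q a) = (\<Sum>r\<in>?J. s (?w p q r) (?z r a))"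
      using pq sumsA[of "w (fst p) (fst q)" "w' (snd p) (snd q)" "\<lambda>i j. z i (z' j a)"]
      by (simp add: D.z_comp D'.z_comp D.z_sum D.z_scale)
    have "?u p (?u q a) = u (fst p) (u (fst q) (u' (snd p) (u' (snd q) a)))"
      using pq by (simp add: comm)
    then show "?u p (?u q a) = (\<Sum>r\<in>?J. s (?t p q r) (?u r a))"
      using pq sumsA[of "t (fst p) (fst q)" "t' (snd p) (snd q)" "\<lambda>i j. u i (u' j a)"]
      by (simp add: D.u_comp D'.u_comp D.u_sum D.u_scale)
  qed
qed

section \<open>The divisibility theorem\<close>

theorem theorem2p5:
  fixes scaleH :: "'k::field \<Rightarrow> 'h::ring_1 \<Rightarrow> 'h"
    and \<Delta> :: "'h \<Rightarrow> ('h, 'h, 'k) tensor" and \<epsilon> :: "'h \<Rightarrow> 'k" and S :: "'h \<Rightarrow> 'h"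
    and scaleA :: "'k \<Rightarrow> 'a::ring_1 \<Rightarrow> 'a" and act :: "'h \<Rightarrow> 'a \<Rightarrow> 'a"
    and E :: "('a \<Rightarrow> 'a) set"
    and \<Delta>E :: "('a \<Rightarrow> 'a) \<Rightarrow> ('a \<Rightarrow> 'a, 'a \<Rightarrow> 'a, 'k) tensor"
    and \<epsilon>E :: "('a \<Rightarrow> 'a) \<Rightarrow> 'k" and SE :: "('a \<Rightarrow> 'a) \<Rightarrow> ('a \<Rightarrow> 'a)"
    and R :: "('h, 'h, 'k) tensor" and R' :: "('a \<Rightarrow> 'a, 'a \<Rightarrow> 'a, 'k) tensor"
  assumes "module_algebra scaleH UNIV (*) 1 \<Delta> \<epsilon> S scaleA act"
    and "finite_dim scaleH UNIV"
    and "dual_galois scaleH UNIV scaleA act"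
    and "E = module_End UNIV scaleA act"
    and "module_algebra (fun_scale scaleA) E (\<circ>) id \<Delta>E \<epsilon>E SE scaleA (\<lambda>\<phi>. \<phi>)"
    and "quasitriangular_on scaleH UNIV (*) 1 \<Delta> \<epsilon> S R"
    and "quasitriangular_on (fun_scale scaleA) E (\<circ>) id \<Delta>E \<epsilon>E SE R'"
    and "corresponding scaleH UNIV scaleA act E R R'"
    and "central_simple scaleA"
  shows "vector_space.dim scaleA (UNIV :: 'a set)
    dvd tensor_rank scaleH UNIV R * tensor_rank (fun_scale scaleA) E R'"
proof -
  interpret A: algebra_type scaleA
    using assms(1) by (simp add: module_algebra_def algebra_type_def)
  obtain I x y n m where "quasitriangular_coordinates scaleH UNIV (*) 1 \<Delta> \<epsilon> S R I x y n m"
    using quasitriangular_on.exists_coordinates[OF assms(6)] by blast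
  then interpret H: quasitriangular_module_algebra scaleH UNIV "(*)" 1 \<Delta> \<epsilon> S R I x y n m scaleA act
    using assms(1) by (rule quasitriangular_module_algebra.intro)
  obtain I' p q n' m' where "quasitriangular_coordinates (fun_scale scaleA) E (\<circ>) id \<Delta>E \<epsilon>E SE R' I' p q n' m'"
    using quasitriangular_on.exists_coordinates[OF assms(7)] by blast
  then interpret E: quasitriangular_module_algebra "fun_scale scaleA" E "(\<circ>)" id \<Delta>E \<epsilon>E SE R' I' p q n' m'
      scaleA "\<lambda>\<phi>. \<phi>"
    using assms(5) by (rule quasitriangular_module_algebra.intro)
  have comm: "\<phi> (act h a) = act h (\<phi> a)" if "\<phi> \<in> E" for \<phi> h a
    using that unfolding assms(4) module_End_def by blast
  obtain B where B: "finite B" "A.independent B" "A.span B = UNIV"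
  proof -
    obtain C where C: "finite C" "H.span C = UNIV" using assms(2) by (auto simp: finite_dim_def)
    interpret T: subspace_pair scaleA scaleH UNIV UNIV
      by (intro subspace_pair.intro A.vector_space_axioms H.vector_space_axioms A.subspace_UNIV H.subspace_UNIV)
    have bil: "bilinear_on scaleA scaleH (fun_scale scaleA) UNIV UNIV UNIV (\<lambda>a h b. a * act h b)"
      by (simp add: bilinear_on_def linear_on_def fun_scale_def fun_eq_iff H.act_add_left H.act_scale_left
          distrib_left distrib_right A.scale_mult_left A.scale_mult_right)
    \<comment> \<open>By surjectivity of the Galois map, the operators of a spanning set of \<open>H\<close> generate the
      endomorphisms of \<open>A\<close> as a left \<open>A\<close>-module.\<close>
    have gen: "\<exists>c. \<forall>b. f b = (\<Sum>h\<in>C. c h * act h b)" if f: "Vector_Spaces.linear scaleA scaleA f" for f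
    proof -
      have "f \<in> galois_map scaleH UNIV scaleA act ` tensor_space scaleA scaleH UNIV UNIV"
        using assms(3) f unfolding dual_galois_def bij_betw_def by blast
      then obtain t where t: "t \<in> tensor_space scaleA scaleH UNIV UNIV" "f = galois_map scaleH UNIV scaleA act t"
        by blast
      obtain N :: nat and a h where ah: "t = (\<Sum>i<N. tens scaleA scaleH (a i) (h i))"
        by (rule T.tensor_space_sum[OF t(1)]) blast
      have f_eq: "f = (\<Sum>i<N. (\<lambda>b. a i * act (h i) b))"
        unfolding t(2) ah galois_map_def
        by (rule T.lift_sum_tens[OF vector_space_fun_scale[OF A.vector_space_axioms] bil]) simp_all
      have "\<exists>r. v = (\<Sum>g\<in>C. scaleH (r g) g)" for v using C H.span_finite[OF C(1)] by auto
      then have "\<forall>i. \<exists>r. h i = (\<Sum>g\<in>C. scaleH (r g) g)" by (rule allI)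
      from choice[OF this] obtain r where "\<forall>i. h i = (\<Sum>g\<in>C. scaleH (r i g) g)" by (rule exE)
      then have r: "h i = (\<Sum>g\<in>C. scaleH (r i g) g)" for i by (rule spec)
      have "f b = (\<Sum>g\<in>C. (\<Sum>i<N. scaleA (r i g) (a i)) * act g b)" for b
      proof -
        have "f b = (\<Sum>i<N. a i * act (h i) b)" by (simp add: f_eq sum_fun_apply)
        also have "\<dots> = (\<Sum>i<N. \<Sum>g\<in>C. scaleA (r i g) (a i) * act g b)"
          by (simp add: r H.act_sum_left H.act_scale_left sum_distrib_left A.scale_mult_left A.scale_mult_right)
        also have "\<dots> = (\<Sum>g\<in>C. (\<Sum>i<N. scaleA (r i g) (a i)) * act g b)"
          by (subst sum.swap) (simp add: sum_distrib_right)
        finally show ?thesis .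
      qed
      then show ?thesis by (intro exI[of _ "\<lambda>g. \<Sum>i<N. scaleA (r i g) (a i)"]) simp
    qed
    show ?thesis
      by (rule A.finite_dim_if_finitely_many_operators_generate[of C act]) (use C gen that in auto)
  qed
  \<comment> \<open>The bialgebra is spanned by the products of the \<open>y i\<close> and the \<open>p k\<close>, hence the two different
    dual actions.\<close>
  let ?w = "\<lambda>i j l. m (fst i) (fst j) (fst l) * n' (snd i) (snd j) (snd l)"
  let ?t = "\<lambda>i j l. n (fst j) (fst i) (fst l) * m' (snd i) (snd j) (snd l)"
  let ?e = "\<lambda>j. \<epsilon> (x (fst j)) * \<epsilon>E (q (snd j))" and ?\<zeta> = "\<lambda>j. \<epsilon> (y (fst j)) * \<epsilon>E (p (snd j))"
  let ?z = "\<lambda>j a. act (y (fst j)) (p (snd j) a)" and ?u = "\<lambda>j a. act (S (x (fst j))) (q (snd j) a)"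
  have dual: "dual_actions scaleA (I \<times> I') ?w ?t ?e ?\<zeta> ?z ?u"
    by (rule dual_actions_product[OF H.dual_actions_right E.dual_actions_left])
      (simp_all add: comm E.x_closed E.y_closed)
  have corr: "(\<Sum>i\<in>I. act (y i) b * act (x i) a) = (\<Sum>k\<in>I'. q k a * p k b)" for a b
    using assms(8) unfolding corresponding_def H.lift_R_act E.lift_R_act by blast
  interpret braided_commutative_dual_actions scaleA "I \<times> I'" ?w ?t ?e ?\<zeta> ?z ?u B
  proof (intro braided_commutative_dual_actions.intro dual central_simple_algebra.intro A.algebra_type_axioms
      central_simple_algebra_axioms.intro braided_commutative_dual_actions_axioms.intro)
    show "central_simple scaleA" "finite B" "A.independent B" "A.span B = UNIV" by fact+
    fix c d
    \<comment> \<open>The sum over the second index is rewritten by the correspondence and becomes the product of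
      \<open>R\<close> with its inverse.\<close>
    have "(\<Sum>j\<in>I \<times> I'. ?u j c * ?z j d) = (\<Sum>j\<in>I. \<Sum>k\<in>I'. q k (act (S (x j)) c) * p k (act (y j) d))"
      by (simp add: sum.cartesian_product' comm E.x_closed E.y_closed)
    also have "\<dots> = d * c" by (simp only: corr[symmetric] H.act_R_inverse)
    finally show "(\<Sum>j\<in>I \<times> I'. ?u j c * ?z j d) = d * c" .
  qed
  have "A.dim UNIV = card B" using A.basis_card_eq_dim[of B UNIV] B by simp
  moreover have "card B dvd card I * card I'" using dim_dvd_card_index by (simp add: card_cartesian_product)
  ultimately show ?thesis by (simp add: H.tensor_rank_eq E.tensor_rank_eq)
qed

end
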